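(* Let $X$ be a space having the homotopy type of a finite simplicial complex, write $\chi=\chi(X)$ for its Euler characteristic, and let $2\leq d\leq n$. Then $$\chi\big(B_d(X,n)\big)=\binom{\chi+n-1}{\chi-1}-\sum_{(\alpha_1,\ldots,\alpha_{d-1})}\frac{1}{\alpha_1!\cdots\alpha_{d-1}!}\,\chi(\chi-1)\cdots\Big(\chi-\sum_{i=1}^{d-1}\alpha_i+1\Big),$$ where the sum runs over all sequences of non-negative integers $(\alpha_1,\ldots,\alpha_{d-1})$ with $\sum_{i=1}^{d-1} i\alpha_i=n$, and $\binom{\chi+n-1}{\chi-1}$ is to be read as the polynomial $\frac{(\chi+n-1)(\chi+n-2)\cdots\chi}{n!}$ in $\chi$. In particular $\chi(B_d(X,n))=0$ whenever $\chi(X)=0$.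
   Context: For a space $X$ and $n\geq 1$, $SP^n(X)=X^n/\mathfrak S_n$ is the $n$-th symmetric product (quotient by permutation of coordinates). For $1\le d\le n$, $F_d(X,n)=\{(x_1,\ldots,x_n)\in X^n : x_{i_1}=\cdots=x_{i_d}\text{ for some }1\leq i_1<\cdots<i_d\leq n\}$ and $B_d(X,n)=F_d(X,n)/\mathfrak S_n\subset SP^n(X)$. The Euler characteristic is $\chi(Y)=\sum_i(-1)^i\operatorname{rank}H_i(Y;\mathbb Z)$. *)

theory Defs
  imports "HOL-Analysis.Analysis" "HOL-Library.Multiset"
begin

definition standard_simplex :: "nat \<Rightarrow> (nat \<Rightarrow> real) set" where
  "standard_simplex p =
     {x. (\<forall>i. 0 \<le> x i \<and> x i \<le> 1) \<and> (\<forall>i>p. x i = 0) \<and> (\<Sum>i\<le>p. x i) = 1}"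

definition singular_simplex :: "nat \<Rightarrow> 'a topology \<Rightarrow> ((nat \<Rightarrow> real) \<Rightarrow> 'a) \<Rightarrow> bool" where
  "singular_simplex p X f \<longleftrightarrow>
     continuous_map (subtopology (powertop_real UNIV) (standard_simplex p)) X f
     \<and> f \<in> extensional (standard_simplex p)"

definition simplical_face :: "nat \<Rightarrow> (nat \<Rightarrow> real) \<Rightarrow> (nat \<Rightarrow> real)" where
  "simplical_face k x = (\<lambda>i. if i < k then x i else if i = k then 0 else x (i - 1))"

definition singular_face :: "nat \<Rightarrow> nat \<Rightarrow> ((nat \<Rightarrow> real) \<Rightarrow> 'a) \<Rightarrow> ((nat \<Rightarrow> real) \<Rightarrow> 'a)" where
  "singular_face p k f = restrict (f \<circ> simplical_face k) (standard_simplex (p - 1))"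

definition singular_chain :: "nat \<Rightarrow> 'a topology \<Rightarrow> (((nat \<Rightarrow> real) \<Rightarrow> 'a) \<Rightarrow> int) \<Rightarrow> bool" where
  "singular_chain p X c \<longleftrightarrow>
     finite {f. c f \<noteq> 0} \<and> (\<forall>f. c f \<noteq> 0 \<longrightarrow> singular_simplex p X f)"

definition chain_boundary :: "nat \<Rightarrow> (((nat \<Rightarrow> real) \<Rightarrow> 'a) \<Rightarrow> int) \<Rightarrow> (((nat \<Rightarrow> real) \<Rightarrow> 'a) \<Rightarrow> int)" where
  "chain_boundary p c =
     (if p = 0 then (\<lambda>g. 0)
      else (\<lambda>g. \<Sum>f\<in>{f. c f \<noteq> 0}. \<Sum>k\<le>p. if singular_face p k f = g then (-1) ^ k * c f else 0))"

definition singular_cycles :: "nat \<Rightarrow> 'a topology \<Rightarrow> (((nat \<Rightarrow> real) \<Rightarrow> 'a) \<Rightarrow> int) set" where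
  "singular_cycles p X = {c. singular_chain p X c \<and> chain_boundary p c = (\<lambda>g. 0)}"

definition singular_boundaries :: "nat \<Rightarrow> 'a topology \<Rightarrow> (((nat \<Rightarrow> real) \<Rightarrow> 'a) \<Rightarrow> int) set" where
  "singular_boundaries p X = {chain_boundary (Suc p) d | d. singular_chain (Suc p) X d}"

text \<open>Rank of H_p(X;Z) = Z_p / B_p: the maximal size of a finite family of cycles that is
  Z-linearly independent modulo boundaries.\<close>
definition homology_rank :: "nat \<Rightarrow> 'a topology \<Rightarrow> nat" where
  "homology_rank p X =
     Sup {card S | S. finite S \<and> S \<subseteq> singular_cycles p X \<and>
            (\<forall>a :: (((nat \<Rightarrow> real) \<Rightarrow> 'a) \<Rightarrow> int) \<Rightarrow> int.
               (\<lambda>f. \<Sum>c\<in>S. a c * c f) \<in> singular_boundaries p X \<longrightarrow> (\<forall>c\<in>S. a c = 0))}"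

definition euler_char :: "'a topology \<Rightarrow> int" where
  "euler_char X = (\<Sum>i\<in>{i. homology_rank i X \<noteq> 0}. (-1) ^ i * int (homology_rank i X))"

definition quotient_topology :: "'a topology \<Rightarrow> ('a \<Rightarrow> 'b) \<Rightarrow> 'b topology" where
  "quotient_topology Y q =
     topology (\<lambda>U. U \<subseteq> q ` topspace Y \<and> openin Y {x \<in> topspace Y. q x \<in> U})"

text \<open>The orbit of (x_0,...,x_{n-1}) under permutation of coordinates is identified with
  the multiset of its entries.\<close>
definition sym_quot :: "nat \<Rightarrow> (nat \<Rightarrow> 'a) \<Rightarrow> 'a multiset" where
  "sym_quot n x = image_mset x (mset_set {..<n})"

definition symprod :: "nat \<Rightarrow> 'a topology \<Rightarrow> 'a multiset topology" where
  "symprod n X = quotient_topology (product_topology (\<lambda>i. X) {..<n}) (sym_quot n)"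

definition fat_diag :: "nat \<Rightarrow> 'a topology \<Rightarrow> nat \<Rightarrow> (nat \<Rightarrow> 'a) set" where
  "fat_diag d X n =
     {x \<in> topspace (product_topology (\<lambda>i. X) {..<n}).
        \<exists>I \<subseteq> {..<n}. card I = d \<and> (\<forall>i\<in>I. \<forall>j\<in>I. x i = x j)}"

definition Bd_space :: "nat \<Rightarrow> 'a topology \<Rightarrow> nat \<Rightarrow> 'a multiset topology" where
  "Bd_space d X n = subtopology (symprod n X) (sym_quot n ` fat_diag d X n)"

end

theory Submission
  imports "HOL-Homology.Homology" Defs
begin

text \<open>Both sides depend only on the homotopy type of \<open>X\<close>, so let \<open>X\<close> be the polyhedron of an ordered
  simplicial complex \<open>K\<close>, viewed as a simplicial set. The space \<open>B\<^sub>d(X, n)\<close> is then decomposed into one open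
  \<open>m\<close>-simplex for every nondegenerate \<open>m\<close>-simplex of the simplicial set \<open>m \<mapsto> B\<^sub>d(K\<^sub>m, n)\<close>, and attaching an
  \<open>m\<close>-cell changes the Euler characteristic by \<open>(-1)\<^sup>m\<close>. If a simplicial set has \<open>c\<^sub>k\<close> nondegenerate
  \<open>k\<close>-simplices, then it has \<open>\<Sum>\<^sub>k c\<^sub>k (m choose k)\<close> simplices of dimension \<open>m\<close>, which is a polynomial in \<open>m\<close>
  whose value at \<open>m = -1\<close> is the Euler characteristic \<open>\<Sum>\<^sub>k (-1)\<^sup>k c\<^sub>k\<close>. Now \<open>B\<^sub>d(S, n)\<close> has \<open>P(card S)\<close>
  elements for a finite set \<open>S\<close>, where \<open>P\<close> is the polynomial on the right-hand side of the theorem. Hence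
  the polynomials for \<open>B\<^sub>d(K, n)\<close> and \<open>K\<close> are related by \<open>P\<close> for all \<open>m \<ge> 0\<close>, and therefore also
  at \<open>m = -1\<close>.\<close>

section \<open>Ranks of abelian groups\<close>

text \<open>Permuting coordinates does no harm because \<open>X^n\<close> is cut into cells by the
  relative order of all partial sums of all its coordinates: a permutation mapping such a cell to
  itself fixes it pointwise, so the cells descend to the quotient and the characteristic maps stay
  injective on open simplices. One encoding serves both sides: points and simplices are monotone
  staircases with values in the reals or in an initial segment of the naturals, and monotone
  relabelling of values gives simplicial operators, characteristic maps and normal forms alike. The
  value of \<chi>(X) needs no separate argument: it is the instance d = n = 1, where the space is X
  itself. The obstacle is that the given rank is a supremum of natural numbers and the given Euler
  characteristic a sum over a possibly infinite set, so neither can be manipulated before finiteness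
  is known. Hence rank is first treated as a relation, and finiteness is carried through every
  homotopy equivalence and every attachment of a cell.\<close>

text \<open>Fraction-free Gaussian elimination: one pivot row is spent per column, and with more
  rows than columns a row is left over to carry a nontrivial relation.\<close>

lemma int_left_kernel:
  fixes M :: "'i \<Rightarrow> nat \<Rightarrow> int"
  assumes "finite I" "card I > r"
  shows "\<exists>c. (\<exists>i\<in>I. c i \<noteq> 0) \<and> (\<forall>j<r. (\<Sum>i\<in>I. c i * M i j) = 0)"
  using assms
proof (induction r arbitrary: I M)
  case 0
  then obtain i where "i \<in> I" by fastforce
  then show ?case by (intro exI[of _ "\<lambda>_. 1"]) auto
next
  case (Suc r)
  show ?case
  proof (cases "\<exists>p\<in>I. M p r \<noteq> 0")
    case False
    obtain c where "\<exists>i\<in>I. c i \<noteq> 0" "\<forall>j<r. (\<Sum>i\<in>I. c i * M i j) = 0"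
      using Suc.IH[of I M] Suc.prems by auto
    with False show ?thesis
      by (intro exI[of _ c]) (auto simp: less_Suc_eq)
  next
    case True
    then obtain p where p: "p \<in> I" "M p r \<noteq> 0" by blast
    \<comment> \<open>Each row is scaled by the pivot entry and then cleared in column
      \<open>r\<close> by a multiple of the pivot row, without division.\<close>
    define M' where "M' = (\<lambda>i j. M p r * M i j - M i r * M p j)"
    have "r < card (I - {p})"
      using p Suc.prems by simp
    then obtain c where c: "\<exists>i\<in>I-{p}. c i \<noteq> 0" "\<forall>j<r. (\<Sum>i\<in>I-{p}. c i * M' i j) = 0"
      using Suc.IH[of "I - {p}" M'] Suc.prems by auto
    \<comment> \<open>Unfolds a relation among cleared rows; the pivot row collects the multiples
      that were subtracted from the others.\<close>
    define c' where "c' = (\<lambda>i. if i = p then - (\<Sum>i\<in>I-{p}. c i * M i r) else c i * M p r)"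
    have eq: "(\<Sum>i\<in>I. c' i * M i j) = (\<Sum>i\<in>I-{p}. c i * M' i j)" for j
    proof -
      have "(\<Sum>i\<in>I. c' i * M i j) = c' p * M p j + (\<Sum>i\<in>I-{p}. c' i * M i j)"
        using p Suc.prems by (simp add: sum.remove)
      also have "(\<Sum>i\<in>I-{p}. c' i * M i j) = (\<Sum>i\<in>I-{p}. c i * M p r * M i j)"
        by (intro sum.cong) (auto simp: c'_def)
      finally show ?thesis
        by (simp add: c'_def M'_def left_diff_distrib right_diff_distrib sum_subtractf sum_distrib_left sum_distrib_right ac_simps)
    qed
    have "M' i r = 0" for i by (simp add: M'_def)
    then have "\<forall>j<Suc r. (\<Sum>i\<in>I. c' i * M i j) = 0"
      using c by (auto simp: eq less_Suc_eq)
    moreover have "\<exists>i\<in>I. c' i \<noteq> 0"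
      using c p by (auto simp: c'_def)
    ultimately show ?thesis by blast
  qed
qed

primrec lincomb :: "('g, 'b) monoid_scheme \<Rightarrow> (nat \<Rightarrow> 'g) \<Rightarrow> nat \<Rightarrow> (nat \<Rightarrow> int) \<Rightarrow> 'g" where
  "lincomb G e 0 a = \<one>\<^bsub>G\<^esub>"
| "lincomb G e (Suc n) a = lincomb G e n a \<otimes>\<^bsub>G\<^esub> (e n [^]\<^bsub>G\<^esub> a n)"

definition independent_family :: "('g, 'b) monoid_scheme \<Rightarrow> (nat \<Rightarrow> 'g) \<Rightarrow> nat \<Rightarrow> bool" where
  "independent_family G e r \<longleftrightarrow> (\<forall>a. lincomb G e r a = \<one>\<^bsub>G\<^esub> \<longrightarrow> (\<forall>i<r. a i = 0))"

text \<open>The family becomes a basis of the subgroup \<open>C\<close> after tensoring with the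
  rationals: it is independent, and each element of \<open>C\<close> has a nonzero multiple in its
  span. A relation rather than a function, since it also asserts that the rank is finite.\<close>

definition has_rank :: "('g, 'b) monoid_scheme \<Rightarrow> 'g set \<Rightarrow> nat \<Rightarrow> bool" where
  "has_rank G C r \<longleftrightarrow> (\<exists>e. (\<forall>i<r. e i \<in> C) \<and> independent_family G e r \<and>
     (\<forall>x\<in>C. \<exists>k a. k \<noteq> 0 \<and> x [^]\<^bsub>G\<^esub> (k::int) = lincomb G e r a))"

lemma lincomb_cong:
  "(\<And>i. i < n \<Longrightarrow> e i = e' i) \<Longrightarrow> (\<And>i. i < n \<Longrightarrow> a i = a' i) \<Longrightarrow> lincomb G e n a = lincomb G e' n a'"
  by (induction n) auto

context comm_group
begin

lemma lincomb_closed: "(\<And>i. i < n \<Longrightarrow> e i \<in> carrier G) \<Longrightarrow> lincomb G e n a \<in> carrier G"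
  by (induction n) auto

lemma lincomb_in_subgroup:
  "subgroup C G \<Longrightarrow> (\<And>i. i < n \<Longrightarrow> e i \<in> C) \<Longrightarrow> lincomb G e n a \<in> C"
  by (induction n) (auto intro: subgroup.one_closed subgroup.m_closed subgroup_int_pow_closed)

lemma lincomb_zero: "(\<And>i. i < n \<Longrightarrow> a i = 0) \<Longrightarrow> lincomb G e n a = \<one>"
  by (induction n) auto

lemma lincomb_add:
  "(\<And>i. i < n \<Longrightarrow> e i \<in> carrier G) \<Longrightarrow>
    lincomb G e n (\<lambda>i. a i + b i) = lincomb G e n a \<otimes> lincomb G e n b"
proof (induction n)
  case (Suc n)
  then have "lincomb G e n a \<in> carrier G" "lincomb G e n b \<in> carrier G" "e n \<in> carrier G"
    by (auto intro: lincomb_closed)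
  with Suc show ?case
    by (simp add: int_pow_mult m_ac)
qed auto

lemma lincomb_scale:
  "(\<And>i. i < n \<Longrightarrow> e i \<in> carrier G) \<Longrightarrow>
    lincomb G e n (\<lambda>i. a i * k) = lincomb G e n a [^] (k::int)"
proof (induction n)
  case (Suc n)
  then have "lincomb G e n a \<in> carrier G" "e n \<in> carrier G"
    by (auto intro: lincomb_closed)
  with Suc show ?case
    by (simp add: int_pow_distrib int_pow_pow)
qed auto

lemma lincomb_append:
  assumes "\<And>i. i < n + m \<Longrightarrow> e i \<in> carrier G"
  shows "lincomb G e (n + m) a = lincomb G e n a \<otimes> lincomb G (\<lambda>i. e (n + i)) m (\<lambda>i. a (n + i))"
  using assms
proof (induction m)
  case 0
  then show ?case by (simp add: lincomb_closed)
next
  case (Suc m)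
  then have "lincomb G e n a \<in> carrier G" "e (n + m) \<in> carrier G"
    "lincomb G (\<lambda>i. e (n + i)) m (\<lambda>i. a (n + i)) \<in> carrier G"
    by (auto intro!: lincomb_closed)
  with Suc show ?case by (simp add: m_assoc)
qed

lemma lincomb_subst:
  assumes "\<And>i. i < n \<Longrightarrow> s i \<in> carrier G" "\<And>j. j < r \<Longrightarrow> t j \<in> carrier G"
    and "\<And>i. i < n \<Longrightarrow> s i [^] (k i :: int) = lincomb G t r (M i)"
  shows "lincomb G s n (\<lambda>i. k i * c i) = lincomb G t r (\<lambda>j. \<Sum>i<n. c i * M i j)"
  using assms
proof (induction n)
  case 0
  then show ?case by (simp add: lincomb_zero)
next
  case (Suc n)
  have "s n [^] (k n * c n) = lincomb G t r (\<lambda>j. M n j * c n)"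
    using Suc.prems by (simp add: lincomb_scale flip: int_pow_pow)
  moreover have "lincomb G s n (\<lambda>i. k i * c i) = lincomb G t r (\<lambda>j. \<Sum>i<n. c i * M i j)"
    using Suc by simp
  ultimately show ?case
    using Suc.prems lincomb_add[of r t "\<lambda>j. \<Sum>i<n. c i * M i j" "\<lambda>j. M n j * c n"]
    by (simp add: mult.commute)
qed

text \<open>Exchange argument: nonzero multiples of the \<open>s i\<close> are combinations of
  \<open>r\<close> elements; if \<open>n > r\<close>, the coefficient rows satisfy a nontrivial
  integer relation, which becomes one between the \<open>s i\<close>.\<close>

lemma independent_le_rank:
  assumes "subgroup C G" "has_rank G C r" "\<And>i. i < n \<Longrightarrow> s i \<in> C" "independent_family G s n"
  shows "n \<le> r"
proof (rule ccontr)
  assume "\<not> n \<le> r"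
  obtain t where t: "\<forall>i<r. t i \<in> C"
      "\<forall>x\<in>C. \<exists>k a. k \<noteq> 0 \<and> x [^] (k::int) = lincomb G t r a"
    using assms(2) unfolding has_rank_def by blast
  then have "\<forall>i<n. \<exists>k a. k \<noteq> 0 \<and> s i [^] (k::int) = lincomb G t r a"
    using assms(3) by blast
  then obtain k M where k: "\<And>i. i < n \<Longrightarrow> (k i :: int) \<noteq> 0"
      "\<And>i. i < n \<Longrightarrow> s i [^] k i = lincomb G t r (M i)"
    by metis
  obtain c where c: "\<exists>i\<in>{..<n}. c i \<noteq> 0" "\<forall>j<r. (\<Sum>i<n. c i * M i j) = 0"
    using int_left_kernel[of "{..<n}" r M] \<open>\<not> n \<le> r\<close> by auto
  have "lincomb G s n (\<lambda>i. k i * c i) = lincomb G t r (\<lambda>j. \<Sum>i<n. c i * M i j)"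
    using assms(1,3) t k by (intro lincomb_subst) (auto intro: subgroup.mem_carrier)
  also have "\<dots> = \<one>" using c by (intro lincomb_zero) auto
  finally have "\<forall>i<n. k i * c i = 0"
    using assms(4)[unfolded independent_family_def, rule_format, of "\<lambda>i. k i * c i"] by blast
  with c k show False by auto
qed

lemma has_rank_unique: "subgroup C G \<Longrightarrow> has_rank G C r \<Longrightarrow> has_rank G C r' \<Longrightarrow> r = r'"
  by (metis has_rank_def independent_le_rank order_antisym)

text \<open>An independent family of maximal length works: adjoining \<open>x\<close> destroys
  independence, and the coefficient of \<open>x\<close> in the resulting relation is nonzero because
  the family itself is independent.\<close>

lemma has_rank_if_bounded:
  assumes C: "subgroup C G"
    and b: "\<And>n s. (\<And>i. i < n \<Longrightarrow> s i \<in> C) \<Longrightarrow> independent_family G s n \<Longrightarrow> n \<le> B"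
  shows "\<exists>r\<le>B. has_rank G C r"
proof -
  define P where "P = (\<lambda>n. \<exists>s. (\<forall>i<n. s i \<in> C) \<and> independent_family G s n)"
  have "P 0" by (simp add: P_def independent_family_def)
  moreover have B: "\<And>n. P n \<Longrightarrow> n \<le> B" using b by (auto simp: P_def)
  ultimately obtain r where r: "P r" "\<And>n. P n \<Longrightarrow> n \<le> r"
    by (metis GreatestI_nat Greatest_le_nat)
  then obtain s where s: "\<forall>i<r. s i \<in> C" "independent_family G s r"
    unfolding P_def by blast
  have sG: "\<And>i. i < r \<Longrightarrow> s i \<in> carrier G" using s subgroup.mem_carrier[OF C] by blast
  have "\<exists>k a. k \<noteq> 0 \<and> x [^] (k::int) = lincomb G s r a" if x: "x \<in> C" for x
  proof -
    have xG: "x \<in> carrier G" using x subgroup.mem_carrier[OF C] by blast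
    let ?s = "s(r := x)"
    have "\<not> P (Suc r)" using r(2)[of "Suc r"] by auto
    then have "\<not> independent_family G ?s (Suc r)"
      using s x unfolding P_def by (metis fun_upd_apply less_Suc_eq)
    then obtain a i where a: "lincomb G ?s (Suc r) a = \<one>" "i < Suc r" "a i \<noteq> 0"
      by (auto simp: independent_family_def)
    have "lincomb G ?s r a = lincomb G s r a" by (intro lincomb_cong) auto
    with a have *: "lincomb G s r a \<otimes> x [^] a r = \<one>" by simp
    have "a r \<noteq> 0"
    proof
      assume 0: "a r = 0"
      then have "lincomb G s r a = \<one>" using * lincomb_closed[of r s a] sG by simp
      then have "\<forall>i<r. a i = 0" using s by (simp add: independent_family_def)
      with 0 a show False by (metis less_Suc_eq)
    qed
    moreover have "x [^] a r = lincomb G s r (\<lambda>i. a i * (-1))"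
    proof -
      have "x [^] a r = inv (lincomb G s r a)"
        using * lincomb_closed[of r s a] sG xG by (metis int_pow_closed inv_equality inv_inv m_comm)
      then show ?thesis
        using sG lincomb_closed[of r s a] by (simp only: lincomb_scale) (simp add: int_pow_neg)
    qed
    ultimately show ?thesis by blast
  qed
  then show ?thesis
    using s r B unfolding has_rank_def by blast
qed

lemma has_rank_subgroup:
  assumes "subgroup C G" "has_rank G C r" "subgroup D G" "D \<subseteq> C"
  shows "\<exists>q. has_rank G D q"
  using has_rank_if_bounded[OF assms(3), of r] independent_le_rank[OF assms(1,2)] assms(4)
  by (meson subsetD)

lemma has_rank_trivial: "has_rank G {\<one>} 0"
  by (auto simp: has_rank_def independent_family_def intro!: exI[of _ "1::int"])

end

section \<open>Rank under homomorphisms and in exact sequences\<close>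

lemma lincomb_hom:
  assumes "comm_group G" "comm_group H" "f \<in> hom G H" "\<And>i. i < n \<Longrightarrow> e i \<in> carrier G"
  shows "f (lincomb G e n a) = lincomb H (f \<circ> e) n a"
proof -
  interpret G: comm_group G by fact
  interpret H: comm_group H by fact
  interpret f: group_hom G H f using assms by unfold_locales
  show ?thesis using assms(4)
    by (induction n) (auto simp: G.lincomb_closed f.hom_int_pow)
qed

text \<open>Rank-nullity: a family in the kernel is extended by preimages of one in the image.
  Applying \<open>f\<close> kills the kernel part, which separates the two halves of any
  relation.\<close>

lemma has_rank_kernel_image:
  assumes "comm_group G" "comm_group H" "f \<in> hom G H"
    and ker: "has_rank G (kernel G H f) p" and im: "has_rank H (f ` carrier G) q"
  shows "has_rank G (carrier G) (p + q)"
proof -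
  interpret G: comm_group G by fact
  interpret H: comm_group H by fact
  interpret f: group_hom G H f using assms by unfold_locales
  obtain e where e: "\<forall>i<p. e i \<in> kernel G H f" "independent_family G e p"
      "\<forall>x\<in>kernel G H f. \<exists>k a. k \<noteq> 0 \<and> x [^]\<^bsub>G\<^esub> (k::int) = lincomb G e p a"
    using ker unfolding has_rank_def by blast
  obtain h where h: "\<forall>i<q. h i \<in> f ` carrier G" "independent_family H h q"
      "\<forall>x\<in>f ` carrier G. \<exists>k a. k \<noteq> 0 \<and> x [^]\<^bsub>H\<^esub> (k::int) = lincomb H h q a"
    using im unfolding has_rank_def by blast
  then have "\<forall>i<q. \<exists>x. x \<in> carrier G \<and> f x = h i" by fastforce
  then obtain g where g: "\<And>i. i < q \<Longrightarrow> g i \<in> carrier G \<and> f (g i) = h i" by metis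
  have eG: "\<And>i. i < p \<Longrightarrow> e i \<in> carrier G" using e by (auto simp: kernel_def)
  define s where "s = (\<lambda>i. if i < p then e i else g (i - p))"
  have sG: "\<And>i. i < p + q \<Longrightarrow> s i \<in> carrier G" using eG g by (auto simp: s_def)
  have app: "lincomb G s (p + q) a = lincomb G e p a \<otimes>\<^bsub>G\<^esub> lincomb G g q (\<lambda>i. a (p + i))" for a
    using G.lincomb_append[of p q s a] sG
    by (simp add: s_def cong: lincomb_cong)
  have fe: "f (lincomb G e p a) = \<one>\<^bsub>H\<^esub>" for a
  proof -
    have "lincomb G e p a \<in> kernel G H f"
      using e f.subgroup_kernel by (intro G.lincomb_in_subgroup) auto
    then show ?thesis by (simp add: kernel_def)
  qed
  have fg: "f (lincomb G g q a) = lincomb H h q a" for a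
  proof -
    have "f (lincomb G g q a) = lincomb H (f \<circ> g) q a"
      using g assms by (intro lincomb_hom) auto
    also have "\<dots> = lincomb H h q a" using g by (intro lincomb_cong) auto
    finally show ?thesis .
  qed
  have cl: "lincomb G e p a \<in> carrier G" "lincomb G g q a \<in> carrier G" for a
    using eG g by (auto intro!: G.lincomb_closed)
  have hG: "lincomb H h q a \<in> carrier H" for a using cl(2) fg f.hom_closed by metis
  have fs: "f (lincomb G s (p + q) a) = lincomb H h q (\<lambda>i. a (p + i))" for a
    by (simp add: app fe fg cl hG)
  have "independent_family G s (p + q)"
    unfolding independent_family_def
  proof (intro allI impI)
    fix a i assume a: "lincomb G s (p + q) a = \<one>\<^bsub>G\<^esub>" and i: "i < p + q"
    then have "lincomb H h q (\<lambda>i. a (p + i)) = \<one>\<^bsub>H\<^esub>" using fs[of a] by simp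
    then have 1: "\<forall>i<q. a (p + i) = 0"
      using h(2)[unfolded independent_family_def, rule_format, of "\<lambda>i. a (p + i)"] by blast
    then have "lincomb G g q (\<lambda>i. a (p + i)) = \<one>\<^bsub>G\<^esub>" by (simp add: G.lincomb_zero)
    then have "lincomb G e p a = \<one>\<^bsub>G\<^esub>" using a cl by (simp add: app)
    then have 2: "\<forall>i<p. a i = 0" using e by (simp add: independent_family_def)
    show "a i = 0"
      using 1[rule_format, of "i - p"] 2 i by (cases "i < p") auto
  qed
  moreover have "\<exists>k a. k \<noteq> 0 \<and> x [^]\<^bsub>G\<^esub> (k::int) = lincomb G s (p + q) a" if x: "x \<in> carrier G" for x
  proof -
    obtain k a where k: "k \<noteq> 0" "f x [^]\<^bsub>H\<^esub> (k::int) = lincomb H h q a" using h x by blast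
    \<comment> \<open>Dividing a multiple of \<open>x\<close> by a lift of its image leaves a kernel
      element; a further multiple \<open>l\<close> brings that into the span, so
      \<open>k * l\<close> is the multiplier for \<open>x\<close>.\<close>
    let ?y = "x [^]\<^bsub>G\<^esub> k \<otimes>\<^bsub>G\<^esub> inv\<^bsub>G\<^esub> (lincomb G g q a)"
    have "?y \<in> kernel G H f"
      using x cl k by (simp add: kernel_def f.hom_int_pow fg hG)
    then obtain l b where l: "l \<noteq> 0" "?y [^]\<^bsub>G\<^esub> (l::int) = lincomb G e p b" using e by blast
    define c where "c = (\<lambda>i. if i < p then b i else a (i - p) * l)"
    have "x [^]\<^bsub>G\<^esub> k = ?y \<otimes>\<^bsub>G\<^esub> lincomb G g q a"
      using x cl by (simp add: G.m_assoc)
    then have "(x [^]\<^bsub>G\<^esub> k) [^]\<^bsub>G\<^esub> l = ?y [^]\<^bsub>G\<^esub> l \<otimes>\<^bsub>G\<^esub> lincomb G g q a [^]\<^bsub>G\<^esub> l"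
      using x cl by (metis G.int_pow_closed G.int_pow_distrib G.inv_closed G.m_closed)
    then have "x [^]\<^bsub>G\<^esub> (k * l) = lincomb G e p b \<otimes>\<^bsub>G\<^esub> lincomb G g q (\<lambda>i. a i * l)"
      using x l g by (simp add: G.int_pow_pow G.lincomb_scale)
    also have "\<dots> = lincomb G s (p + q) c"
      unfolding app by (intro arg_cong2[where f = "\<lambda>x y. x \<otimes>\<^bsub>G\<^esub> y"] lincomb_cong) (auto simp: c_def)
    finally show ?thesis using k l by (metis mult_eq_0_iff)
  qed
  ultimately show ?thesis
    using sG unfolding has_rank_def by blast
qed

text \<open>Preimages of an independent family are independent, so the rank of the domain bounds the
  length of independent families in the image.\<close>

lemma has_rank_image:
  assumes "comm_group G" "comm_group H" "f \<in> hom G H" "has_rank G (carrier G) r"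
  shows "\<exists>q. has_rank H (f ` carrier G) q"
proof -
  interpret G: comm_group G by fact
  interpret H: comm_group H by fact
  interpret f: group_hom G H f using assms by unfold_locales
  have "n \<le> r" if s: "\<And>i. i < n \<Longrightarrow> s i \<in> f ` carrier G" "independent_family H s n" for n s
  proof -
    have "\<forall>i<n. \<exists>x. x \<in> carrier G \<and> f x = s i" using s by fastforce
    then obtain g where g: "\<And>i. i < n \<Longrightarrow> g i \<in> carrier G \<and> f (g i) = s i" by metis
    have "independent_family G g n"
      unfolding independent_family_def
    proof (intro allI impI)
      fix a i assume "lincomb G g n a = \<one>\<^bsub>G\<^esub>" "i < n"
      then have "lincomb H (f \<circ> g) n a = \<one>\<^bsub>H\<^esub>"
        using lincomb_hom[OF assms(1-3), of n g a] g by simp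
      also have "lincomb H (f \<circ> g) n a = lincomb H s n a" using g by (intro lincomb_cong) auto
      finally show "a i = 0" using s \<open>i < n\<close> by (simp add: independent_family_def)
    qed
    then show ?thesis using G.independent_le_rank[OF G.subgroup_self assms(4)] g by blast
  qed
  then show ?thesis
    using H.has_rank_if_bounded[OF f.img_is_subgroup] by blast
qed

text \<open>The rank of the middle group is finite because those of its neighbours are. The two
  summands are exposed because they reappear in adjacent terms of the long exact sequence.\<close>

lemma has_rank_exact:
  assumes "comm_group A" "comm_group B" "comm_group C" "f \<in> hom A B" "g \<in> hom B C"
    and ex: "kernel B C g = f ` carrier A"
    and "has_rank A (carrier A) a" "has_rank C (carrier C) c"
  shows "\<exists>p q. has_rank B (f ` carrier A) p \<and> has_rank C (g ` carrier B) q \<and> has_rank B (carrier B) (p + q)"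
proof -
  interpret C: comm_group C by fact
  interpret g: group_hom B C g using assms by (simp add: comm_group_def group_hom_axioms_def group_hom_def)
  obtain p where "has_rank B (f ` carrier A) p" using has_rank_image assms by blast
  moreover obtain q where "has_rank C (g ` carrier B) q"
    using C.has_rank_subgroup[OF C.subgroup_self assms(8) g.img_is_subgroup] g.homh hom_carrier by blast
  ultimately show ?thesis
    using has_rank_kernel_image[OF assms(2,3,5)] ex by metis
qed

lemma has_rank_iso:
  assumes "comm_group G" "comm_group H" "G \<cong> H" "has_rank G (carrier G) r"
  shows "has_rank H (carrier H) r"
proof -
  interpret G: comm_group G by fact
  interpret H: comm_group H by fact
  obtain f where f: "f \<in> iso G H" using assms(3) by (auto simp: is_iso_def)
  then have hom: "f \<in> hom G H" and im: "f ` carrier G = carrier H" and inj: "inj_on f (carrier G)"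
    by (auto simp: iso_def bij_betw_def)
  interpret f: group_hom G H f using hom by unfold_locales
  have ker: "kernel G H f = {\<one>\<^bsub>G\<^esub>}" using inj f.inj_iff_trivial_ker by simp
  obtain q where q: "has_rank H (f ` carrier G) q" using has_rank_image[OF assms(1,2) hom assms(4)] by blast
  then have "has_rank G (carrier G) (0 + q)"
    using has_rank_kernel_image[OF assms(1,2) hom] ker G.has_rank_trivial by metis
  then show ?thesis
    using q im G.has_rank_unique[OF G.subgroup_self assms(4)] by simp
qed

lemma has_rank_trivial_group:
  "comm_group G \<Longrightarrow> trivial_group G \<Longrightarrow> has_rank G (carrier G) 0"
  by (metis comm_group.has_rank_trivial trivial_group_def)

lemma has_rank_integer_group: "has_rank integer_group (carrier integer_group) 1"
  unfolding has_rank_def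
proof (intro exI conjI ballI)
  show "independent_family integer_group (\<lambda>_. 1) 1"
    by (simp add: independent_family_def)
  show "x [^]\<^bsub>integer_group\<^esub> (1::int) = lincomb integer_group (\<lambda>_. 1) 1 (\<lambda>_. x)" for x
    by simp
qed auto

section \<open>Singular homology and its ranks\<close>

lemma standard_simplex_eq: "Defs.standard_simplex = Simplices.standard_simplex"
  by (simp add: fun_eq_iff Defs.standard_simplex_def Simplices.standard_simplex_def)

lemma singular_simplex_eq: "Defs.singular_simplex = Simplices.singular_simplex"
  by (simp add: fun_eq_iff Defs.singular_simplex_def Simplices.singular_simplex_def standard_simplex_eq)

lemma singular_face_eq: "Defs.singular_face = Simplices.singular_face"
  by (simp add: fun_eq_iff Defs.singular_face_def Simplices.singular_face_def standard_simplex_eq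
      Defs.simplical_face_def Simplices.simplical_face_def restrict_def)

lemma singular_chain_lookup_iff:
  "Defs.singular_chain p X (Poly_Mapping.lookup c) \<longleftrightarrow> Simplices.singular_chain p X c"
  by (auto simp: Defs.singular_chain_def Simplices.singular_chain_def singular_simplex_eq
      in_keys_iff subset_iff)

lemma singular_chain_obtain_frag:
  assumes "Defs.singular_chain p X c"
  obtains c' where "c = Poly_Mapping.lookup c'" "Simplices.singular_chain p X c'"
proof -
  have "c = Poly_Mapping.lookup (Abs_poly_mapping c)"
    using assms by (simp add: Defs.singular_chain_def)
  with assms that show ?thesis by (metis singular_chain_lookup_iff)
qed

lemma chain_boundary_lookup:
  "Defs.chain_boundary p (Poly_Mapping.lookup c) = Poly_Mapping.lookup (Simplices.chain_boundary p c)"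
proof (cases "p = 0")
  case False
  have "{f. Poly_Mapping.lookup c f \<noteq> 0} = Poly_Mapping.keys c"
    by (auto simp: in_keys_iff)
  with False show ?thesis
    by (intro ext) (auto simp: Defs.chain_boundary_def Simplices.chain_boundary_def frag_extend_def
        lookup_sum singular_face_eq sum_distrib_left intro!: sum.cong)
qed (simp add: fun_eq_iff Defs.chain_boundary_def Simplices.chain_boundary_def)

lemma singular_cycles_lookup_iff:
  "Poly_Mapping.lookup c \<in> singular_cycles p X \<longleftrightarrow> singular_relcycle p X {} c"
  by (auto simp: singular_cycles_def singular_cycle singular_chain_lookup_iff chain_boundary_lookup
      poly_mapping_eq_iff fun_eq_iff)

lemma singular_boundaries_lookup_iff:
  "Poly_Mapping.lookup c \<in> singular_boundaries p X \<longleftrightarrow> singular_relboundary p X {} c"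
proof -
  have "Poly_Mapping.lookup c \<in> singular_boundaries p X \<longleftrightarrow>
     (\<exists>d. Simplices.singular_chain (Suc p) X d \<and>
        Poly_Mapping.lookup c = Defs.chain_boundary (Suc p) (Poly_Mapping.lookup d))"
    unfolding singular_boundaries_def mem_Collect_eq
    by (metis singular_chain_lookup_iff singular_chain_obtain_frag)
  also have "\<dots> \<longleftrightarrow> singular_relboundary p X {} c"
    unfolding singular_boundary chain_boundary_lookup poly_mapping_eq_iff by metis
  finally show ?thesis .
qed

definition homology_class :: "nat \<Rightarrow> 'a topology \<Rightarrow> 'a chain \<Rightarrow> 'a chain set" where
  "homology_class p X = homologous_rel_set p X {}"

lemma homology_class_hom:
  "homology_class p X \<in> hom (relcycle_group p X {}) (homology_group (int p) X)"
proof -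
  interpret normal "singular_relboundary_set p X {}" "relcycle_group p X {}"
    by (rule normal_subgroup_singular_relboundary_relcycle)
  show ?thesis
    using r_coset_hom_Mod
    by (simp add: homology_class_def relative_homology_group_def right_coset_singular_relboundary)
qed

lemma homology_class_eq_one_iff:
  "homology_class p X c = \<one>\<^bsub>homology_group (int p) X\<^esub> \<longleftrightarrow> singular_relboundary p X {} c"
  by (simp add: homology_class_def homologous_rel_set_eq_relboundary)

lemma relcycle_group_int_pow:
  assumes "singular_relcycle p X {} c"
  shows "c [^]\<^bsub>relcycle_group p X {}\<^esub> (k::int) = frag_cmul k c"
proof -
  have "(\<lambda>k. frag_cmul k c) \<in> hom integer_group (relcycle_group p X {})"
    using assms by (auto simp: hom_def singular_relcycle_cmul frag_cmul_distrib)
  from hom_int_pow[OF this, of 1 k] show ?thesis by simp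
qed

lemma lincomb_relcycle_group:
  assumes "\<And>i. i < n \<Longrightarrow> singular_relcycle p X {} (c i)"
  shows "lincomb (relcycle_group p X {}) c n a = (\<Sum>i<n. frag_cmul (a i) (c i))"
  using assms by (induction n) (auto simp: relcycle_group_int_pow)

text \<open>Translates between the two notions of independence: relations between homology classes,
  and combinations of representing cycles that bound.\<close>

lemma lincomb_homology_class_eq_one_iff:
  assumes "\<And>i. i < n \<Longrightarrow> singular_relcycle p X {} (c i)"
  shows "lincomb (homology_group (int p) X) (homology_class p X \<circ> c) n a = \<one>\<^bsub>homology_group (int p) X\<^esub>
    \<longleftrightarrow> (\<lambda>f. \<Sum>i<n. a i * Poly_Mapping.lookup (c i) f) \<in> singular_boundaries p X"
proof -
  have "lincomb (homology_group (int p) X) (homology_class p X \<circ> c) n a =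
      homology_class p X (\<Sum>i<n. frag_cmul (a i) (c i))"
    using assms lincomb_hom[OF _ _ homology_class_hom[of p X], of n c a]
    by (simp add: lincomb_relcycle_group)
  moreover have "Poly_Mapping.lookup (\<Sum>i<n. frag_cmul (a i) (c i)) =
      (\<lambda>f. \<Sum>i<n. a i * Poly_Mapping.lookup (c i) f)"
    by (simp add: fun_eq_iff lookup_sum)
  ultimately show ?thesis
    by (simp only: homology_class_eq_one_iff flip: singular_boundaries_lookup_iff)
qed

text \<open>Admissible sets of cycles give independent families of classes, so their sizes are at
  most \<open>r\<close>; representatives of the family witnessing the rank form such a set of size
  \<open>r\<close>, so the supremum is attained.\<close>

lemma homology_rank_eq:
  assumes rank: "has_rank (homology_group (int p) X) (carrier (homology_group (int p) X)) r"
  shows "homology_rank p X = r"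
proof -
  let ?H = "homology_group (int p) X"
  interpret H: comm_group ?H by simp
  let ?indep = "\<lambda>S. \<forall>a :: (((nat \<Rightarrow> real) \<Rightarrow> 'a) \<Rightarrow> int) \<Rightarrow> int.
               (\<lambda>f. \<Sum>c\<in>S. a c * c f) \<in> singular_boundaries p X \<longrightarrow> (\<forall>c\<in>S. a c = 0)"
  have le: "card S \<le> r" if S: "finite S" "S \<subseteq> singular_cycles p X" "?indep S" for S
  proof -
    obtain g where g: "bij_betw g {..<card S} S"
      using S(1) ex_bij_betw_nat_finite atLeast0LessThan by metis
    have "\<forall>i<card S. \<exists>c. g i = Poly_Mapping.lookup c \<and> singular_relcycle p X {} c"
    proof (intro allI impI)
      fix i assume "i < card S"
      then have "g i \<in> singular_cycles p X" using g S by (auto simp: bij_betw_def)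
      then show "\<exists>c. g i = Poly_Mapping.lookup c \<and> singular_relcycle p X {} c"
        by (metis (mono_tags, lifting) mem_Collect_eq singular_chain_obtain_frag singular_cycles_def
            singular_cycles_lookup_iff)
    qed
    then obtain c where c: "\<And>i. i < card S \<Longrightarrow> g i = Poly_Mapping.lookup (c i)"
        "\<And>i. i < card S \<Longrightarrow> singular_relcycle p X {} (c i)"
      by metis
    have "independent_family ?H (homology_class p X \<circ> c) (card S)"
      unfolding independent_family_def
    proof (intro allI impI)
      fix a i assume a: "lincomb ?H (homology_class p X \<circ> c) (card S) a = \<one>\<^bsub>?H\<^esub>" and i: "i < card S"
      let ?b = "\<lambda>x. a (the_inv_into {..<card S} g x)"
      have inv: "the_inv_into {..<card S} g (g i) = i" if "i < card S" for i
        using g that by (simp add: bij_betw_def the_inv_into_f_f)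
      have "(\<lambda>f. \<Sum>x\<in>S. ?b x * x f) = (\<lambda>f. \<Sum>i<card S. a i * Poly_Mapping.lookup (c i) f)"
      proof
        fix f
        have "(\<Sum>x\<in>S. ?b x * x f) = (\<Sum>i<card S. ?b (g i) * g i f)"
          by (rule sum.reindex_bij_betw[OF g, symmetric])
        also have "\<dots> = (\<Sum>i<card S. a i * Poly_Mapping.lookup (c i) f)"
        proof (intro sum.cong refl)
          fix i assume "i \<in> {..<card S}"
          then have "i < card S" by simp
          then show "?b (g i) * g i f = a i * Poly_Mapping.lookup (c i) f"
            using inv[of i] c(1)[of i] by metis
        qed
        finally show "(\<Sum>x\<in>S. ?b x * x f) = (\<Sum>i<card S. a i * Poly_Mapping.lookup (c i) f)" .
      qed
      moreover have "(\<lambda>f. \<Sum>i<card S. a i * Poly_Mapping.lookup (c i) f) \<in> singular_boundaries p X"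
        using a lincomb_homology_class_eq_one_iff[of "card S" p X c a] c(2) by blast
      ultimately have "(\<lambda>f. \<Sum>x\<in>S. ?b x * x f) \<in> singular_boundaries p X" by (simp only:)
      then have "\<forall>x\<in>S. ?b x = 0" by (rule S(3)[THEN spec, THEN mp])
      moreover have "g i \<in> S" using g i by (auto simp: bij_betw_def)
      ultimately have "?b (g i) = 0" by (rule bspec)
      then show "a i = 0" using i by (simp only: inv)
    qed
    moreover have "(homology_class p X \<circ> c) i \<in> carrier ?H" if "i < card S" for i
      using hom_in_carrier[OF homology_class_hom, of "c i" p X] c(2)[OF that] by simp
    ultimately show ?thesis
      by (intro H.independent_le_rank[OF H.subgroup_self rank])
  qed
  obtain e where e: "\<forall>i<r. e i \<in> carrier ?H" "independent_family ?H e r"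
    using rank by (auto simp: has_rank_def)
  then have "\<forall>i<r. \<exists>c. e i = homology_class p X c \<and> singular_relcycle p X {} c"
    by (auto simp: carrier_relative_homology_group homology_class_def)
  then obtain c where c: "\<And>i. i < r \<Longrightarrow> e i = homology_class p X (c i)"
      "\<And>i. i < r \<Longrightarrow> singular_relcycle p X {} (c i)"
    by metis
  have ind: "\<forall>i<r. a i = 0"
    if "(\<lambda>f. \<Sum>i<r. a i * Poly_Mapping.lookup (c i) f) \<in> singular_boundaries p X" for a
  proof -
    have "lincomb ?H (homology_class p X \<circ> c) r a = lincomb ?H e r a"
      using c by (intro lincomb_cong) auto
    then show ?thesis
      using that e(2) lincomb_homology_class_eq_one_iff[of r p X c a] c(2)
      by (simp add: independent_family_def)
  qed
  define S where "S = (\<lambda>i. Poly_Mapping.lookup (c i)) ` {..<r}"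
  have inj: "inj_on (\<lambda>i. Poly_Mapping.lookup (c i)) {..<r}"
  proof (rule inj_onI, rule ccontr)
    fix i j assume ij: "i \<in> {..<r}" "j \<in> {..<r}" "Poly_Mapping.lookup (c i) = Poly_Mapping.lookup (c j)" "i \<noteq> j"
    \<comment> \<open>Two equal representatives would have difference 0, a boundary, against
      independence; hence \<open>S\<close> really has \<open>r\<close> elements.\<close>
    let ?a = "\<lambda>k. if k = i then 1 else if k = j then -1 else (0::int)"
    have "(\<Sum>k<r. ?a k * Poly_Mapping.lookup (c k) f) = 0" for f
    proof -
      have "(\<Sum>k<r. ?a k * Poly_Mapping.lookup (c k) f) = (\<Sum>k\<in>{i,j}. ?a k * Poly_Mapping.lookup (c k) f)"
        using ij by (intro sum.mono_neutral_right) auto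
      then show ?thesis using ij by simp
    qed
    then have "(\<lambda>f. \<Sum>k<r. ?a k * Poly_Mapping.lookup (c k) f) = Poly_Mapping.lookup 0"
      by (simp only: fun_eq_iff lookup_zero) blast
    moreover have "Poly_Mapping.lookup 0 \<in> singular_boundaries p X"
      by (simp only: singular_boundaries_lookup_iff singular_relboundary_0)
    ultimately have "\<forall>k<r. ?a k = 0" by (intro ind) (simp only:)
    then have "?a i = 0" using ij(1) by blast
    then show False by simp
  qed
  have "?indep S"
  proof (intro allI impI)
    fix a :: "(((nat \<Rightarrow> real) \<Rightarrow> 'a) \<Rightarrow> int) \<Rightarrow> int"
    assume "(\<lambda>f. \<Sum>x\<in>S. a x * x f) \<in> singular_boundaries p X"
    then have "\<forall>i<r. a (Poly_Mapping.lookup (c i)) = 0"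
      by (intro ind) (simp add: S_def sum.reindex[OF inj])
    then show "\<forall>x\<in>S. a x = 0" by (auto simp: S_def)
  qed
  moreover have "S \<subseteq> singular_cycles p X" "finite S" "card S = r"
    using c inj by (auto simp: S_def singular_cycles_lookup_iff card_image)
  ultimately show ?thesis
    unfolding homology_rank_def
    by (intro cSup_eq_maximum) (use le in auto)
qed

text \<open>\<open>homology_rank\<close> is a supremum in the naturals and \<open>euler_char\<close>
  a sum over a set that may be infinite, so both can be mere default values. This predicate says
  that they have their intended meaning.\<close>

definition finite_homology :: "'a topology \<Rightarrow> bool" where
  "finite_homology X \<longleftrightarrow> (\<forall>p. has_rank (homology_group (int p) X) (carrier (homology_group (int p) X)) (homology_rank p X))
     \<and> finite {p. homology_rank p X \<noteq> 0}"

lemma finite_homologyI: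
  assumes "\<And>p. has_rank (homology_group (int p) X) (carrier (homology_group (int p) X)) (b p)"
    and "\<And>p. p \<ge> P \<Longrightarrow> b p = 0"
  shows "finite_homology X" "euler_char X = (\<Sum>p<P. (-1)^p * int (b p))"
proof -
  have b: "homology_rank p X = b p" for p
    by (rule homology_rank_eq) (rule assms)
  have sub: "{p. homology_rank p X \<noteq> 0} \<subseteq> {..<P}"
    using assms(2) by (auto simp: b) (metis not_less less_numeral_extra(3))
  then show "finite_homology X"
    using assms(1) by (auto simp: finite_homology_def b intro: finite_subset)
  show "euler_char X = (\<Sum>p<P. (-1)^p * int (b p))"
    unfolding euler_char_def b[symmetric]
    using sub by (intro sum.mono_neutral_left) auto
qed

lemma finite_homology_homotopy_equivalent:
  assumes "X homotopy_equivalent_space Y" "finite_homology X"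
  shows "finite_homology Y" "euler_char Y = euler_char X"
proof -
  have b: "has_rank (homology_group (int p) Y) (carrier (homology_group (int p) Y)) (homology_rank p X)" for p
    using assms(2) homotopy_equivalent_space_imp_isomorphic_homology_groups[OF assms(1), of "int p"]
      has_rank_iso[OF abelian_homology_group abelian_homology_group]
    unfolding finite_homology_def by blast
  obtain P where P: "{p. homology_rank p X \<noteq> 0} \<subseteq> {..<P}"
    using assms(2) by (auto simp: finite_homology_def dest: finite_nat_bounded)
  have z: "homology_rank p X = 0" if "p \<ge> P" for p
    using P that by (metis (mono_tags) leD lessThan_iff mem_Collect_eq subsetD)
  show "finite_homology Y" using finite_homologyI(1)[OF b z] .
  have "euler_char Y = (\<Sum>p<P. (-1)^p * int (homology_rank p X))"
    using finite_homologyI(2)[OF b z] .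
  also have "\<dots> = euler_char X"
    using finite_homologyI(2)[of X "\<lambda>p. homology_rank p X", OF _ z] assms(2) by (simp add: finite_homology_def)
  finally show "euler_char Y = euler_char X" .
qed

lemma finite_homology_empty:
  assumes "topspace X = {}"
  shows "finite_homology X" "euler_char X = 0"
proof -
  have b: "has_rank (homology_group (int p) X) (carrier (homology_group (int p) X)) 0" for p
    by (rule has_rank_trivial_group[OF abelian_homology_group trivial_homology_group_empty[OF assms]])
  show "finite_homology X" "euler_char X = 0"
    using finite_homologyI[OF b, of 0] by auto
qed

text \<open>In the long exact sequence of the pair \<open>(X, S)\<close> every rank splits as the sum of the ranks of the
  images of the adjacent maps, so the alternating sum telescopes.\<close>

lemma finite_homology_pair:
  assumes fin: "finite_homology (subtopology X S)"
    and rel: "\<And>p. has_rank (relative_homology_group (int p) X S) (carrier (relative_homology_group (int p) X S))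
                 (if p = m then 1 else 0)"
  shows "finite_homology X" "euler_char X = euler_char (subtopology X S) + (-1) ^ m"
proof -
  define A where "A = subtopology X S"
  define HA where "HA = (\<lambda>p. homology_group p A)"
  define HX where "HX = (\<lambda>p. homology_group p X)"
  define HR where "HR = (\<lambda>p. relative_homology_group p X S)"
  define i where "i = (\<lambda>p. hom_induced p A {} X {} id)"
  define j where "j = (\<lambda>p. hom_induced p X {} X S id)"
  define d where "d = (\<lambda>p. hom_boundary p X S)"
  have cg: "comm_group (HA p)" "comm_group (HX p)" "comm_group (HR p)" for p
    by (simp_all add: HA_def HX_def HR_def)
  have hom: "i p \<in> hom (HA p) (HX p)" "j p \<in> hom (HX p) (HR p)" "d p \<in> hom (HR p) (HA (p - 1))" for p
    by (auto simp: i_def j_def d_def HA_def HX_def HR_def A_def hom_induced_hom hom_boundary_hom)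
  have ex1: "kernel (HR p) (HA (p - 1)) (d p) = j p ` carrier (HX p)" for p
    using homology_exactness_axiom_1[of p X S] by (simp add: d_def j_def HA_def HX_def HR_def A_def)
  have ex2: "kernel (HA p) (HX p) (i p) = d (p + 1) ` carrier (HR (p + 1))" for p
    using homology_exactness_axiom_2[of "p + 1" X S] by (simp add: d_def i_def HA_def HX_def HR_def A_def)
  have ex3: "kernel (HX p) (HR p) (j p) = i p ` carrier (HA p)" for p
    using homology_exactness_axiom_3[of p X S] by (simp add: i_def j_def HA_def HX_def HR_def A_def)
  define bA where "bA = (\<lambda>p. homology_rank p A)"
  define bR where "bR = (\<lambda>p. if p = m then 1 else 0 :: nat)"
  have bA: "has_rank (HA (int p)) (carrier (HA (int p))) (bA p)" for p
    using fin by (simp add: finite_homology_def HA_def A_def bA_def)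
  have bR: "has_rank (HR (int p)) (carrier (HR (int p))) (bR p)" for p
    using rel by (simp add: HR_def bR_def)
  have sub: "subgroup (carrier G) G" if "comm_group G" for G
    using that by (simp add: comm_group.axioms(2) group.subgroup_self)
  have subim: "subgroup (f ` carrier G) H" if "comm_group G" "comm_group H" "f \<in> hom G H" for f G H
    using that by (meson comm_group.axioms(2) group_hom.img_is_subgroup group_hom.intro group_hom_axioms.intro)
  have "\<exists>p q. has_rank (HX (int k)) (i (int k) ` carrier (HA (int k))) p \<and>
      has_rank (HR (int k)) (j (int k) ` carrier (HX (int k))) q \<and>
      has_rank (HX (int k)) (carrier (HX (int k))) (p + q)" for k
    using has_rank_exact[OF cg(1,2,3) hom(1,2) ex3 bA bR] .
  then obtain ri rj where r:
      "\<And>k. has_rank (HX (int k)) (i (int k) ` carrier (HA (int k))) (ri k)"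
      "\<And>k. has_rank (HR (int k)) (j (int k) ` carrier (HX (int k))) (rj k)"
      "\<And>k. has_rank (HX (int k)) (carrier (HX (int k))) (ri k + rj k)"
    by metis
  have "\<exists>q. has_rank (HA (int k - 1)) (d (int k) ` carrier (HR (int k))) q" for k
    using has_rank_image[OF cg(3,1) hom(3) bR] .
  then obtain rd where rd: "\<And>k. has_rank (HA (int k - 1)) (d (int k) ` carrier (HR (int k))) (rd k)"
    by metis
  \<comment> \<open>\<open>rd k\<close> is the rank of the image of the connecting map out of degree
    \<open>k\<close>. By exactness this image is the kernel of the next map, and rank-nullity splits
    the rank.\<close>
  have A: "bA k = rd (Suc k) + ri k" for k
  proof -
    have "has_rank (HA (int k)) (carrier (HA (int k))) (rd (Suc k) + ri k)"
      using rd[of "Suc k"] r(1)[of k] ex2[of "int k"]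
      by (intro has_rank_kernel_image[OF cg(1) cg(2) hom(1)]) (auto simp: add.commute)
    then show ?thesis
      using comm_group.has_rank_unique[OF cg(1) sub[OF cg(1)] bA] by blast
  qed
  have R: "bR k = rj k + rd k" for k
  proof -
    have "has_rank (HR (int k)) (carrier (HR (int k))) (rj k + rd k)"
      using rd[of k] r(2)[of k] ex1[of "int k"]
      by (intro has_rank_kernel_image[OF cg(3) cg(1) hom(3)]) auto
    then show ?thesis
      using comm_group.has_rank_unique[OF cg(3) sub[OF cg(3)] bR] by blast
  qed
  \<comment> \<open>The sequence ends here: the connecting map out of degree 0 takes values in
    homology of degree -1, which is trivial.\<close>
  have rd0: "rd 0 = 0"
  proof -
    have "trivial_group (HA (- 1))" by (simp add: HA_def trivial_homology_group)
    then have *: "has_rank (HA (- 1)) (carrier (HA (- 1))) 0" by (rule has_rank_trivial_group[OF cg(1)])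
    obtain e where e: "\<forall>i<rd 0. e i \<in> d 0 ` carrier (HR 0)" "independent_family (HA (-1)) e (rd 0)"
      using rd[of 0] by (auto simp: has_rank_def)
    have "d 0 ` carrier (HR 0) \<subseteq> carrier (HA (-1))" using hom(3)[of 0] hom_carrier by fastforce
    then show ?thesis
      using comm_group.independent_le_rank[OF cg(1) sub[OF cg(1)] *, of "rd 0" e] e by blast
  qed
  obtain P0 where P0: "{p. homology_rank p A \<noteq> 0} \<subseteq> {..<P0}"
    using fin by (auto simp: finite_homology_def A_def dest: finite_nat_bounded)
  \<comment> \<open>From \<open>P\<close> on all ranks vanish; \<open>P > m\<close> puts the one
    relative class into the range of summation and later yields \<open>rd P = 0\<close>.\<close>
  define P where "P = max P0 (Suc m)"
  have bAz: "bA k = 0" if "k \<ge> P" for k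
    using P0 that unfolding bA_def P_def
    by (metis (mono_tags) leD lessThan_iff max.boundedE mem_Collect_eq subsetD)
  have bRz: "bR k = 0" if "k \<ge> P" for k
    using that by (auto simp: bR_def P_def)
  have bXz: "ri k + rj k = 0" if "k \<ge> P" for k
    using A[of k] R[of k] bAz[OF that] bRz[OF that] by simp
  note X = finite_homologyI[OF r(3)[unfolded HX_def] bXz]
  show "finite_homology X" by (rule X)
  have EX: "euler_char X = (\<Sum>p<P. (-1)^p * int (ri p + rj p))" by (rule X(2))
  have eA: "euler_char A = (\<Sum>p<P. (-1)^p * int (bA p))"
    by (rule finite_homologyI(2)[OF bA[unfolded HA_def] bAz])
  \<comment> \<open>In degree \<open>p\<close> the ranks of the subspace and of the pair together
    exceed that of the space by \<open>rd (Suc p) + rd p\<close>; with signs only the two ends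
    survive.\<close>
  have tele: "(\<Sum>p<n. (-1)^p * (int (rd (Suc p)) + int (rd p))) = int (rd 0) - (-1) ^ n * int (rd n)" for n
    by (induction n) (auto simp: algebra_simps)
  have "rd P = 0" using R[of P] bRz[of P] by simp
  then have 0: "(\<Sum>p<P. (-1)^p * (int (rd (Suc p)) + int (rd p))) = 0"
    using tele[of P] rd0 by simp
  have "euler_char X = (\<Sum>p<P. (-1)^p * (int (bA p) + int (bR p)) - (-1)^p * (int (rd (Suc p)) + int (rd p)))"
    unfolding EX by (intro sum.cong refl) (simp add: A R algebra_simps)
  also have "\<dots> = (\<Sum>p<P. (-1)^p * int (bA p)) + (\<Sum>p<P. (-1)^p * int (bR p))"
    using 0 by (simp add: sum_subtractf sum.distrib distrib_left)
  also have "(\<Sum>p<P. (-1)^p * int (bR p)) = (\<Sum>p\<in>{m}. (-1)^p * int (bR p))"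
    by (intro sum.mono_neutral_right) (auto simp: bR_def P_def)
  finally show "euler_char X = euler_char (subtopology X S) + (-1) ^ m"
    using eA by (simp add: A_def bR_def)
qed

section \<open>Attaching cells\<close>

subsection \<open>Open simplices\<close>

abbreviation std_simplex :: "nat \<Rightarrow> (nat \<Rightarrow> real) set" where
  "std_simplex \<equiv> Simplices.standard_simplex"

definition open_simplex :: "nat \<Rightarrow> (nat \<Rightarrow> real) set" where
  "open_simplex m = {x \<in> std_simplex m. \<forall>i\<le>m. 0 < x i}"

definition barycenter :: "nat \<Rightarrow> nat \<Rightarrow> real" where
  "barycenter m = (\<lambda>i. if i \<le> m then 1 / (real m + 1) else 0)"

primrec min_coord :: "nat \<Rightarrow> (nat \<Rightarrow> real) \<Rightarrow> real" where
  "min_coord 0 x = x 0"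
| "min_coord (Suc m) x = min (min_coord m x) (x (Suc m))"

lemma min_coord_le: "i \<le> m \<Longrightarrow> min_coord m x \<le> x i"
  by (induction m) (auto simp: le_Suc_eq min_le_iff_disj)

lemma min_coord_attained: "\<exists>i\<le>m. x i = min_coord m x"
  by (induction m) (auto simp: min_def le_Suc_eq)

lemma continuous_on_apply: "continuous_on S (\<lambda>x :: nat \<Rightarrow> real. x i)"
  by (rule continuous_on_product_then_coordinatewise) (rule continuous_on_id)

lemma continuous_on_min_coord: "continuous_on S (min_coord m)"
  by (induction m) (auto intro!: continuous_intros continuous_on_apply)

lemma barycenter_in_open_simplex: "barycenter m \<in> open_simplex m"
  by (auto simp: open_simplex_def barycenter_def Simplices.standard_simplex_def)

lemma open_simplex_subset: "open_simplex m \<subseteq> std_simplex m"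
  by (auto simp: open_simplex_def)

lemma compact_std_simplex: "compact (std_simplex m)"
  using compactin_standard_simplex by (simp add: euclidean_product_topology)

text \<open>The minimum is at most the average \<open>1 / (m + 1)\<close>, with equality only if all
  coordinates agree. This keeps the denominator of the radial deformation positive away from the
  barycenter.\<close>

lemma min_coord_less_barycenter:
  assumes x: "x \<in> std_simplex m" "x \<noteq> barycenter m"
  shows "(real m + 1) * min_coord m x < 1"
proof -
  have sum: "(\<Sum>i\<le>m. x i) = 1" using x by (simp add: Simplices.standard_simplex_def)
  obtain i where i: "i \<le> m" "x i \<noteq> 1 / (real m + 1)"
    using x by (auto simp: fun_eq_iff barycenter_def Simplices.standard_simplex_def split: if_splits)
      (metis not_le)
  have le: "(real m + 1) * min_coord m x \<le> 1"
    using sum_mono[of "{..m}" "\<lambda>_. min_coord m x" x] min_coord_le[of _ m x] sum by (simp add: add.commute)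
  have "(real m + 1) * min_coord m x \<noteq> 1"
  proof
    assume eq: "(real m + 1) * min_coord m x = 1"
    then have mc: "min_coord m x = 1 / (real m + 1)" by (simp add: field_simps)
    then have "min_coord m x < x i" using min_coord_le[of i m x] i by auto
    then have "(\<Sum>i\<le>m. min_coord m x) < (\<Sum>i\<le>m. x i)"
      using i min_coord_le[of _ m x] by (intro sum_strict_mono_ex1) auto
    with sum eq show False by (simp add: add.commute)
  qed
  with le show ?thesis by simp
qed

text \<open>Subtracting a constant from all barycentric coordinates and renormalizing moves a point along the ray
  from the barycenter; at \<open>t = 1\<close> the smallest coordinate vanishes.\<close>

definition radial :: "nat \<Rightarrow> real \<Rightarrow> (nat \<Rightarrow> real) \<Rightarrow> nat \<Rightarrow> real" where
  "radial m t x = (\<lambda>i. if i \<le> m then (x i - t * min_coord m x) / (1 - (real m + 1) * (t * min_coord m x)) else 0)"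

context
  fixes m :: nat and x :: "nat \<Rightarrow> real" and t :: real
  assumes x: "x \<in> std_simplex m" "x \<noteq> barycenter m" and t: "0 \<le> t" "t \<le> 1"
begin

lemma min_coord_nonneg: "0 \<le> min_coord m x"
  using min_coord_attained[of m x] x by (auto simp: Simplices.standard_simplex_def) metis

lemma radial_denom_pos: "0 < 1 - (real m + 1) * (t * min_coord m x)"
proof -
  have "t * ((real m + 1) * min_coord m x) \<le> 1 * ((real m + 1) * min_coord m x)"
    using t min_coord_nonneg by (intro mult_right_mono) auto
  with min_coord_less_barycenter[OF x] show ?thesis by (simp add: algebra_simps)
qed

lemma radial_in: "radial m t x \<in> std_simplex m"
proof -
  have nn: "0 \<le> x i - t * min_coord m x" if "i \<le> m" for i
  proof -
    have "t * min_coord m x \<le> 1 * min_coord m x"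
      using t min_coord_nonneg by (intro mult_right_mono) auto
    with min_coord_le[OF that, of x] show ?thesis by simp
  qed
  have sum: "(\<Sum>i\<le>m. radial m t x i) = 1"
  proof -
    have "(\<Sum>i\<le>m. x i - t * min_coord m x) = 1 - (real m + 1) * (t * min_coord m x)"
      using x by (simp add: sum_subtractf Simplices.standard_simplex_def)
    then show ?thesis
      using radial_denom_pos by (simp add: radial_def flip: sum_divide_distrib)
  qed
  have pos: "0 \<le> radial m t x i" for i
    using nn[of i] radial_denom_pos by (simp add: radial_def)
  have "radial m t x i \<le> 1" for i
  proof (cases "i \<le> m")
    case True
    then show ?thesis using member_le_sum[of i "{..m}" "radial m t x"] pos sum by simp
  qed (simp add: radial_def)
  with pos sum show ?thesis
    by (auto simp: Simplices.standard_simplex_def radial_def)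
qed

lemma radial_neq: "radial m t x \<noteq> barycenter m"
proof
  assume eq: "radial m t x = barycenter m"
  have "x i = 1 / (real m + 1)" if "i \<le> m" for i
  proof -
    have "(x i - t * min_coord m x) / (1 - (real m + 1) * (t * min_coord m x)) = 1 / (real m + 1)"
      using fun_cong[OF eq, of i] that by (simp add: radial_def barycenter_def)
    then have "(x i - t * min_coord m x) * (real m + 1) = 1 - (real m + 1) * (t * min_coord m x)"
      using radial_denom_pos by (simp add: divide_eq_eq eq_divide_eq)
    then show ?thesis by (simp add: field_simps)
  qed
  then have "x = barycenter m"
    using x by (auto simp: fun_eq_iff barycenter_def Simplices.standard_simplex_def)
  with x show False by simp
qed

text \<open>The smallest coordinate is 0, so nothing is subtracted. This makes the deformation
  compatible with the identity on the subspace to which a cell is attached.\<close>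

lemma radial_boundary: "x \<notin> open_simplex m \<Longrightarrow> radial m t x = x"
proof -
  assume "x \<notin> open_simplex m"
  then obtain i where "i \<le> m" "x i \<le> 0" using x by (force simp: open_simplex_def)
  then have "min_coord m x = 0" using min_coord_le[of i m x] min_coord_nonneg by simp
  then show ?thesis using x by (auto simp: radial_def Simplices.standard_simplex_def)
qed

end

lemma radial_0: "x \<in> std_simplex m \<Longrightarrow> radial m 0 x = x"
  by (auto simp: radial_def Simplices.standard_simplex_def)

lemma radial_1_notin: "radial m 1 x \<notin> open_simplex m"
proof -
  obtain i where "i \<le> m" "x i = min_coord m x" using min_coord_attained by blast
  then show ?thesis by (auto simp: radial_def open_simplex_def intro!: exI[of _ i])
qed

lemma continuous_on_radial:
  "continuous_on ({0..1} \<times> (std_simplex m - {barycenter m})) (\<lambda>(t, x). radial m t x)"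
proof -
  let ?S = "{0..1} \<times> (std_simplex m - {barycenter m})"
  have nz: "1 - (real m + 1) * (fst p * min_coord m (snd p)) \<noteq> 0" if "p \<in> ?S" for p
    using radial_denom_pos[of "snd p" m "fst p"] that by auto
  have "continuous_on ?S (\<lambda>p. (snd p i - fst p * min_coord m (snd p)) /
      (1 - (real m + 1) * (fst p * min_coord m (snd p))))" for i
    using nz by (intro continuous_intros
        continuous_on_compose2[OF continuous_on_min_coord continuous_on_snd]
        continuous_on_compose2[OF continuous_on_apply continuous_on_snd] ballI) auto
  then have "continuous_on ?S (\<lambda>p. if i \<le> m then (snd p i - fst p * min_coord m (snd p)) /
      (1 - (real m + 1) * (fst p * min_coord m (snd p))) else 0)" for i
    by (cases "i \<le> m") simp_all
  then show ?thesis
    unfolding case_prod_unfold radial_def by (rule continuous_on_coordinatewise_then_product)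
qed

section \<open>The open simplex as a Euclidean space, and its local homology\<close>

lemma Euclidean_space_eq: "Euclidean_space m = top_of_set {x. \<forall>i\<ge>m. x i = 0}"
  by (simp add: Euclidean_space_def euclidean_product_topology)

lemma open_simplex_homeomorphic_Euclidean:
  obtains f where "homeomorphic_map (top_of_set (open_simplex m)) (Euclidean_space m) f"
    "f (barycenter m) = (\<lambda>_. 0)"
proof -
  \<comment> \<open>Log-ratio coordinates, whose inverse normalizes exponentials. At the barycenter
    all ratios are 1, so it goes to the origin.\<close>
  define f where "f = (\<lambda>(x::nat \<Rightarrow> real) i. if i < m then ln (x (Suc i) / x 0) else 0)"
  define E where "E = (\<lambda>y::nat \<Rightarrow> real. 1 + (\<Sum>j<m. exp (y j)))"
  define g where "g = (\<lambda>(y::nat \<Rightarrow> real) i. if i \<le> m then (if i = 0 then 1 else exp (y (i - 1))) / E y else 0)"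
  have E: "E y > 0" for y by (simp add: E_def add_pos_nonneg sum_nonneg)
  have sum: "(\<Sum>i\<le>m. x i) = x 0 + (\<Sum>j<m. x (Suc j))" for x :: "nat \<Rightarrow> real"
    by (simp add: sum.atMost_shift)
  have gsum: "(\<Sum>i\<le>m. g y i) = 1" for y
  proof -
    have "(\<Sum>j<m. g y (Suc j)) = (\<Sum>j<m. exp (y j)) / E y"
      unfolding sum_divide_distrib by (intro sum.cong) (auto simp: g_def)
    then have "(\<Sum>i\<le>m. g y i) = 1 / E y + (\<Sum>j<m. exp (y j)) / E y"
      by (simp add: sum g_def)
    also have "\<dots> = E y / E y" unfolding E_def add_divide_distrib ..
    finally show ?thesis using E[of y] by simp
  qed
  have gpos: "i \<le> m \<Longrightarrow> 0 < g y i" for y i using E[of y] by (simp add: g_def)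
  have g_in: "g y \<in> open_simplex m" for y
  proof -
    have "g y i \<le> 1" for i
    proof (cases "i \<le> m")
      case True
      then show ?thesis
        using member_le_sum[of i "{..m}" "g y"] gpos[of _ y] gsum[of y] by (auto simp: less_imp_le)
    qed (simp add: g_def)
    moreover have "0 \<le> g y i" for i using gpos[of i y] by (cases "i \<le> m") (auto simp: g_def)
    ultimately show ?thesis
      using gpos[of _ y] gsum[of y] by (auto simp: open_simplex_def Simplices.standard_simplex_def g_def)
  qed
  have fg: "f (g y) = y" if "\<forall>i\<ge>m. y i = 0" for y
    using that E[of y] by (auto simp: f_def g_def fun_eq_iff)
  have gf: "g (f x) = x" if x: "x \<in> open_simplex m" for x
  proof -
    have pos: "\<And>i. i \<le> m \<Longrightarrow> 0 < x i" and s1: "(\<Sum>i\<le>m. x i) = 1" and z: "\<And>i. i > m \<Longrightarrow> x i = 0"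
      using x by (auto simp: open_simplex_def Simplices.standard_simplex_def)
    have ex: "exp (f x j) = x (Suc j) / x 0" if "j < m" for j
      using that pos[of "Suc j"] pos[of 0] by (simp add: f_def)
    have "E (f x) = 1 + (\<Sum>j<m. x (Suc j)) / x 0"
      by (simp add: E_def ex sum_divide_distrib)
    also have "\<dots> = (x 0 + (\<Sum>j<m. x (Suc j))) / x 0" using pos[of 0] by (simp add: field_simps)
    also have "\<dots> = 1 / x 0" using s1 by (simp add: sum)
    finally have Ef: "E (f x) = 1 / x 0" .
    show ?thesis
    proof
      fix i show "g (f x) i = x i"
        using pos[of 0] z[of i] ex[of "i - 1"] by (cases i) (auto simp: g_def Ef)
    qed
  qed
  have cf: "continuous_map (top_of_set (open_simplex m)) (Euclidean_space m) f"
  proof -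
    have "continuous_on (open_simplex m) (\<lambda>x. ln (x (Suc i) / x 0))" if "i < m" for i
      using that by (intro continuous_intros continuous_on_apply) (auto simp: open_simplex_def Suc_le_eq less_imp_neq[symmetric])
    then have "continuous_on (open_simplex m) (\<lambda>x. if i < m then ln (x (Suc i) / x 0) else 0)" for i
      by (cases "i < m") auto
    then have "continuous_on (open_simplex m) f"
      unfolding f_def by (rule continuous_on_coordinatewise_then_product)
    then show ?thesis by (auto simp: Euclidean_space_eq continuous_map_in_subtopology f_def)
  qed
  have cg: "continuous_map (Euclidean_space m) (top_of_set (open_simplex m)) g"
  proof -
    have "E y \<noteq> 0" for y using E[of y] by simp
    moreover have "continuous_on S E" for S
      unfolding E_def by (intro continuous_intros continuous_on_apply)
    ultimately have "continuous_on S (\<lambda>y. (if i = 0 then 1 else exp (y (i - 1))) / E y)" for S i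
      by (cases "i = 0") (auto intro!: continuous_intros continuous_on_apply)
    then have "continuous_on S (\<lambda>y. if i \<le> m then (if i = 0 then 1 else exp (y (i - 1))) / E y else 0)" for S i
      by (cases "i \<le> m") simp_all
    then have "continuous_on S g" for S
      unfolding g_def by (rule continuous_on_coordinatewise_then_product)
    then show ?thesis using g_in by (auto simp: Euclidean_space_eq continuous_map_in_subtopology)
  qed
  have "homeomorphic_maps (top_of_set (open_simplex m)) (Euclidean_space m) f g"
    using cf cg fg gf by (auto simp: homeomorphic_maps_def Euclidean_space_eq)
  then show ?thesis
    by (intro that[of f]) (auto simp: homeomorphic_map_maps f_def barycenter_def fun_eq_iff)
qed

text \<open>Adding \<open>m\<close> dimensions shifts the degree by \<open>m\<close>, which reduces
  the computation to dimension 0. There the complement of the origin is empty and the group is the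
  homology of a point in degree \<open>p - m\<close>.\<close>

lemma local_homology_Euclidean:
  "has_rank (relative_homology_group (int p) (Euclidean_space m) (topspace (Euclidean_space m) - {\<lambda>_. 0}))
     (carrier (relative_homology_group (int p) (Euclidean_space m) (topspace (Euclidean_space m) - {\<lambda>_. 0})))
     (if p = m then 1 else 0)"
proof -
  let ?q = "int p - int m"
  have ts: "topspace (Euclidean_space 0) = {\<lambda>_. 0}" by (auto simp: topspace_Euclidean_space)
  have "closedin (Euclidean_space 0) {\<lambda>_. 0}" using ts closedin_topspace by metis
  from relative_homology_group_Euclidean_complement_step[OF this, of ?q m]
  have iso: "homology_group ?q (Euclidean_space 0) \<cong>
      relative_homology_group (int p) (Euclidean_space m) (topspace (Euclidean_space m) - {\<lambda>_. 0})"
    by (simp add: ts)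
  have "has_rank (homology_group ?q (Euclidean_space 0)) (carrier (homology_group ?q (Euclidean_space 0)))
     (if p = m then 1 else 0)"
  proof (cases "p = m")
    case True
    have "path_connected_space (Euclidean_space 0)"
      using ts path_connectedin_singleton[of "Euclidean_space 0" "\<lambda>_. 0"]
      by (metis insertI1 path_connectedin_topspace)
    then have "homology_group 0 (Euclidean_space 0) \<cong> integer_group"
      using ts by (intro isomorphic_integer_zeroth_homology_group) auto
    then have "integer_group \<cong> homology_group 0 (Euclidean_space 0)"
      by (simp add: group.iso_sym)
    then show ?thesis
      using True has_rank_iso[OF abelian_integer_group abelian_homology_group _ has_rank_integer_group]
      by simp
  next
    case False
    then have "trivial_group (homology_group ?q (Euclidean_space 0))"
      using homology_dimension_axiom[OF ts, of ?q] by simp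
    then show ?thesis
      using False has_rank_trivial_group[OF abelian_homology_group] by simp
  qed
  then show ?thesis
    using has_rank_iso[OF abelian_homology_group abelian_relative_homology_group iso] by blast
qed

lemma local_homology_open_simplex:
  "has_rank (relative_homology_group (int p) (top_of_set (open_simplex m)) (open_simplex m - {barycenter m}))
     (carrier (relative_homology_group (int p) (top_of_set (open_simplex m)) (open_simplex m - {barycenter m})))
     (if p = m then 1 else 0)"
proof -
  obtain f where f: "homeomorphic_map (top_of_set (open_simplex m)) (Euclidean_space m) f"
    "f (barycenter m) = (\<lambda>_. 0)" using open_simplex_homeomorphic_Euclidean .
  have inj: "inj_on f (open_simplex m)" and im: "f ` open_simplex m = topspace (Euclidean_space m)"
    using homeomorphic_imp_injective_map[OF f(1)] homeomorphic_imp_surjective_map[OF f(1)] by auto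
  have "f ` (open_simplex m - {barycenter m}) = topspace (Euclidean_space m) - {\<lambda>_. 0}"
    using inj_on_image_set_diff[OF inj, of "open_simplex m" "{barycenter m}"]
      barycenter_in_open_simplex[of m] im f(2) by simp
  from homeomorphic_map_relative_homology_iso[OF f(1) _ this, of "int p"]
  have "relative_homology_group (int p) (top_of_set (open_simplex m)) (open_simplex m - {barycenter m}) \<cong>
      relative_homology_group (int p) (Euclidean_space m) (topspace (Euclidean_space m) - {\<lambda>_. 0})"
    by (auto intro: is_isoI)
  from has_rank_iso[OF abelian_relative_homology_group abelian_relative_homology_group
      group.iso_sym[OF group_relative_homology_group this] local_homology_Euclidean]
  show ?thesis .
qed

subsection \<open>One cell\<close>

context
  fixes Y :: "'a topology" and A :: "'a set" and \<Phi> :: "(nat \<Rightarrow> real) \<Rightarrow> 'a" and m :: nat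
  assumes Haus: "Hausdorff_space Y" and clA: "closedin Y A"
    and cont: "continuous_map (top_of_set (std_simplex m)) Y \<Phi>"
    and bd: "\<Phi> ` (std_simplex m - open_simplex m) \<subseteq> A"
    and inj: "inj_on \<Phi> (open_simplex m)"
    and im: "\<Phi> ` open_simplex m = topspace Y - A"
begin

lemma cell_closed_map: "closed_map (top_of_set (std_simplex m)) Y \<Phi>"
  using cont Haus compact_std_simplex[of m]
  by (intro continuous_imp_closed_map) (auto simp: compact_space_subtopology)

lemma cell_preimage_complement: "{x \<in> std_simplex m. \<Phi> x \<in> topspace Y - A} = open_simplex m"
  using bd im open_simplex_subset[of m] by auto

text \<open>Excising \<open>A\<close> leaves the open cell. The map \<open>\<Phi>\<close> is a
  homeomorphism onto it, because a closed map stays closed when restricted to the full preimage of a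
  set.\<close>

lemma cell_local_homology:
  defines "T \<equiv> topspace Y - {\<Phi> (barycenter m)}"
  shows "has_rank (relative_homology_group (int p) Y T) (carrier (relative_homology_group (int p) Y T))
     (if p = m then 1 else 0)"
proof -
  let ?b = "barycenter m" and ?C = "topspace Y - A"
  have b: "\<Phi> ?b \<in> ?C" using im barycenter_in_open_simplex by blast
  have homeo: "homeomorphic_map (top_of_set (open_simplex m)) (subtopology Y ?C) \<Phi>"
  proof (rule bijective_closed_imp_homeomorphic_map)
    show "continuous_map (top_of_set (open_simplex m)) (subtopology Y ?C) \<Phi>"
      using cont im open_simplex_subset[of m] continuous_map_from_subtopology_mono[OF cont]
      by (auto simp: continuous_map_in_subtopology)
    have "closed_map (subtopology (top_of_set (std_simplex m)) (open_simplex m)) (subtopology Y ?C) \<Phi>"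
      using cell_preimage_complement by (intro closed_map_restriction[OF cell_closed_map]) auto
    then show "closed_map (top_of_set (open_simplex m)) (subtopology Y ?C) \<Phi>"
      using open_simplex_subset[of m] by (simp add: subtopology_subtopology inf.absorb2)
  qed (use im inj in auto)
  have im': "\<Phi> ` (open_simplex m - {?b}) = T - A"
    using inj_on_image_set_diff[OF inj, of "open_simplex m" "{?b}"]
      barycenter_in_open_simplex[of m] im by (auto simp: T_def)
  have "relative_homology_group (int p) (top_of_set (open_simplex m)) (open_simplex m - {?b}) \<cong>
      relative_homology_group (int p) (subtopology Y ?C) (T - A)"
    using homeomorphic_map_relative_homology_iso[OF homeo _ im', of "int p"] by (auto intro: is_isoI)
  also have "\<dots> \<cong> relative_homology_group (int p) (subtopology Y (topspace Y)) T"
  proof -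
    have "openin Y T"
      unfolding T_def using b Haus by (intro openin_diff) (auto simp: Hausdorff_imp_t1_space closedin_t1_singleton)
    then have "Y closure_of A \<subseteq> Y interior_of T"
      using clA b closedin_subset[OF clA]
      by (auto simp: closure_of_closedin interior_of_openin T_def)
    from homology_excision_axiom[OF this, of "topspace Y" "int p"] show ?thesis
      by (auto simp: T_def intro: is_isoI)
  qed
  finally have "relative_homology_group (int p) (top_of_set (open_simplex m)) (open_simplex m - {?b}) \<cong>
      relative_homology_group (int p) Y T" by simp
  from has_rank_iso[OF abelian_relative_homology_group abelian_relative_homology_group this local_homology_open_simplex]
  show ?thesis .
qed

text \<open>Pushing the punctured cell radially to its boundary while fixing \<open>A\<close> is a
  deformation retraction. The work lies in continuity, since the homotopy is given through a choice
  of preimages.\<close>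

lemma cell_deformation:
  "subtopology Y (topspace Y - {\<Phi> (barycenter m)}) homotopy_equivalent_space subtopology Y A"
proof -
  let ?b = "barycenter m"
  let ?y = "\<Phi> (barycenter m)"
  let ?D = "std_simplex m - {?b}"
  let ?I = "top_of_set {0..1::real}"
  define Z where "Z = subtopology Y (topspace Y - {?y})"
  have AY: "A \<subseteq> topspace Y" by (rule closedin_subset[OF clA])
  have y: "?y \<in> topspace Y" "?y \<notin> A" using im barycenter_in_open_simplex[of m] by auto
  have D: "\<Phi> x \<in> topspace Y - {?y} \<longleftrightarrow> x \<noteq> ?b" if x: "x \<in> std_simplex m" for x
  proof -
    have "\<Phi> x \<in> topspace Y" using cont x by (auto simp: continuous_map_def)
    moreover have "x = ?b" if "\<Phi> x = ?y"
    proof -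
      have "x \<in> open_simplex m" using bd x y that by auto
      with that inj barycenter_in_open_simplex show ?thesis by (auto simp: inj_on_def)
    qed
    ultimately show ?thesis by auto
  qed
  \<comment> \<open>Preimages are chosen only in the open simplex, where \<open>\<Phi>\<close> is
    injective; the boundary of the simplex lands in \<open>A\<close> and falls under the first
    case.\<close>
  define h where "h = (\<lambda>(t, z). if z \<in> A then z else \<Phi> (radial m t (inv_into (open_simplex m) \<Phi> z)))"
  have h\<Phi>: "h (t, \<Phi> x) = \<Phi> (radial m t x)" if "t \<in> {0..1}" "x \<in> ?D" for t x
  proof (cases "x \<in> open_simplex m")
    case True
    then have "\<Phi> x \<notin> A" using im by auto
    with True inj show ?thesis by (simp add: h_def)
  next
    case False
    then have "\<Phi> x \<in> A" using bd that by auto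
    moreover have "radial m t x = x" using that False by (intro radial_boundary) auto
    ultimately show ?thesis by (simp add: h_def)
  qed
  have hA: "h (t, z) = z" if "z \<in> A" for t z using that by (simp add: h_def)
  have cover: "z \<in> A \<or> z \<in> \<Phi> ` ?D" if "z \<in> topspace Z" for z
  proof (rule disjCI)
    assume "z \<notin> \<Phi> ` ?D"
    have z: "z \<in> topspace Y" "z \<noteq> ?y" using that by (auto simp: Z_def)
    show "z \<in> A"
    proof (rule ccontr)
      assume "z \<notin> A"
      then obtain x where "x \<in> open_simplex m" "z = \<Phi> x" using im z by blast
      with z \<open>z \<notin> \<Phi> ` ?D\<close> open_simplex_subset[of m] show False by auto
    qed
  qed
  have rad: "radial m t x \<in> ?D" if "t \<in> {0..1}" "x \<in> ?D" for t x
    using radial_in[of x m t] radial_neq[of x m t] that by auto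
  have \<Phi>D: "\<Phi> x \<in> topspace Y" "\<Phi> x \<noteq> ?y" if "x \<in> ?D" for x
    using D[of x] that by simp_all
  have \<Phi>Z: "\<Phi> x \<in> topspace Z" if "x \<in> ?D" for x
    using D[of x] that by (auto simp: Z_def)
  have clAZ: "closedin Z A"
  proof -
    have "closedin Z ((topspace Y - {?y}) \<inter> A)"
      unfolding Z_def using clA by (rule closedin_subtopology_Int_closed)
    moreover have "(topspace Y - {?y}) \<inter> A = A" using y AY by auto
    ultimately show ?thesis by simp
  qed
  have clDZ: "closedin Z (\<Phi> ` ?D)"
  proof -
    have "closedin Y (\<Phi> ` std_simplex m)"
      using cell_closed_map by (auto simp: closed_map_def)
    then have "closedin Z ((topspace Y - {?y}) \<inter> \<Phi> ` std_simplex m)"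
      unfolding Z_def by (rule closedin_subtopology_Int_closed)
    moreover have "(topspace Y - {?y}) \<inter> \<Phi> ` std_simplex m = \<Phi> ` ?D" using D by auto
    ultimately show ?thesis by simp
  qed
  have cont_h: "continuous_map (prod_topology ?I Z) Z h"
  \<comment> \<open>\<open>Z\<close> is the union of two closed pieces: \<open>A\<close>, where the
    homotopy is the projection, and the image of the punctured simplex.\<close>
  proof (rule pasting_lemma_closed[where I = "{True, False}"
        and T = "\<lambda>i. {0..1} \<times> (if i then A else \<Phi> ` ?D)" and f = "\<lambda>_. h"])
    fix i :: bool assume "i \<in> {True, False}"
    show "closedin (prod_topology ?I Z) ({0..1} \<times> (if i then A else \<Phi> ` ?D))"
      using clAZ clDZ by (auto simp: closedin_prod_Times_iff)
    show "continuous_map (subtopology (prod_topology ?I Z) ({0..1} \<times> (if i then A else \<Phi> ` ?D))) Z h"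
    proof (cases i)
      case True
      have "continuous_map (subtopology (prod_topology ?I Z) ({0..1} \<times> A)) Z snd"
        by (intro continuous_map_from_subtopology continuous_map_snd)
      then have "continuous_map (subtopology (prod_topology ?I Z) ({0..1} \<times> A)) Z h"
        by (rule continuous_map_eq) (auto simp: hA)
      with True show ?thesis by simp
    next
      case False
      let ?q = "\<lambda>(t, x). (t, \<Phi> x)"
      let ?P = "prod_topology ?I (top_of_set (std_simplex m))"
      have qc: "continuous_map ?P (prod_topology ?I Y) ?q"
        unfolding case_prod_unfold
        by (intro continuous_map_pairedI continuous_map_fst continuous_map_of_snd cont continuous_map_compose[OF continuous_map_snd cont, unfolded o_def])
      \<comment> \<open>Compactness is used before puncturing: restricted to the preimage of the
        punctured image the map is still closed, hence a quotient map, so that continuity of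
        \<open>h\<close> can be tested on the simplex.\<close>
      have "closed_map ?P (prod_topology ?I Y) ?q"
      proof (rule continuous_imp_closed_map[OF qc])
        show "compact_space ?P"
          unfolding compact_space_prod_topology using compact_std_simplex[of m]
          by (intro disjI2 conjI compact_space_subtopology) (simp_all add: compactin_euclidean_iff)
        show "Hausdorff_space (prod_topology ?I Y)"
          unfolding Hausdorff_space_prod_topology using Haus by (simp add: Hausdorff_space_subtopology)
      qed
      then have "closed_map (subtopology ?P ({0..1} \<times> ?D)) (subtopology (prod_topology ?I Y) ({0..1} \<times> \<Phi> ` ?D)) ?q"
      proof (rule closed_map_restriction)
        have "?y \<notin> \<Phi> ` ?D" using \<Phi>D(2) by (metis imageE)
        then have iff: "\<Phi> x \<in> \<Phi> ` ?D \<longleftrightarrow> x \<noteq> ?b" if "x \<in> std_simplex m" for x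
          using that by blast
        show "{p \<in> topspace ?P. ?q p \<in> {0..1} \<times> \<Phi> ` ?D} = {0..1} \<times> ?D"
        proof (rule Set.set_eqI)
          fix p :: "real \<times> (nat \<Rightarrow> real)"
          obtain t x where p: "p = (t, x)" by (cases p)
          have "p \<in> {p \<in> topspace ?P. ?q p \<in> {0..1} \<times> \<Phi> ` ?D} \<longleftrightarrow> t \<in> {0..1} \<and> x \<in> std_simplex m \<and> \<Phi> x \<in> \<Phi> ` ?D"
            unfolding p by (simp only: topspace_prod_topology topspace_euclidean_subtopology mem_Collect_eq
                mem_Times_iff prod.case fst_conv snd_conv) blast
          also have "\<dots> \<longleftrightarrow> p \<in> {0..1} \<times> ?D"
            using iff[of x] unfolding p by blast
          finally show "p \<in> {p \<in> topspace ?P. ?q p \<in> {0..1} \<times> \<Phi> ` ?D} \<longleftrightarrow> p \<in> {0..1} \<times> ?D" .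
        qed
      qed
      moreover have "continuous_map (subtopology ?P ({0..1} \<times> ?D)) (subtopology (prod_topology ?I Y) ({0..1} \<times> \<Phi> ` ?D)) ?q"
        unfolding continuous_map_in_subtopology
      proof (intro conjI)
        show "continuous_map (subtopology ?P ({0..1} \<times> ?D)) (prod_topology ?I Y) ?q"
          by (rule continuous_map_from_subtopology[OF qc])
        show "?q \<in> topspace (subtopology ?P ({0..1} \<times> ?D)) \<rightarrow> {0..1} \<times> \<Phi> ` ?D"
          by auto
      qed
      moreover have "?q ` topspace (subtopology ?P ({0..1} \<times> ?D)) = topspace (subtopology (prod_topology ?I Y) ({0..1} \<times> \<Phi> ` ?D))"
        using \<Phi>D(1) by (auto simp: image_iff)
      ultimately have "quotient_map (subtopology ?P ({0..1} \<times> ?D)) (subtopology (prod_topology ?I Y) ({0..1} \<times> \<Phi> ` ?D)) ?q"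
        by (intro continuous_closed_imp_quotient_map)
      moreover have "continuous_map (subtopology ?P ({0..1} \<times> ?D)) Z (h \<circ> ?q)"
      proof -
        have P: "subtopology ?P ({0..1} \<times> ?D) = top_of_set ({0..1} \<times> ?D)"
        proof -
          have "({0..1} \<times> std_simplex m) \<inter> ({0..1::real} \<times> ?D) = {0..1} \<times> ?D" by blast
          then show ?thesis by (simp add: subtopology_subtopology)
        qed
        have "continuous_map (top_of_set ({0..1} \<times> ?D)) (top_of_set (std_simplex m)) (\<lambda>(t, x). radial m t x)"
          unfolding continuous_map_in_subtopology
        proof
          show "continuous_map (top_of_set ({0..1} \<times> ?D)) euclidean (\<lambda>(t, x). radial m t x)"
            using continuous_on_radial[of m] by simp
          show "(\<lambda>(t, x). radial m t x) \<in> topspace (top_of_set ({0..1} \<times> ?D)) \<rightarrow> std_simplex m"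
          proof
            fix p assume "p \<in> topspace (top_of_set ({0..1::real} \<times> ?D))"
            then show "(case p of (t, x) \<Rightarrow> radial m t x) \<in> std_simplex m"
              using rad[of "fst p" "snd p"] by (simp add: case_prod_unfold mem_Times_iff)
          qed
        qed
        from continuous_map_compose[OF this cont]
        have "continuous_map (top_of_set ({0..1} \<times> ?D)) Y (\<Phi> \<circ> (\<lambda>(t, x). radial m t x))" .
        then have "continuous_map (top_of_set ({0..1} \<times> ?D)) Z (\<Phi> \<circ> (\<lambda>(t, x). radial m t x))"
          unfolding Z_def continuous_map_in_subtopology
        proof
          show "\<Phi> \<circ> (\<lambda>(t, x). radial m t x) \<in> topspace (top_of_set ({0..1} \<times> ?D)) \<rightarrow> topspace Y - {?y}"
          proof
            fix p assume "p \<in> topspace (top_of_set ({0..1::real} \<times> ?D))"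
            then have "radial m (fst p) (snd p) \<in> ?D"
              using rad[of "fst p" "snd p"] by (simp add: mem_Times_iff)
            then show "(\<Phi> \<circ> (\<lambda>(t, x). radial m t x)) p \<in> topspace Y - {?y}"
              using \<Phi>D by (simp add: case_prod_unfold)
          qed
        qed
        then show ?thesis unfolding P
        proof (rule continuous_map_eq)
          fix p assume "p \<in> topspace (top_of_set ({0..1::real} \<times> ?D))"
          then show "(\<Phi> \<circ> (\<lambda>(t, x). radial m t x)) p = (h \<circ> ?q) p"
            using h\<Phi>[of "fst p" "snd p"] by (simp add: case_prod_unfold mem_Times_iff)
        qed
      qed
      ultimately have "continuous_map (subtopology (prod_topology ?I Y) ({0..1} \<times> \<Phi> ` ?D)) Z h"
        by (rule continuous_compose_quotient_map)
      moreover have "subtopology (prod_topology ?I Z) ({0..1} \<times> \<Phi> ` ?D) = subtopology (prod_topology ?I Y) ({0..1} \<times> \<Phi> ` ?D)"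
      proof -
        have "\<Phi> ` ?D \<subseteq> topspace Y - {?y}" using \<Phi>D by (simp add: image_subset_iff)
        then show ?thesis
          by (simp add: Z_def subtopology_Times subtopology_subtopology inf.absorb2)
      qed
      ultimately show ?thesis using False by simp
    qed
  qed (use cover in \<open>auto split: if_splits\<close>)
  have cont1: "continuous_map Z (subtopology Y A) (\<lambda>z. h (1, z))"
  proof -
    have "continuous_map Z (prod_topology ?I Z) (\<lambda>z. (1, z))"
      by (intro continuous_map_pairedI) auto
    from continuous_map_compose[OF this cont_h] have "continuous_map Z Z (\<lambda>z. h (1, z))" by (simp add: o_def)
    then have "continuous_map Z Y (\<lambda>z. h (1, z))"
      unfolding Z_def by (simp add: continuous_map_in_subtopology)
    moreover have "h (1, z) \<in> A" if "z \<in> topspace Z" for z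
      using cover[OF that]
    proof
      assume "z \<in> \<Phi> ` ?D"
      then obtain x where x: "x \<in> ?D" "z = \<Phi> x" by blast
      then have "h (1, z) = \<Phi> (radial m 1 x)" using h\<Phi>[of 1 x] by simp
      then show ?thesis using x rad[of 1 x] radial_1_notin[of m x] bd by auto
    qed (simp add: hA)
    ultimately show ?thesis by (auto simp: continuous_map_in_subtopology)
  qed
  have "retraction_maps Z (subtopology Y A) (\<lambda>z. h (1, z)) id"
    unfolding retraction_maps_def
  proof (intro conjI ballI)
    show "continuous_map (subtopology Y A) Z id"
      unfolding Z_def using y AY by (auto simp: continuous_map_in_subtopology)
  qed (use cont1 hA in auto)
  moreover have "homotopic_with (\<lambda>x. True) Z Z id (\<lambda>z. h (1, z))"
  proof (subst homotopic_with, simp, intro exI[of _ h] conjI ballI TrueI)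
    show "continuous_map (prod_topology ?I Z) Z h" by (rule cont_h)
    fix z assume z: "z \<in> topspace Z"
    show "h (0, z) = id z"
      using cover[OF z]
    proof
      assume "z \<in> \<Phi> ` ?D"
      then obtain x where x: "x \<in> ?D" "z = \<Phi> x" by blast
      then have "h (0, z) = \<Phi> (radial m 0 x)" using h\<Phi>[of 0 x] by simp
      then show ?thesis using x by (simp add: radial_0)
    qed (simp add: hA)
  qed auto
  ultimately show ?thesis
    unfolding Z_def[symmetric]
    by (intro deformation_retraction_imp_homotopy_equivalent_space[of _ id]) (auto simp: homotopic_with_symD)
qed

text \<open>\<open>A\<close> has the homotopy type of \<open>Y\<close> minus one interior point of
  the cell, and relative to that complement \<open>Y\<close> has homology of rank 1, concentrated in
  degree \<open>m\<close>.\<close>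

lemma attach_cell:
  assumes "finite_homology (subtopology Y A)"
  shows "finite_homology Y" "euler_char Y = euler_char (subtopology Y A) + (-1) ^ m"
proof -
  have *: "subtopology Y A homotopy_equivalent_space subtopology Y (topspace Y - {\<Phi> (barycenter m)})"
    using cell_deformation homotopy_equivalent_space_sym by blast
  note T = finite_homology_homotopy_equivalent[OF * assms]
  note pair = finite_homology_pair[OF T(1) cell_local_homology]
  show "finite_homology Y" by (rule pair)
  show "euler_char Y = euler_char (subtopology Y A) + (-1) ^ m" using pair(2) T(2) by simp
qed

end

subsection \<open>Finitely many cells\<close>

text \<open>Induction on the number of cells, removing one of maximal dimension: no boundary of
  another cell meets it, so the remaining cells satisfy the hypotheses again.\<close>

theorem finite_homology_cells:
  fixes \<Phi> :: "'c \<Rightarrow> (nat \<Rightarrow> real) \<Rightarrow> 'a" and d :: "'c \<Rightarrow> nat"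
  assumes "finite E" "Hausdorff_space Y"
    and "\<And>c. c \<in> E \<Longrightarrow> continuous_map (top_of_set (std_simplex (d c))) Y (\<Phi> c)"
    and "\<And>c. c \<in> E \<Longrightarrow> inj_on (\<Phi> c) (open_simplex (d c))"
    and "\<And>c c'. c \<in> E \<Longrightarrow> c' \<in> E \<Longrightarrow> c \<noteq> c' \<Longrightarrow> \<Phi> c ` open_simplex (d c) \<inter> \<Phi> c' ` open_simplex (d c') = {}"
    and "\<And>c x. c \<in> E \<Longrightarrow> x \<in> std_simplex (d c) - open_simplex (d c) \<Longrightarrow>
           \<exists>c'\<in>E. d c' < d c \<and> \<Phi> c x \<in> \<Phi> c' ` open_simplex (d c')"
    and "topspace Y = (\<Union>c\<in>E. \<Phi> c ` open_simplex (d c))"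
  shows "finite_homology Y \<and> euler_char Y = (\<Sum>c\<in>E. (-1) ^ d c)"
  using assms
proof (induction "card E" arbitrary: E Y)
  case 0
  then show ?case using finite_homology_empty[of Y] by simp
next
  case (Suc n)
  note fin = Suc.prems(1) and Haus = Suc.prems(2) and cont = Suc.prems(3) and inj = Suc.prems(4)
    and disj = Suc.prems(5) and bd = Suc.prems(6) and cover = Suc.prems(7)
  have "E \<noteq> {}" using Suc.hyps by auto
  then have "Max (d ` E) \<in> d ` E" using fin by (intro Max_in) auto
  then obtain c where "c \<in> E" "d c = Max (d ` E)" by (metis imageE)
  then have c: "c \<in> E" "\<And>c'. c' \<in> E \<Longrightarrow> d c' \<le> d c"
    using fin by simp_all
  define E' where "E' = E - {c}"
  define A where "A = (\<Union>c\<in>E'. \<Phi> c ` open_simplex (d c))"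
  have bd': "\<exists>c''\<in>E'. d c'' < d c' \<and> \<Phi> c' x \<in> \<Phi> c'' ` open_simplex (d c'')"
    if "c' \<in> E" "x \<in> std_simplex (d c') - open_simplex (d c')" for c' x
    using bd[OF that] c(2)[OF that(1)] by (auto simp: E'_def)
  \<comment> \<open>Passing to closed cells adds nothing, as their boundaries lie in cells that are
    kept; so \<open>A\<close> is a finite union of compact sets and hence closed.\<close>
  have A: "A = (\<Union>c\<in>E'. \<Phi> c ` std_simplex (d c))"
  proof
    show "A \<subseteq> (\<Union>c\<in>E'. \<Phi> c ` std_simplex (d c))"
      using open_simplex_subset by (fastforce simp: A_def)
    show "(\<Union>c\<in>E'. \<Phi> c ` std_simplex (d c)) \<subseteq> A"
    proof clarify
      fix c' x assume "c' \<in> E'" "x \<in> std_simplex (d c')"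
      then show "\<Phi> c' x \<in> A"
        using bd'[of c' x] by (cases "x \<in> open_simplex (d c')") (auto simp: A_def E'_def)
    qed
  qed
  have "closedin Y (\<Phi> c' ` std_simplex (d c'))" if "c' \<in> E'" for c'
    using that cont[of c'] compact_std_simplex[of "d c'"] Haus
    by (intro compactin_imp_closedin image_compactin[of "top_of_set (std_simplex (d c'))"])
      (auto simp: E'_def compactin_subtopology)
  then have clA: "closedin Y A" unfolding A using fin by (intro closedin_Union) (auto simp: E'_def)
  have AY: "topspace (subtopology Y A) = A" using closedin_subset[OF clA] by auto
  have IH: "finite_homology (subtopology Y A) \<and> euler_char (subtopology Y A) = (\<Sum>c\<in>E'. (-1) ^ d c)"
  proof (rule Suc.hyps(1))
    show "n = card E'" using Suc.hyps(2) c(1) fin by (simp add: E'_def)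
    show "Hausdorff_space (subtopology Y A)" using Haus by (rule Hausdorff_space_subtopology)
    fix c' assume c': "c' \<in> E'"
    then show "continuous_map (top_of_set (std_simplex (d c'))) (subtopology Y A) (\<Phi> c')"
      using cont[of c'] A by (auto simp: continuous_map_in_subtopology E'_def)
    show "\<exists>c''\<in>E'. d c'' < d c' \<and> \<Phi> c' x \<in> \<Phi> c'' ` open_simplex (d c'')"
      if "x \<in> std_simplex (d c') - open_simplex (d c')" for x
      using bd'[of c' x] that c' by (auto simp: E'_def)
  qed (use fin inj disj AY in \<open>auto simp: E'_def A_def\<close>)
  have im: "\<Phi> c ` open_simplex (d c) = topspace Y - A"
    using disj[OF c(1)] cover c(1) by (auto simp: A_def E'_def)
  have "\<Phi> c ` (std_simplex (d c) - open_simplex (d c)) \<subseteq> A"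
    using bd'[OF c(1)] unfolding A_def by blast
  note att = attach_cell[OF Haus clA cont[OF c(1)] this inj[OF c(1)] im]
  have "(\<Sum>c\<in>E. (-1) ^ d c) = (-1) ^ d c + (\<Sum>c\<in>E'. (-1::int) ^ d c)"
    using c(1) fin by (simp add: E'_def sum.remove)
  with att IH show ?case by simp
qed

section \<open>Symmetric products\<close>

text \<open>The constructor \<open>topology\<close> has the intended open sets only for families
  satisfying the axioms; these hold because preimages commute with unions and intersections.\<close>

lemma openin_quotient_topology:
  "openin (quotient_topology Y q) U \<longleftrightarrow> U \<subseteq> q ` topspace Y \<and> openin Y {x \<in> topspace Y. q x \<in> U}"
proof -
  have "istopology (\<lambda>U. U \<subseteq> q ` topspace Y \<and> openin Y {x \<in> topspace Y. q x \<in> U})"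
    unfolding istopology_def
  proof (intro conjI allI impI)
    fix S T assume "S \<subseteq> q ` topspace Y \<and> openin Y {x \<in> topspace Y. q x \<in> S}"
      and "T \<subseteq> q ` topspace Y \<and> openin Y {x \<in> topspace Y. q x \<in> T}"
    then have "openin Y ({x \<in> topspace Y. q x \<in> S} \<inter> {x \<in> topspace Y. q x \<in> T})" by blast
    moreover have "{x \<in> topspace Y. q x \<in> S} \<inter> {x \<in> topspace Y. q x \<in> T} = {x \<in> topspace Y. q x \<in> S \<inter> T}"
      by blast
    ultimately show "openin Y {x \<in> topspace Y. q x \<in> S \<inter> T}" by simp
  next
    fix \<U> assume "\<forall>K\<in>\<U>. K \<subseteq> q ` topspace Y \<and> openin Y {x \<in> topspace Y. q x \<in> K}"
    then have "openin Y (\<Union>K\<in>\<U>. {x \<in> topspace Y. q x \<in> K})" by blast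
    moreover have "(\<Union>K\<in>\<U>. {x \<in> topspace Y. q x \<in> K}) = {x \<in> topspace Y. q x \<in> \<Union>\<U>}" by blast
    ultimately show "openin Y {x \<in> topspace Y. q x \<in> \<Union>\<U>}" by simp
  qed blast+
  then show ?thesis by (simp add: quotient_topology_def)
qed

lemma topspace_quotient_topology: "topspace (quotient_topology Y q) = q ` topspace Y"
proof
  have "{x \<in> topspace Y. q x \<in> q ` topspace Y} = topspace Y" by blast
  then have "openin (quotient_topology Y q) (q ` topspace Y)"
    by (simp add: openin_quotient_topology)
  then show "q ` topspace Y \<subseteq> topspace (quotient_topology Y q)" by (rule openin_subset)
  show "topspace (quotient_topology Y q) \<subseteq> q ` topspace Y"
    using openin_topspace[of "quotient_topology Y q"] unfolding openin_quotient_topology by blast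
qed

lemma quotient_map_quotient_topology: "quotient_map Y (quotient_topology Y q) q"
  unfolding quotient_map_def
  by (simp add: topspace_quotient_topology openin_quotient_topology)

section \<open>Orbits of tuples as multisets\<close>

lemma size_sym_quot: "size (sym_quot n x) = n"
  by (simp add: sym_quot_def)

lemma set_sym_quot: "set_mset (sym_quot n x) = x ` {..<n}"
  by (simp add: sym_quot_def)

lemma sym_quot_restrict: "sym_quot n (restrict x {..<n}) = sym_quot n x"
  unfolding sym_quot_def by (intro image_mset_cong) simp

lemma image_mset_sym_quot: "image_mset f (sym_quot n x) = sym_quot n (\<lambda>i. f (x i))"
  by (simp add: sym_quot_def multiset.map_comp o_def)

lemma count_sym_quot: "count (sym_quot n x) z = card {i. i < n \<and> x i = z}"
proof -
  have "x -` {z} \<inter> {..<n} = {i. i < n \<and> x i = z}" by auto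
  then show ?thesis by (simp add: sym_quot_def count_image_mset)
qed

lemma sum_mset_sym_quot: "(\<Sum>z\<in>#sym_quot n x. f z) = (\<Sum>i<n. f (x i))"
  by (simp add: sym_quot_def multiset.map_comp o_def sum_unfold_sum_mset)

lemma sym_quot_surj:
  assumes "size M = n" "set_mset M \<subseteq> A"
  shows "\<exists>x \<in> {..<n} \<rightarrow>\<^sub>E A. sym_quot n x = M"
proof -
  obtain xs where xs: "mset xs = M" by (meson ex_mset)
  then have len: "length xs = n" using assms by auto
  define x where "x = restrict ((!) xs) {..<n}"
  have "sym_quot n x = image_mset ((!) xs) (mset_set {..<length xs})"
    by (simp add: x_def sym_quot_restrict len) (simp add: sym_quot_def)
  also have "\<dots> = mset (map ((!) xs) [0..<length xs])"
    by (simp add: atLeast0LessThan)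
  finally have "sym_quot n x = M" using xs by (simp add: map_nth)
  moreover have "x \<in> {..<n} \<rightarrow>\<^sub>E A"
    using assms xs len by (auto simp: x_def)
  ultimately show ?thesis by blast
qed

lemma topspace_symprod: "topspace (symprod n X) = {M. size M = n \<and> set_mset M \<subseteq> topspace X}"
proof
  show "topspace (symprod n X) \<subseteq> {M. size M = n \<and> set_mset M \<subseteq> topspace X}"
    by (auto simp: symprod_def topspace_quotient_topology size_sym_quot set_sym_quot PiE_def Pi_def)
  show "{M. size M = n \<and> set_mset M \<subseteq> topspace X} \<subseteq> topspace (symprod n X)"
  proof
    fix M assume "M \<in> {M. size M = n \<and> set_mset M \<subseteq> topspace X}"
    then obtain x where "x \<in> {..<n} \<rightarrow>\<^sub>E topspace X" "sym_quot n x = M"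
      using sym_quot_surj[of M n "topspace X"] by blast
    then show "M \<in> topspace (symprod n X)"
      by (auto simp: symprod_def topspace_quotient_topology)
  qed
qed

text \<open>The set underlying \<open>B\<^sub>d\<close>, for an arbitrary set \<open>A\<close>: it
  is applied both to the points of a space and to finite sets of simplices.\<close>

definition fat_multisets :: "nat \<Rightarrow> 'a set \<Rightarrow> nat \<Rightarrow> 'a multiset set" where
  "fat_multisets d A n = {M. size M = n \<and> set_mset M \<subseteq> A \<and> (\<exists>z. d \<le> count M z)}"

text \<open>Multiplicity counts positions with a given entry. Since \<open>1 \<le> d\<close>, the
  set of equal positions is nonempty and supplies the repeated entry.\<close>

lemma sym_quot_fat_diag:
  assumes "1 \<le> d"
  shows "sym_quot n ` fat_diag d X n = fat_multisets d (topspace X) n"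
proof
  show "sym_quot n ` fat_diag d X n \<subseteq> fat_multisets d (topspace X) n"
  proof clarify
    fix x assume x: "x \<in> fat_diag d X n"
    then obtain I where I: "I \<subseteq> {..<n}" "card I = d" "\<forall>i\<in>I. \<forall>j\<in>I. x i = x j"
      by (auto simp: fat_diag_def)
    then obtain i where i: "i \<in> I" using assms by fastforce
    have "I \<subseteq> {j. j < n \<and> x j = x i}" using I i by blast
    then have "d \<le> count (sym_quot n x) (x i)"
      using I(2) card_mono[of "{j. j < n \<and> x j = x i}" I] by (simp add: count_sym_quot)
    moreover have "set_mset (sym_quot n x) \<subseteq> topspace X"
      using x by (auto simp: fat_diag_def set_sym_quot)
    ultimately show "sym_quot n x \<in> fat_multisets d (topspace X) n"
      by (auto simp: fat_multisets_def size_sym_quot)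
  qed
  show "fat_multisets d (topspace X) n \<subseteq> sym_quot n ` fat_diag d X n"
  proof
    fix M assume M: "M \<in> fat_multisets d (topspace X) n"
    then obtain z where z: "d \<le> count M z" by (auto simp: fat_multisets_def)
    obtain x where x: "x \<in> {..<n} \<rightarrow>\<^sub>E topspace X" "sym_quot n x = M"
      using sym_quot_surj[of M n "topspace X"] M by (auto simp: fat_multisets_def)
    have "d \<le> card {i. i < n \<and> x i = z}" using z x(2) by (metis count_sym_quot)
    then obtain I where "I \<subseteq> {i. i < n \<and> x i = z}" "card I = d"
      by (meson obtain_subset_with_card_n)
    then have "x \<in> fat_diag d X n"
      using x(1) by (auto simp: fat_diag_def intro!: exI[of _ I])
    with x(2) show "M \<in> sym_quot n ` fat_diag d X n" by blast
  qed
qed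

lemma Bd_space_eq:
  "1 \<le> d \<Longrightarrow> Bd_space d X n = subtopology (symprod n X) (fat_multisets d (topspace X) n)"
  by (simp add: Bd_space_def sym_quot_fat_diag)

lemma topspace_Bd_space: "1 \<le> d \<Longrightarrow> topspace (Bd_space d X n) = fat_multisets d (topspace X) n"
  by (auto simp: Bd_space_eq topspace_symprod fat_multisets_def)

text \<open>A map can merge entries but never separates equal ones; this makes fat multisets
  functorial.\<close>

lemma count_image_mset_le: "count M z \<le> count (image_mset f M) (f z)"
proof (cases "z \<in># M")
  case True
  then show ?thesis
    by (auto simp: count_image_mset intro!: member_le_sum)
qed (simp add: not_in_iff)

lemma image_mset_fat_multisets:
  assumes "M \<in> fat_multisets d A n" "\<And>x. x \<in> A \<Longrightarrow> f x \<in> B"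
  shows "image_mset f M \<in> fat_multisets d B n"
proof -
  obtain z where "d \<le> count M z" using assms(1) by (auto simp: fat_multisets_def)
  then have "d \<le> count (image_mset f M) (f z)" by (rule order_trans[OF _ count_image_mset_le])
  moreover have "f ` set_mset M \<subseteq> B" using assms by (auto simp: fat_multisets_def)
  ultimately show ?thesis using assms(1) by (auto simp: fat_multisets_def)
qed

subsection \<open>Homotopy invariance\<close>

text \<open>The unit interval is locally compact Hausdorff, so its product with the orbit map is
  still a quotient map; the homotopy can then be tested on tuples, one coordinate at a time.\<close>

lemma continuous_map_symprod_homotopy:
  assumes h: "continuous_map (prod_topology (top_of_set {0..1::real}) X) Y h"
  shows "continuous_map (prod_topology (top_of_set {0..1}) (symprod n X)) (symprod n Y)
    (\<lambda>(t, M). image_mset (\<lambda>x. h (t, x)) M)"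
proof -
  let ?I = "top_of_set {0..1::real}"
  let ?X = "product_topology (\<lambda>i. X) {..<n}"
  have "quotient_map ?X (symprod n X) (sym_quot n)"
    unfolding symprod_def by (rule quotient_map_quotient_topology)
  then have "quotient_map (prod_topology ?I ?X) (prod_topology ?I (symprod n X)) (\<lambda>(t, x). (t, sym_quot n x))"
    by (intro quotient_map_prod_right)
      (auto intro!: compact_imp_locally_compact_space compact_space_subtopology Hausdorff_space_subtopology)
  moreover have "continuous_map (prod_topology ?I ?X) (symprod n Y)
     ((\<lambda>(t, M). image_mset (\<lambda>x. h (t, x)) M) \<circ> (\<lambda>(t, x). (t, sym_quot n x)))"
  proof -
    have comp: "continuous_map (prod_topology ?I ?X) Y (\<lambda>p. h (fst p, snd p i))" if "i \<in> {..<n}" for i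
    proof -
      have "continuous_map (prod_topology ?I ?X) (prod_topology ?I X) (\<lambda>p. (fst p, snd p i))"
      proof (rule continuous_map_pairedI)
        show "continuous_map (prod_topology ?I ?X) X (\<lambda>p. snd p i)"
          using continuous_map_compose[OF continuous_map_snd continuous_map_product_projection[OF that]]
          by (simp add: o_def)
      qed (rule continuous_map_fst)
      from continuous_map_compose[OF this h] show ?thesis by (simp add: o_def)
    qed
    have "continuous_map (prod_topology ?I ?X) (product_topology (\<lambda>i. Y) {..<n})
      (\<lambda>p. restrict (\<lambda>i. h (fst p, snd p i)) {..<n})"
      unfolding continuous_map_componentwise
    proof (intro conjI ballI)
      fix i assume i: "i \<in> {..<n}"
      show "continuous_map (prod_topology ?I ?X) Y (\<lambda>p. restrict (\<lambda>i. h (fst p, snd p i)) {..<n} i)"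
        using i by (intro continuous_map_eq[OF comp[OF i]]) simp
    qed auto
    moreover have "continuous_map (product_topology (\<lambda>i. Y) {..<n}) (symprod n Y) (sym_quot n)"
      unfolding symprod_def by (rule quotient_imp_continuous_map[OF quotient_map_quotient_topology])
    ultimately have "continuous_map (prod_topology ?I ?X) (symprod n Y)
      (sym_quot n \<circ> (\<lambda>p. restrict (\<lambda>i. h (fst p, snd p i)) {..<n}))"
      by (rule continuous_map_compose)
    then show ?thesis
      by (rule continuous_map_eq) (simp add: sym_quot_restrict image_mset_sym_quot case_prod_unfold)
  qed
  ultimately show ?thesis by (rule continuous_compose_quotient_map)
qed

lemma continuous_map_Bd_homotopy:
  assumes d: "1 \<le> d" and h: "continuous_map (prod_topology (top_of_set {0..1::real}) X) Y h"
  shows "continuous_map (prod_topology (top_of_set {0..1}) (Bd_space d X n)) (Bd_space d Y n)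
    (\<lambda>(t, M). image_mset (\<lambda>x. h (t, x)) M)"
proof -
  let ?I = "top_of_set {0..1::real}"
  have "prod_topology ?I (Bd_space d X n) =
      subtopology (prod_topology ?I (symprod n X)) ({0..1} \<times> fat_multisets d (topspace X) n)"
    by (simp add: Bd_space_eq[OF d] prod_topology_subtopology(2))
  then have "continuous_map (prod_topology ?I (Bd_space d X n)) (symprod n Y)
    (\<lambda>(t, M). image_mset (\<lambda>x. h (t, x)) M)"
    using continuous_map_from_subtopology[OF continuous_map_symprod_homotopy[OF h, of n]] by simp
  moreover have "(\<lambda>(t, M). image_mset (\<lambda>x. h (t, x)) M) \<in>
      topspace (prod_topology ?I (Bd_space d X n)) \<rightarrow> fat_multisets d (topspace Y) n"
  proof clarify
    fix t M assume "(t, M) \<in> topspace (prod_topology ?I (Bd_space d X n))"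
    then have tM: "t \<in> {0..1}" "M \<in> fat_multisets d (topspace X) n"
      by (simp_all add: topspace_Bd_space[OF d])
    have "h (t, x) \<in> topspace Y" if "x \<in> topspace X" for x
    proof -
      have "(t, x) \<in> topspace (prod_topology ?I X)" using tM(1) that by simp
      then show ?thesis using continuous_map_image_subset_topspace[OF h] by blast
    qed
    then show "image_mset (\<lambda>x. h (t, x)) M \<in> fat_multisets d (topspace Y) n"
      by (rule image_mset_fat_multisets[OF tM(2)])
  qed
  ultimately show ?thesis
    by (simp only: Bd_space_eq[OF d] continuous_map_in_subtopology)
qed

lemma continuous_map_Bd:
  assumes d: "1 \<le> d" and f: "continuous_map X Y f"
  shows "continuous_map (Bd_space d X n) (Bd_space d Y n) (image_mset f)"
proof -
  let ?I = "top_of_set {0..1::real}"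
  have "continuous_map (prod_topology ?I X) Y (\<lambda>p. f (snd p))"
    using continuous_map_compose[OF continuous_map_snd f] by (simp add: o_def)
  from continuous_map_Bd_homotopy[OF d this]
  have 1: "continuous_map (prod_topology ?I (Bd_space d X n)) (Bd_space d Y n) (\<lambda>(t, M). image_mset f M)"
    by simp
  have "continuous_map (Bd_space d X n) (prod_topology ?I (Bd_space d X n)) (\<lambda>M. (0, M))"
    by (intro continuous_map_pairedI) auto
  from continuous_map_compose[OF this 1] show ?thesis by (simp add: o_def)
qed

lemma homotopic_Bd:
  assumes d: "1 \<le> d" and fg: "homotopic_with (\<lambda>_. True) X Y f g"
  shows "homotopic_with (\<lambda>_. True) (Bd_space d X n) (Bd_space d Y n) (image_mset f) (image_mset g)"
proof -
  obtain h where h: "continuous_map (prod_topology (top_of_set {0..1::real}) X) Y h"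
      "\<And>x. h (0, x) = f x" "\<And>x. h (1, x) = g x"
    using fg unfolding homotopic_with_def by blast
  show ?thesis
    unfolding homotopic_with_def
    using continuous_map_Bd_homotopy[OF d h(1), of n]
    by (intro exI[of _ "\<lambda>(t, M). image_mset (\<lambda>x. h (t, x)) M"]) (simp add: h(2,3))
qed

lemma Bd_space_homotopy_equivalent:
  assumes d: "1 \<le> d" and "X homotopy_equivalent_space Y"
  shows "Bd_space d X n homotopy_equivalent_space Bd_space d Y n"
proof -
  obtain f g where fg: "continuous_map X Y f" "continuous_map Y X g"
      "homotopic_with (\<lambda>_. True) X X (g \<circ> f) id" "homotopic_with (\<lambda>_. True) Y Y (f \<circ> g) id"
    using assms(2) unfolding homotopy_equivalent_space_def by blast
  have comp: "image_mset (g \<circ> f) = image_mset g \<circ> image_mset f" "image_mset (f \<circ> g) = image_mset f \<circ> image_mset g"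
    "image_mset id = id" "image_mset id = id"
    by (simp_all add: fun_eq_iff multiset.map_comp)
  show ?thesis
    unfolding homotopy_equivalent_space_def
    using continuous_map_Bd[OF d fg(1), of n] continuous_map_Bd[OF d fg(2), of n]
      homotopic_Bd[OF d fg(3), of n] homotopic_Bd[OF d fg(4), of n]
    unfolding comp multiset.map_id0 by blast
qed

subsection \<open>Symmetric products of metrizable spaces are Hausdorff\<close>

text \<open>Symmetric sums descend to orbits; they supply the real functions that separate multisets
  below.\<close>

lemma continuous_map_sum_mset_symprod:
  assumes "continuous_map X euclideanreal f"
  shows "continuous_map (symprod n X) euclideanreal (\<lambda>M. \<Sum>x\<in>#M. f x)"
proof -
  have "continuous_map (product_topology (\<lambda>i. X) {..<n}) euclideanreal (\<lambda>x. \<Sum>i<n. f (x i))"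
  proof (intro continuous_map_sum)
    fix i assume "i \<in> {..<n}"
    from continuous_map_compose[OF continuous_map_product_projection[OF this] assms]
    show "continuous_map (product_topology (\<lambda>i. X) {..<n}) euclideanreal (\<lambda>x. f (x i))"
      by (simp add: o_def)
  qed simp
  then have "continuous_map (product_topology (\<lambda>i. X) {..<n}) euclideanreal ((\<lambda>M. \<Sum>x\<in>#M. f x) \<circ> sym_quot n)"
    by (simp add: o_def sum_mset_sym_quot)
  then show ?thesis
    unfolding symprod_def by (rule continuous_compose_quotient_map[OF quotient_map_quotient_topology])
qed

text \<open>Two multisets with different multiplicity at \<open>z\<close> are separated by summing the distances to
  the finite set of all their other elements.\<close>

lemma Hausdorff_symprod:
  fixes S :: "'a::metric_space set"
  shows "Hausdorff_space (symprod n (top_of_set S))"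
  unfolding Hausdorff_space_def
proof (intro allI impI, elim conjE)
  fix M N assume M: "M \<in> topspace (symprod n (top_of_set S))" and N: "N \<in> topspace (symprod n (top_of_set S))"
    and "M \<noteq> N"
  then have size: "size M = n" "size N = n" by (auto simp: topspace_symprod)
  obtain z where z: "count M z \<noteq> count N z" using \<open>M \<noteq> N\<close> by (meson multiset_eqI)
  define F where "F = (set_mset M \<union> set_mset N) - {z}"
  have finF: "finite F" by (simp add: F_def)
  \<comment> \<open>If \<open>z\<close> were the only element, both multisets would be
    \<open>n\<close> copies of it. Nonemptiness matters because \<open>infdist\<close> to the empty
    set is 0 by convention.\<close>
  have "F \<noteq> {}"
  proof
    assume "F = {}"
    then have "set_mset M \<subseteq> {z}" "set_mset N \<subseteq> {z}" by (auto simp: F_def)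
    then have "M = replicate_mset n z" "N = replicate_mset n z"
      using size set_mset_subset_singletonD by metis+
    with z show False by simp
  qed
  then have pos: "infdist z F > 0"
    using finF in_closed_iff_infdist_zero[of F z] infdist_nonneg[of z F]
    by (auto simp: finite_imp_closed F_def less_le)
  define \<phi> where "\<phi> = (\<lambda>M. \<Sum>x\<in>#M. infdist x F)"
  have val: "set_mset L \<subseteq> insert z F \<Longrightarrow> \<phi> L = real (count L z) * infdist z F" for L
    by (induction L) (auto simp: \<phi>_def algebra_simps)
  have sub: "set_mset M \<subseteq> insert z F" "set_mset N \<subseteq> insert z F" by (auto simp: F_def)
  have "\<phi> M \<noteq> \<phi> N" using z pos by (simp add: val sub)
  then obtain U V where UV: "open U" "open V" "\<phi> M \<in> U" "\<phi> N \<in> V" "U \<inter> V = {}"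
    using hausdorff by metis
  have cont: "continuous_map (symprod n (top_of_set S)) euclideanreal \<phi>"
    unfolding \<phi>_def by (intro continuous_map_sum_mset_symprod) (auto intro!: continuous_intros)
  let ?P = "\<lambda>U. {M \<in> topspace (symprod n (top_of_set S)). \<phi> M \<in> U}"
  have "openin (symprod n (top_of_set S)) (?P U)" "openin (symprod n (top_of_set S)) (?P V)"
    using openin_continuous_map_preimage[OF cont] UV by auto
  moreover have "disjnt (?P U) (?P V)" using UV(5) by (auto simp: disjnt_def)
  moreover have "M \<in> ?P U" "N \<in> ?P V" using M N UV by auto
  ultimately show "\<exists>U V. openin (symprod n (top_of_set S)) U \<and> openin (symprod n (top_of_set S)) V \<and>
      M \<in> U \<and> N \<in> V \<and> disjnt U V" by blast
qed

section \<open>Cell decomposition\<close>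

subsection \<open>Ranks in finite linearly ordered sets\<close>

text \<open>On \<open>W\<close> this is the order isomorphism onto an initial segment of the
  naturals. It is defined on the whole type, where it is still weakly monotone, so that it composes
  with every staircase.\<close>

definition rank_in :: "'v::linorder set \<Rightarrow> 'v \<Rightarrow> nat" where
  "rank_in W w = card {u \<in> W. u < w}"

definition unrank :: "'v::linorder set \<Rightarrow> nat \<Rightarrow> 'v" where
  "unrank W = inv_into W (rank_in W)"

lemma rank_in_mono: "finite W \<Longrightarrow> v \<le> w \<Longrightarrow> rank_in W v \<le> rank_in W w"
  unfolding rank_in_def by (intro card_mono) auto

lemma rank_in_strict_mono:
  assumes "finite W" "v \<in> W" "v < w"
  shows "rank_in W v < rank_in W w"
  unfolding rank_in_def using assms by (intro psubset_card_mono) auto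

lemma rank_in_inj: "finite W \<Longrightarrow> inj_on (rank_in W) W"
  by (rule inj_onI) (metis linorder_less_linear rank_in_strict_mono less_irrefl)

lemma rank_in_less_card: "finite W \<Longrightarrow> w \<in> W \<Longrightarrow> rank_in W w < card W"
  unfolding rank_in_def by (intro psubset_card_mono) auto

lemma rank_in_image:
  assumes "finite W"
  shows "rank_in W ` W = {..<card W}"
proof (rule card_subset_eq)
  show "rank_in W ` W \<subseteq> {..<card W}" using rank_in_less_card[OF assms] by auto
  show "card (rank_in W ` W) = card {..<card W}" by (simp add: card_image rank_in_inj assms)
qed simp

lemma unrank_rank: "finite W \<Longrightarrow> w \<in> W \<Longrightarrow> unrank W (rank_in W w) = w"
  unfolding unrank_def by (simp add: rank_in_inj)

lemma unrank_in:
  assumes "finite W" "k < card W"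
  shows "unrank W k \<in> W"
  unfolding unrank_def using assms rank_in_image[OF assms(1)] by (intro inv_into_into) auto

lemma rank_unrank:
  assumes "finite W" "k < card W"
  shows "rank_in W (unrank W k) = k"
  unfolding unrank_def using assms rank_in_image[OF assms(1)] by (intro f_inv_into_f) auto

lemma unrank_strict_mono:
  assumes "finite W" "k < l" "l < card W"
  shows "unrank W k < unrank W l"
proof (rule ccontr)
  assume "\<not> unrank W k < unrank W l"
  then have "rank_in W (unrank W l) \<le> rank_in W (unrank W k)"
    using assms(1) by (intro rank_in_mono) auto
  then show False using assms rank_unrank[OF assms(1), of k] rank_unrank[OF assms(1), of l] by simp
qed

lemma unrank_image:
  assumes "finite W"
  shows "unrank W ` {..<card W} = W"
proof
  show "unrank W ` {..<card W} \<subseteq> W" using unrank_in[OF assms] by auto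
  show "W \<subseteq> unrank W ` {..<card W}"
    using unrank_rank[OF assms] rank_in_less_card[OF assms] by (metis imageI lessThan_iff subsetI)
qed

lemma rank_in_strict_mono_image:
  assumes "\<And>k l. k < l \<Longrightarrow> l \<le> n \<Longrightarrow> c k < c l" "k \<le> n"
  shows "rank_in (c ` {..n}) (c k) = k"
proof -
  have less: "c l < c k \<longleftrightarrow> l < k" if "l \<le> n" for l
    using assms(1)[of k l] assms(1)[of l k] assms(2) that by (metis less_asym less_irrefl linorder_neqE_nat)
  have "{u \<in> c ` {..n}. u < c k} = c ` {..<k}"
    using less assms(2) by auto
  moreover have "inj_on c {..<k}"
    by (rule inj_onI) (use assms in \<open>metis lessThan_iff less_irrefl less_le_trans less_imp_le linorder_neqE_nat\<close>)
  ultimately show ?thesis by (simp add: rank_in_def card_image)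
qed

subsection \<open>Staircases\<close>

text \<open>A point with barycentric coordinates \<open>x\<^sub>0, \<dots>, x\<^bsub>N-1\<^esub>\<close> is encoded by its partial sums, a monotone
  function from \<open>0\<close> to \<open>1\<close> whose set of jumps is the carrier simplex. With values in \<open>{0..m+1}\<close> instead of
  reals the same encoding describes the weakly monotone sequences of \<open>m + 1\<close> vertices of a simplex.\<close>

definition staircases :: "nat set set \<Rightarrow> nat \<Rightarrow> 'v::linorder \<Rightarrow> 'v \<Rightarrow> (nat \<Rightarrow> 'v) set" where
  "staircases \<S> N b t = {a. a 0 = b \<and> (\<forall>i\<ge>N. a i = t) \<and> mono a \<and> {i. a i \<noteq> a (Suc i)} \<in> \<S>}"

text \<open>The levels used by any member of the multiset. Their number, minus 2 for the two extreme
  levels, will be the dimension of the cell containing a point.\<close>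

definition value_set :: "(nat \<Rightarrow> 'v) multiset \<Rightarrow> 'v set" where
  "value_set M = (\<Union>a\<in>set_mset M. range a)"

text \<open>Monotone relabelling of levels can remove jumps but not create them, and
  \<open>\<S>\<close> is closed under subsets. Characteristic maps and normal forms below are
  instances.\<close>

lemma staircases_compose:
  assumes "\<And>S T. S \<in> \<S> \<Longrightarrow> T \<subseteq> S \<Longrightarrow> T \<in> \<S>"
    and a: "a \<in> staircases \<S> N b t" and "range a \<subseteq> W"
    and f: "\<And>v w. v \<in> W \<Longrightarrow> w \<in> W \<Longrightarrow> v \<le> w \<Longrightarrow> f v \<le> f w" "f b = b'" "f t = t'"
  shows "f \<circ> a \<in> staircases \<S> N b' t'"
proof -
  have "mono (f \<circ> a)"
    using a assms(3) f(1) by (auto simp: staircases_def mono_def image_subset_iff)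
  moreover have "{i. (f \<circ> a) i \<noteq> (f \<circ> a) (Suc i)} \<subseteq> {i. a i \<noteq> a (Suc i)}" by auto
  then have "{i. (f \<circ> a) i \<noteq> (f \<circ> a) (Suc i)} \<in> \<S>"
    using assms(1) a by (auto simp: staircases_def)
  ultimately show ?thesis using a f(2,3) by (auto simp: staircases_def)
qed

lemma staircases_range:
  assumes "a \<in> staircases \<S> N b t"
  shows "range a \<subseteq> {b..t}" "b \<in> range a" "t \<in> range a" "range a = a ` {..N}"
proof -
  have a: "a 0 = b" "\<And>i. i \<ge> N \<Longrightarrow> a i = t" "mono a" using assms by (auto simp: staircases_def)
  show "b \<in> range a" using a(1) by (metis rangeI)
  show "t \<in> range a" using a(2)[of N] by (metis order_refl rangeI)
  show "range a \<subseteq> {b..t}"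
  proof clarify
    fix i
    have "a 0 \<le> a i" using a(3) by (rule monoD) simp
    moreover have "a i \<le> a (max i N)" using a(3) by (rule monoD) simp
    ultimately show "a i \<in> {b..t}" using a(1) a(2)[of "max i N"] by simp
  qed
  show "range a = a ` {..N}"
  proof
    show "range a \<subseteq> a ` {..N}"
    proof clarify
      fix i show "a i \<in> a ` {..N}"
        using a(2)[of i] a(2)[of N] by (cases "i \<le> N") (auto intro: image_eqI[of _ _ N])
    qed
  qed auto
qed

lemma finite_staircases: "finite (staircases \<S> N (0::nat) m)"
proof (rule finite_subset)
  show "staircases \<S> N 0 m \<subseteq> (\<lambda>f i. if i < N then f i else m) ` ({..<N} \<rightarrow>\<^sub>E {..m})"
  proof
    fix a assume a: "a \<in> staircases \<S> N 0 m"
    then have "a = (\<lambda>i. if i < N then restrict a {..<N} i else m)"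
      by (auto simp: staircases_def fun_eq_iff)
    moreover have "restrict a {..<N} \<in> {..<N} \<rightarrow>\<^sub>E {..m}"
      using staircases_range(1)[OF a] by (auto simp: image_subset_iff)
    ultimately show "a \<in> (\<lambda>f i. if i < N then f i else m) ` ({..<N} \<rightarrow>\<^sub>E {..m})" by blast
  qed
qed (intro finite_imageI finite_PiE; simp)

lemma finite_multisets_of_size: "finite A \<Longrightarrow> finite {M. size M = n \<and> set_mset M \<subseteq> A}"
proof (induction n)
  case (Suc n)
  have "{M. size M = Suc n \<and> set_mset M \<subseteq> A} \<subseteq> (\<lambda>(x, M). add_mset x M) ` (A \<times> {M. size M = n \<and> set_mset M \<subseteq> A})"
  proof clarify
    fix M assume "size M = Suc n" "set_mset M \<subseteq> A"
    then obtain x M' where "M = add_mset x M'" by (metis size_eq_Suc_imp_eq_union)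
    with \<open>size M = Suc n\<close> \<open>set_mset M \<subseteq> A\<close>
    show "M \<in> (\<lambda>(x, M). add_mset x M) ` (A \<times> {M. size M = n \<and> set_mset M \<subseteq> A})"
      by (intro image_eqI[of _ _ "(x, M')"]) auto
  qed
  then show ?case using Suc by (auto intro: finite_subset)
qed (auto intro: finite_subset[of _ "{{#}}"])

lemma finite_fat_multisets: "finite A \<Longrightarrow> finite (fat_multisets d A n)"
  by (rule finite_subset[OF _ finite_multisets_of_size[of A n]]) (auto simp: fat_multisets_def)

lemma value_set_image_mset: "value_set (image_mset (\<lambda>a. f \<circ> a) M) = f ` value_set M"
  by (auto simp: value_set_def)

text \<open>There are at most \<open>n\<close> distinct members with at most \<open>N + 1\<close>
  values each; this bounds the dimension of the cells.\<close>

lemma finite_value_set: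
  assumes "M \<in> fat_multisets d (staircases \<S> N b t) n"
  shows "finite (value_set M)" "card (value_set M) \<le> n * Suc N"
proof -
  have *: "finite (range a) \<and> card (range a) \<le> Suc N" if "a \<in># M" for a
  proof -
    have "range a = a ` {..N}" using assms that by (intro staircases_range(4)) (auto simp: fat_multisets_def)
    then show ?thesis using card_image_le[of "{..N}" a] by simp
  qed
  then show "finite (value_set M)" by (auto simp: value_set_def)
  have "card (value_set M) \<le> (\<Sum>a\<in>set_mset M. card (range a))"
    unfolding value_set_def by (intro card_UN_le) simp
  also have "\<dots> \<le> (\<Sum>a\<in>set_mset M. Suc N)" using * by (intro sum_mono) auto
  also have "\<dots> = card (set_mset M) * Suc N" by simp
  finally have "card (value_set M) \<le> card (set_mset M) * Suc N" .
  moreover have "card (set_mset M) \<le> n"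
    using assms size_multiset_overloaded_eq[of M] sum_mono[of "set_mset M" "\<lambda>_. 1" "count M"]
    by (auto simp: fat_multisets_def Suc_le_eq)
  ultimately show "card (value_set M) \<le> n * Suc N" by (meson le_trans mult_le_mono1)
qed

lemma value_set_staircases:
  assumes "M \<in> fat_multisets d (staircases \<S> N b t) n" "n \<ge> 1"
  shows "b \<in> value_set M" "t \<in> value_set M" "value_set M \<subseteq> {b..t}"
proof -
  have "M \<noteq> {#}" using assms by (auto simp: fat_multisets_def)
  then obtain a where a: "a \<in># M" by blast
  have st: "\<And>a. a \<in># M \<Longrightarrow> a \<in> staircases \<S> N b t" using assms by (auto simp: fat_multisets_def)
  show "b \<in> value_set M" "t \<in> value_set M"
    using staircases_range(2,3)[OF st[OF a]] a by (auto simp: value_set_def)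
  show "value_set M \<subseteq> {b..t}"
    using staircases_range(1)[OF st] unfolding value_set_def by blast
qed

subsection \<open>Characteristic maps\<close>

definition cumulative :: "(nat \<Rightarrow> real) \<Rightarrow> nat \<Rightarrow> real" where
  "cumulative x k = (\<Sum>j<k. x j)"

text \<open>Level \<open>k\<close> is placed at the height given by the sum of the first
  \<open>k\<close> coordinates of \<open>x\<close>: the type \<open>\<tau>\<close> stays fixed while
  the heights move.\<close>

definition cell_map :: "(nat \<Rightarrow> nat) multiset \<Rightarrow> (nat \<Rightarrow> real) \<Rightarrow> (nat \<Rightarrow> real) multiset" where
  "cell_map \<tau> x = image_mset (\<lambda>a. cumulative x \<circ> a) \<tau>"

lemma cumulative_0 [simp]: "cumulative x 0 = 0"
  by (simp add: cumulative_def)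

lemma cumulative_diff: "cumulative x (Suc k) - cumulative x k = x k"
  by (simp add: cumulative_def)

lemma cumulative_top: "x \<in> std_simplex m \<Longrightarrow> cumulative x (Suc m) = 1"
  by (simp add: cumulative_def Simplices.standard_simplex_def lessThan_Suc_atMost)

lemma cumulative_mono: "x \<in> std_simplex m \<Longrightarrow> k \<le> l \<Longrightarrow> cumulative x k \<le> cumulative x l"
  unfolding cumulative_def by (intro sum_mono2) (auto simp: Simplices.standard_simplex_def)

lemma cumulative_strict_mono:
  assumes "x \<in> open_simplex m" "k < l" "l \<le> Suc m"
  shows "cumulative x k < cumulative x l"
proof -
  have x: "x \<in> std_simplex m" using assms(1) open_simplex_subset by blast
  have "0 < x k" using assms by (auto simp: open_simplex_def)
  then have "cumulative x k < cumulative x (Suc k)" using cumulative_diff[of x k] by simp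
  also have "\<dots> \<le> cumulative x l" using assms(2) by (intro cumulative_mono[OF x]) simp
  finally show ?thesis .
qed

context
  fixes \<S> :: "nat set set" and N d n :: nat
  assumes down: "\<And>S T. S \<in> \<S> \<Longrightarrow> T \<subseteq> S \<Longrightarrow> T \<in> \<S>"
    and d: "1 \<le> d" and n: "1 \<le> n"
begin

abbreviation points :: "(nat \<Rightarrow> real) set" where
  "points \<equiv> staircases \<S> N 0 1"

abbreviation grids :: "nat \<Rightarrow> (nat \<Rightarrow> nat) set" where
  "grids m \<equiv> staircases \<S> N 0 (Suc m)"

text \<open>The nondegenerate \<open>m\<close>-simplices: no level is skipped. The
  \<open>m + 1\<close> barycentric coordinates have \<open>m + 2\<close> partial sums, hence levels
  up to \<open>Suc m\<close>.\<close>

definition cells :: "nat \<Rightarrow> (nat \<Rightarrow> nat) multiset set" where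
  "cells m = {\<tau> \<in> fat_multisets d (grids m) n. value_set \<tau> = {..Suc m}}"

lemma finite_cells: "finite (cells m)"
  unfolding cells_def using finite_fat_multisets[OF finite_staircases[of \<S> N "Suc m"], of d n] by simp

lemma cells_empty: "m \<ge> n * Suc N \<Longrightarrow> cells m = {}"
  using finite_value_set(2)[of _ d \<S> N 0 "Suc m" n] by (fastforce simp: cells_def)

lemma cumulative_compose_grid:
  assumes "x \<in> std_simplex m" "a \<in> grids m"
  shows "cumulative x \<circ> a \<in> points"
  by (rule staircases_compose[where W = UNIV, OF down assms(2)])
    (use assms(1) in \<open>auto intro: cumulative_mono cumulative_top\<close>)

lemma cell_map_fat:
  assumes "x \<in> std_simplex m" "\<tau> \<in> fat_multisets d (grids m) n"
  shows "cell_map \<tau> x \<in> fat_multisets d points n"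
  unfolding cell_map_def
  by (rule image_mset_fat_multisets[OF assms(2)]) (rule cumulative_compose_grid[OF assms(1)])

lemma value_set_cell_map: "\<tau> \<in> cells m \<Longrightarrow> value_set (cell_map \<tau> x) = cumulative x ` {..Suc m}"
  unfolding cell_map_def value_set_image_mset by (simp add: cells_def)

lemma continuous_map_cell_map:
  assumes "\<tau> \<in> fat_multisets d (grids m) n"
  shows "continuous_map (top_of_set (std_simplex m)) (Bd_space d (top_of_set points) n) (cell_map \<tau>)"
proof -
  obtain a where a: "a \<in> {..<n} \<rightarrow>\<^sub>E grids m" "sym_quot n a = \<tau>"
    using sym_quot_surj[of \<tau> n "grids m"] assms by (auto simp: fat_multisets_def)
  have comp: "continuous_map (top_of_set (std_simplex m)) (top_of_set points) (\<lambda>x. cumulative x \<circ> a i)" if "i \<in> {..<n}" for i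
  proof -
    have "continuous_on (std_simplex m) (\<lambda>x. cumulative x \<circ> a i)"
      unfolding cumulative_def o_def
      by (intro continuous_on_coordinatewise_then_product continuous_on_sum continuous_on_apply)
    moreover have "cumulative x \<circ> a i \<in> points" if "x \<in> std_simplex m" for x
      using a(1) \<open>i \<in> {..<n}\<close> by (intro cumulative_compose_grid[OF that]) auto
    ultimately show ?thesis by (auto simp: continuous_map_in_subtopology)
  qed
  have "continuous_map (top_of_set (std_simplex m)) (product_topology (\<lambda>i. top_of_set points) {..<n})
      (\<lambda>x. restrict (\<lambda>i. cumulative x \<circ> a i) {..<n})"
    unfolding continuous_map_componentwise
  proof (intro conjI ballI)
    fix i assume i: "i \<in> {..<n}"
    show "continuous_map (top_of_set (std_simplex m)) (top_of_set points) (\<lambda>x. restrict (\<lambda>i. cumulative x \<circ> a i) {..<n} i)"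
      using i by (intro continuous_map_eq[OF comp[OF i]]) simp
  qed auto
  moreover have "continuous_map (product_topology (\<lambda>i. top_of_set points) {..<n}) (symprod n (top_of_set points)) (sym_quot n)"
    unfolding symprod_def by (rule quotient_imp_continuous_map[OF quotient_map_quotient_topology])
  ultimately have "continuous_map (top_of_set (std_simplex m)) (symprod n (top_of_set points))
      (sym_quot n \<circ> (\<lambda>x. restrict (\<lambda>i. cumulative x \<circ> a i) {..<n}))"
    by (rule continuous_map_compose)
  moreover have "sym_quot n (restrict (\<lambda>i. cumulative x \<circ> a i) {..<n}) = cell_map \<tau> x" for x
    by (simp add: sym_quot_restrict cell_map_def image_mset_sym_quot flip: a(2))
  ultimately have "continuous_map (top_of_set (std_simplex m)) (symprod n (top_of_set points)) (cell_map \<tau>)"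
    by (simp add: o_def)
  moreover have "cell_map \<tau> \<in> std_simplex m \<rightarrow> fat_multisets d points n"
    using cell_map_fat[OF _ assms] by blast
  ultimately show ?thesis
    by (simp add: Bd_space_eq[OF d] continuous_map_in_subtopology)
qed

section \<open>The open cells are disjoint and cover the space\<close>

text \<open>Over the open simplex the heights increase strictly, so a level is the rank of its
  height. Type and coordinates can therefore be read off from the image alone.\<close>

lemma rank_in_cell_map:
  assumes "\<tau> \<in> cells m" "x \<in> open_simplex m" "k \<le> Suc m"
  shows "rank_in (value_set (cell_map \<tau> x)) (cumulative x k) = k"
  unfolding value_set_cell_map[OF assms(1)]
  by (rule rank_in_strict_mono_image[OF _ assms(3)]) (rule cumulative_strict_mono[OF assms(2)])

lemma card_value_set_cell_map:
  assumes "\<tau> \<in> cells m" "x \<in> open_simplex m"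
  shows "card (value_set (cell_map \<tau> x)) = m + 2"
proof -
  have "inj_on (cumulative x) {..Suc m}"
    using rank_in_cell_map[OF assms] by (metis atMost_iff inj_onI)
  then show ?thesis by (simp add: value_set_cell_map[OF assms(1)] card_image)
qed

lemma cell_map_rank:
  assumes "\<tau> \<in> cells m" "x \<in> open_simplex m"
  shows "image_mset (\<lambda>z. rank_in (value_set (cell_map \<tau> x)) \<circ> z) (cell_map \<tau> x) = \<tau>"
proof -
  let ?W = "value_set (cell_map \<tau> x)"
  have "image_mset (\<lambda>z. rank_in ?W \<circ> z) (cell_map \<tau> x) = image_mset (\<lambda>a. rank_in ?W \<circ> (cumulative x \<circ> a)) \<tau>"
    by (simp add: cell_map_def multiset.map_comp o_def)
  also have "\<dots> = image_mset id \<tau>"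
  proof (rule image_mset_cong)
    fix a assume "a \<in># \<tau>"
    then have "range a \<subseteq> {..Suc m}" using assms(1) by (auto simp: cells_def value_set_def)
    then show "rank_in ?W \<circ> (cumulative x \<circ> a) = id a"
      using rank_in_cell_map[OF assms] by (simp add: fun_eq_iff image_subset_iff)
  qed
  finally show ?thesis by simp
qed

text \<open>The number of heights gives the dimension, replacing heights by ranks gives the type,
  and the heights themselves are the partial sums of \<open>x\<close>.\<close>

lemma cell_map_unique:
  assumes "\<tau> \<in> cells m" "x \<in> open_simplex m" "\<tau>' \<in> cells m'" "x' \<in> open_simplex m'"
    and eq: "cell_map \<tau> x = cell_map \<tau>' x'"
  shows "m = m' \<and> \<tau> = \<tau>' \<and> x = x'"
proof -
  let ?W = "value_set (cell_map \<tau> x)"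
  have m: "m = m'" using card_value_set_cell_map[OF assms(1,2)] card_value_set_cell_map[OF assms(3,4)] eq by simp
  have "\<tau> = \<tau>'" using cell_map_rank[OF assms(1,2)] cell_map_rank[OF assms(3,4)] eq by simp
  have fin: "finite ?W" by (simp add: value_set_cell_map[OF assms(1)])
  have c: "cumulative x k = cumulative x' k" if "k \<le> Suc m" for k
  proof (rule inj_onD[OF rank_in_inj[OF fin]])
    show "rank_in ?W (cumulative x k) = rank_in ?W (cumulative x' k)"
      using rank_in_cell_map[OF assms(1,2) that] rank_in_cell_map[OF assms(3,4), of k] eq that m by simp
    show "cumulative x k \<in> ?W" using that by (simp add: value_set_cell_map[OF assms(1)])
    show "cumulative x' k \<in> ?W" unfolding eq using that m by (simp add: value_set_cell_map[OF assms(3)])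
  qed
  have "x k = x' k" for k
  proof (cases "k \<le> m")
    case True
    then show ?thesis using c[of k] c[of "Suc k"] cumulative_diff[of x k] cumulative_diff[of x' k] by simp
  next
    case False
    then show ?thesis using assms(2,4) m by (simp add: open_simplex_def Simplices.standard_simplex_def)
  qed
  with m \<open>\<tau> = \<tau>'\<close> show ?thesis by auto
qed

text \<open>The heights of \<open>M\<close>, sorted, form a chain from 0 to 1. Its increments are
  the barycentric coordinates, and the ranks of the heights give the type.\<close>

lemma cell_map_cover:
  assumes M: "M \<in> fat_multisets d points n"
  shows "\<exists>m. \<exists>\<tau>\<in>cells m. \<exists>x\<in>open_simplex m. cell_map \<tau> x = M"
proof -
  define W where "W = value_set M"
  have fin: "finite W" unfolding W_def by (rule finite_value_set[OF M])
  have W: "0 \<in> W" "1 \<in> W" "W \<subseteq> {0..1}" unfolding W_def by (rule value_set_staircases[OF M n])+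
  have "card {0, 1::real} \<le> card W" using W fin by (intro card_mono) auto
  then obtain m where m: "card W = m + 2" by (metis card_2_iff le_add_diff_inverse2 zero_neq_one)
  have "{u \<in> W. u < 0} = {}" using W(3) by force
  then have r0: "rank_in W 0 = 0" unfolding rank_in_def by (simp only: card.empty)
  have "{u \<in> W. u < 1} = W - {1}" using W(3) by auto
  then have r1: "rank_in W 1 = Suc m" using m fin W(2) by (simp add: rank_in_def)
  let ?c = "unrank W"
  have c0: "?c 0 = 0" using unrank_rank[OF fin W(1)] by (simp add: r0)
  have c1: "?c (Suc m) = 1" using unrank_rank[OF fin W(2)] by (simp add: r1)
  define x where "x = (\<lambda>j. if j \<le> m then ?c (Suc j) - ?c j else 0)"
  have cum: "cumulative x k = ?c k" if "k \<le> Suc m" for k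
    using that by (induction k) (auto simp: cumulative_def x_def c0)
  have pos: "0 < x j" if "j \<le> m" for j
    using that m unrank_strict_mono[OF fin, of j "Suc j"] by (simp add: x_def)
  have sum: "(\<Sum>j\<le>m. x j) = 1"
    using cum[of "Suc m"] c1 by (simp add: cumulative_def lessThan_Suc_atMost)
  have "x j \<le> 1" for j
  proof (cases "j \<le> m")
    case True
    then show ?thesis using member_le_sum[of j "{..m}" x] pos sum by (simp add: less_imp_le)
  qed (simp add: x_def)
  moreover have "0 \<le> x j" for j using pos[of j] by (cases "j \<le> m") (auto simp: x_def)
  ultimately have x: "x \<in> open_simplex m"
    using pos sum by (auto simp: open_simplex_def Simplices.standard_simplex_def x_def)
  define \<tau> where "\<tau> = image_mset (\<lambda>z. rank_in W \<circ> z) M"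
  have "\<tau> \<in> fat_multisets d (grids m) n"
    unfolding \<tau>_def
  proof (rule image_mset_fat_multisets[OF M])
    fix z assume z: "z \<in> points"
    show "rank_in W \<circ> z \<in> grids m"
      by (rule staircases_compose[where W = UNIV, OF down z]) (simp_all add: r0 r1 rank_in_mono fin)
  qed
  moreover have "value_set \<tau> = {..Suc m}"
    unfolding \<tau>_def value_set_image_mset W_def[symmetric] rank_in_image[OF fin] m by auto
  ultimately have \<tau>: "\<tau> \<in> cells m" by (simp add: cells_def)
  have "cell_map \<tau> x = image_mset (\<lambda>z. cumulative x \<circ> (rank_in W \<circ> z)) M"
    by (simp add: cell_map_def \<tau>_def multiset.map_comp o_def)
  also have "\<dots> = image_mset id M"
  proof (rule image_mset_cong)
    fix z assume "z \<in># M"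
    then have zW: "\<And>i. z i \<in> W" by (auto simp: W_def value_set_def)
    have "cumulative x (rank_in W (z i)) = z i" for i
      using rank_in_less_card[OF fin zW[of i]] m by (simp add: cum unrank_rank[OF fin zW])
    then show "cumulative x \<circ> (rank_in W \<circ> z) = id z" by (simp add: fun_eq_iff)
  qed
  finally have "cell_map \<tau> x = M" by simp
  with x \<tau> show ?thesis by blast
qed

theorem euler_char_Bd_points:
  "finite_homology (Bd_space d (top_of_set points) n) \<and>
   euler_char (Bd_space d (top_of_set points) n) = (\<Sum>m<n * Suc N. (-1) ^ m * int (card (cells m)))"
proof -
  let ?Y = "Bd_space d (top_of_set points) n"
  let ?E = "SIGMA m:{..<n * Suc N}. cells m"
  have top: "topspace ?Y = fat_multisets d points n" by (simp add: topspace_Bd_space[OF d])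
  have cover: "\<exists>c\<in>?E. M \<in> cell_map (snd c) ` open_simplex (fst c)" if M: "M \<in> fat_multisets d points n" for M
  proof -
    obtain m \<tau> x where *: "\<tau> \<in> cells m" "x \<in> open_simplex m" "cell_map \<tau> x = M"
      using cell_map_cover[OF M] by blast
    then have "m < n * Suc N" using cells_empty[of m] by fastforce
    with * show ?thesis by (intro bexI[of _ "(m, \<tau>)"]) auto
  qed
  have "finite_homology ?Y \<and> euler_char ?Y = (\<Sum>c\<in>?E. (-1) ^ fst c)"
  proof (rule finite_homology_cells[where \<Phi> = "\<lambda>c. cell_map (snd c)"])
    show "finite ?E" using finite_cells by blast
    show "Hausdorff_space ?Y"
      unfolding Bd_space_eq[OF d] by (intro Hausdorff_space_subtopology Hausdorff_symprod)
    show "continuous_map (top_of_set (std_simplex (fst c))) ?Y (cell_map (snd c))" if "c \<in> ?E" for c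
      using that by (intro continuous_map_cell_map) (auto simp: cells_def)
    show "inj_on (cell_map (snd c)) (open_simplex (fst c))" if "c \<in> ?E" for c
    proof (rule inj_onI)
      fix x y assume "x \<in> open_simplex (fst c)" "y \<in> open_simplex (fst c)" "cell_map (snd c) x = cell_map (snd c) y"
      then show "x = y" using cell_map_unique[of "snd c" "fst c" x "snd c" "fst c" y] that by auto
    qed
    show "cell_map (snd c) ` open_simplex (fst c) \<inter> cell_map (snd c') ` open_simplex (fst c') = {}"
      if "c \<in> ?E" "c' \<in> ?E" "c \<noteq> c'" for c c'
    proof (rule ccontr)
      assume "\<not> ?thesis"
      then obtain x x' where "x \<in> open_simplex (fst c)" "x' \<in> open_simplex (fst c')"
        "cell_map (snd c) x = cell_map (snd c') x'" by blast
      then have "fst c = fst c' \<and> snd c = snd c'"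
        using cell_map_unique[of "snd c" "fst c" x "snd c'" "fst c'" x'] that by auto
      then show False using that by (simp add: prod_eq_iff)
    qed
    show "\<exists>c'\<in>?E. fst c' < fst c \<and> cell_map (snd c) x \<in> cell_map (snd c') ` open_simplex (fst c')"
      if c: "c \<in> ?E" and x: "x \<in> std_simplex (fst c) - open_simplex (fst c)" for c x
    proof -
      have \<tau>: "snd c \<in> cells (fst c)" using c by auto
      have "cell_map (snd c) x \<in> fat_multisets d points n"
        using x \<tau> by (intro cell_map_fat[of x "fst c"]) (auto simp: cells_def)
      then obtain c' where c': "c' \<in> ?E" "cell_map (snd c) x \<in> cell_map (snd c') ` open_simplex (fst c')"
        using cover by blast
      then obtain x' where x': "x' \<in> open_simplex (fst c')" "cell_map (snd c) x = cell_map (snd c') x'" by blast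
      have "\<tau>' \<in> cells (fst c') \<Longrightarrow> \<tau>' = snd c' \<Longrightarrow> card (cumulative x ` {..Suc (fst c)}) = fst c' + 2" for \<tau>'
        using card_value_set_cell_map[OF _ x'(1), of "snd c'"] by (simp add: value_set_cell_map[OF \<tau>] flip: x'(2))
      then have card: "card (cumulative x ` {..Suc (fst c)}) = fst c' + 2" using c'(1) by auto
      \<comment> \<open>A boundary point has a vanishing coordinate, hence two coinciding partial
        sums and fewer heights; the cell containing its image has smaller dimension.\<close>
      obtain j where j: "j \<le> fst c" "x j = 0"
        using x by (auto simp: open_simplex_def Simplices.standard_simplex_def) (metis less_eq_real_def)
      have "\<not> inj_on (cumulative x) {..Suc (fst c)}"
      proof
        assume "inj_on (cumulative x) {..Suc (fst c)}"
        moreover have "cumulative x j = cumulative x (Suc j)" using cumulative_diff[of x j] j by simp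
        ultimately show False using j inj_onD[of "cumulative x" "{..Suc (fst c)}" j "Suc j"] by simp
      qed
      then have "card (cumulative x ` {..Suc (fst c)}) \<noteq> card {..Suc (fst c)}"
        using eq_card_imp_inj_on by blast
      moreover have "card (cumulative x ` {..Suc (fst c)}) \<le> card {..Suc (fst c)}" by (rule card_image_le) simp
      ultimately have "fst c' < fst c" using card by simp
      with c' show ?thesis by blast
    qed
    show "topspace ?Y = (\<Union>c\<in>?E. cell_map (snd c) ` open_simplex (fst c))"
    proof
      show "topspace ?Y \<subseteq> (\<Union>c\<in>?E. cell_map (snd c) ` open_simplex (fst c))"
        using cover unfolding top by blast
      show "(\<Union>c\<in>?E. cell_map (snd c) ` open_simplex (fst c)) \<subseteq> topspace ?Y"
      proof clarify
        fix m \<tau> x assume "\<tau> \<in> cells m" "x \<in> open_simplex (fst (m, \<tau>))"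
        then show "cell_map (snd (m, \<tau>)) x \<in> topspace ?Y"
          using open_simplex_subset[of m] unfolding top by (intro cell_map_fat[of x m]) (auto simp: cells_def)
      qed
    qed
  qed
  also have "(\<Sum>c\<in>?E. (-1) ^ fst c) = (\<Sum>m<n * Suc N. \<Sum>\<tau>\<in>cells m. (-1::int) ^ m)"
    using finite_cells by (subst sum.Sigma) (auto simp: case_prod_unfold)
  also have "\<dots> = (\<Sum>m<n * Suc N. (-1) ^ m * int (card (cells m)))"
    by (intro sum.cong) auto
  finally show ?thesis .
qed

end

section \<open>Polyhedra as spaces of staircases\<close>

lemma support_weights_affine_independent:
  fixes e :: "nat \<Rightarrow> 'b::euclidean_space"
  assumes "finite I" "inj_on e I" "\<not> affine_dependent (e ` I)"
    and "(\<Sum>i\<in>I. w i) = (\<Sum>i\<in>I. w' i)" "(\<Sum>i\<in>I. w i *\<^sub>R e i) = (\<Sum>i\<in>I. w' i *\<^sub>R e i)"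
  shows "\<forall>i\<in>I. w i = (w' i :: real)"
proof (rule ccontr)
  assume "\<not> ?thesis"
  then obtain k where k: "k \<in> I" "w k \<noteq> w' k" by blast
  define U where "U = (\<lambda>v. w (inv_into I e v) - w' (inv_into I e v))"
  have inv: "inv_into I e (e i) = i" if "i \<in> I" for i using assms(2) that by simp
  have "sum U (e ` I) = (\<Sum>i\<in>I. w i - w' i)"
    using assms(2) by (simp add: sum.reindex U_def inv)
  also have "\<dots> = 0" using assms(4) by (simp add: sum_subtractf)
  finally have 1: "sum U (e ` I) = 0" .
  have "(\<Sum>v\<in>e ` I. U v *\<^sub>R v) = (\<Sum>i\<in>I. (w i - w' i) *\<^sub>R e i)"
    using assms(2) by (simp add: sum.reindex U_def inv)
  also have "\<dots> = 0" using assms(5) by (simp add: scaleR_left_diff_distrib sum_subtractf)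
  finally have 2: "(\<Sum>v\<in>e ` I. U v *\<^sub>R v) = 0" .
  have "U (e k) \<noteq> 0" using k by (simp add: U_def inv)
  then have "affine_dependent (e ` I)"
    using affine_dependent_explicit_finite[of "e ` I"] assms(1) k(1) 1 2 by blast
  with assms(3) show False by simp
qed

text \<open>The intersection with \<open>T\<close> is a face, and a face meeting the relative
  interior is the whole simplex.\<close>

lemma simplex_subset_if_rel_interior_meets:
  assumes "simplicial_complex \<K>" "convex hull C \<in> \<K>" "T \<in> \<K>" "x \<in> rel_interior (convex hull C)" "x \<in> T"
  shows "convex hull C \<subseteq> T"
proof -
  have face: "convex hull C \<inter> T face_of convex hull C"
    using assms(1-3) by (simp add: simplicial_complex_def)
  have "x \<in> (convex hull C \<inter> T) \<inter> rel_interior (convex hull C)"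
    using assms(4,5) rel_interior_subset by blast
  then have "(convex hull C \<inter> T) \<inter> rel_interior (convex hull C) \<noteq> {}" by (metis empty_iff)
  from subset_of_face_of[OF face subset_refl this] show ?thesis by simp
qed

lemma affine_independent_hull_eq:
  fixes C D :: "'b::euclidean_space set"
  assumes "\<not> affine_dependent C" "\<not> affine_dependent D" "convex hull C = convex hull D"
  shows "C = D"
  using extreme_point_of_convex_hull_affine_independent[OF assms(1)]
    extreme_point_of_convex_hull_affine_independent[OF assms(2)] assms(3) by auto

lemma simplicial_complex_vertices:
  assumes K: "simplicial_complex \<K>" and S: "S \<in> \<K>"
  obtains C where "finite C" "\<not> affine_dependent C" "S = convex hull C" "\<And>c. c \<in> C \<Longrightarrow> {c} \<in> \<K>"
proof -
  obtain C where C: "finite C" "\<not> affine_dependent C" "S = convex hull C"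
    using K S by (auto simp: simplicial_complex_def simplex)
  have "{c} \<in> \<K>" if "c \<in> C" for c
  proof -
    have "{c} face_of S"
      using C that by (simp add: face_of_singleton extreme_point_of_convex_hull_affine_independent)
    then show ?thesis using K S by (auto simp: simplicial_complex_def)
  qed
  with C that show ?thesis by blast
qed

text \<open>Barycentric coordinates for vertices numbered below \<open>N\<close>. The simplex has
  one more coordinate, of index \<open>N\<close>, which vanishes when the members of
  \<open>\<S>\<close> lie below \<open>N\<close>.\<close>

definition realization :: "nat set set \<Rightarrow> nat \<Rightarrow> (nat \<Rightarrow> real) set" where
  "realization \<S> N = {w \<in> std_simplex N. {i. w i \<noteq> 0} \<in> \<S>}"

lemma compact_realization:
  assumes "\<And>I. I \<in> \<S> \<Longrightarrow> I \<subseteq> {..<N}" and down: "\<And>S T. S \<in> \<S> \<Longrightarrow> T \<subseteq> S \<Longrightarrow> T \<in> \<S>"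
  shows "compact (realization \<S> N)"
proof -
  have "finite \<S>" using assms(1) by (intro finite_subset[of \<S> "Pow {..<N}"]) auto
  have "closed {w :: nat \<Rightarrow> real. i \<notin> I \<longrightarrow> w i = 0}" for i I
    by (cases "i \<in> I") (auto intro!: closed_Collect_eq continuous_on_apply)
  then have "closed {w :: nat \<Rightarrow> real. \<forall>i. i \<notin> I \<longrightarrow> w i = 0}" for I
    by (rule closed_Collect_all)
  then have "compact (std_simplex N \<inter> {w. \<forall>i. i \<notin> I \<longrightarrow> w i = 0})" for I
    by (intro compact_Int_closed compact_std_simplex)
  then have "compact (\<Union>I\<in>\<S>. std_simplex N \<inter> {w. \<forall>i. i \<notin> I \<longrightarrow> w i = 0})"
    using \<open>finite \<S>\<close> by (intro compact_UN) auto
  moreover have "(\<Union>I\<in>\<S>. std_simplex N \<inter> {w. \<forall>i. i \<notin> I \<longrightarrow> w i = 0}) = realization \<S> N"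
  proof
    show "(\<Union>I\<in>\<S>. std_simplex N \<inter> {w. \<forall>i. i \<notin> I \<longrightarrow> w i = 0}) \<subseteq> realization \<S> N"
    proof clarify
      fix I w assume "I \<in> \<S>" "w \<in> std_simplex N" "\<forall>i. i \<notin> I \<longrightarrow> w i = 0"
      moreover from this have "{i. w i \<noteq> 0} \<subseteq> I" by blast
      ultimately show "w \<in> realization \<S> N" using down[of I "{i. w i \<noteq> 0}"] by (simp add: realization_def)
    qed
  qed (auto simp: realization_def)
  ultimately show ?thesis by simp
qed

text \<open>Taking partial sums is a continuous injection on a compact space; coordinate
  \<open>i\<close> becomes the jump between \<open>i\<close> and \<open>i + 1\<close>, so supports
  become jump sets.\<close>

lemma realization_homeomorphic_staircases:
  assumes "\<And>I. I \<in> \<S> \<Longrightarrow> I \<subseteq> {..<N}" and down: "\<And>S T. S \<in> \<S> \<Longrightarrow> T \<subseteq> S \<Longrightarrow> T \<in> \<S>"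
  shows "realization \<S> N homeomorphic staircases \<S> N (0::real) 1"
proof (rule homeomorphic_compact[of _ cumulative])
  show "compact (realization \<S> N)" by (rule compact_realization) (use assms in auto)
  show "continuous_on (realization \<S> N) cumulative"
    unfolding cumulative_def
    by (intro continuous_on_coordinatewise_then_product continuous_on_sum continuous_on_apply)
  show "inj_on cumulative (realization \<S> N)"
  proof (rule inj_onI)
    fix w w' assume "cumulative w = cumulative w'"
    then show "w = w'" using cumulative_diff[of w] cumulative_diff[of w'] by (auto simp: fun_eq_iff)
  qed
  show "cumulative ` realization \<S> N = staircases \<S> N 0 1"
  proof
    show "cumulative ` realization \<S> N \<subseteq> staircases \<S> N 0 1"
    proof clarify
      fix w assume "w \<in> realization \<S> N"
      then have w: "w \<in> std_simplex N" "{i. w i \<noteq> 0} \<in> \<S>" by (auto simp: realization_def)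
      have z: "w i = 0" if "i \<ge> N" for i using assms(1)[OF w(2)] that by force
      \<comment> \<open>In the simplex 1 is only guaranteed at \<open>Suc N\<close>; as coordinate
        \<open>N\<close> vanishes, it is already reached at \<open>N\<close>, as staircases
        require.\<close>
      have "cumulative w i = 1" if "i \<ge> N" for i
      proof -
        have "cumulative w (Suc N) = 1" by (rule cumulative_top[OF w(1)])
        then have "cumulative w N = 1" using z[of N] cumulative_diff[of w N] by simp
        with that show ?thesis
        proof (induction i rule: dec_induct)
          case (step k)
          then show ?case using z[of k] cumulative_diff[of w k] by simp
        qed
      qed
      moreover have "{i. cumulative w i \<noteq> cumulative w (Suc i)} = {i. w i \<noteq> 0}"
        using cumulative_diff[of w] by (metis cancel_comm_monoid_add_class.diff_cancel eq_iff_diff_eq_0)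
      ultimately show "cumulative w \<in> staircases \<S> N 0 1"
        using w cumulative_mono[OF w(1)] by (auto simp: staircases_def mono_def)
    qed
    show "staircases \<S> N 0 1 \<subseteq> cumulative ` realization \<S> N"
    proof
      fix s :: "nat \<Rightarrow> real" assume s: "s \<in> staircases \<S> N 0 1"
      define w where "w = (\<lambda>i. s (Suc i) - s i)"
      have cum: "cumulative w = s"
      proof
        fix k show "cumulative w k = s k"
          using s by (induction k) (auto simp: cumulative_def w_def staircases_def)
      qed
      have pos: "0 \<le> w i" for i using s by (auto simp: w_def staircases_def mono_def)
      have "w i \<le> 1" for i
      proof -
        have "s i \<in> {0..1}" "s (Suc i) \<in> {0..1}" using staircases_range(1)[OF s] by blast+
        then show ?thesis by (simp add: w_def)
      qed
      moreover have "w i = 0" if "i > N" for i using s that by (auto simp: w_def staircases_def)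
      moreover have "(\<Sum>i\<le>N. w i) = 1"
        using fun_cong[OF cum, of "Suc N"] s by (simp add: cumulative_def lessThan_Suc_atMost staircases_def)
      moreover have "{i. w i \<noteq> 0} = {i. s i \<noteq> s (Suc i)}" by (auto simp: w_def)
      ultimately have "w \<in> realization \<S> N"
        using s pos by (auto simp: realization_def Simplices.standard_simplex_def staircases_def)
      with cum show "s \<in> cumulative ` realization \<S> N" by blast
    qed
  qed
qed

text \<open>Numbering the vertices orders all simplices compatibly. A point is matched with its
  barycentric coordinates in its carrier, the simplex having it in the relative interior.\<close>

theorem simplicial_complex_homeomorphic_staircases:
  fixes \<K> :: "'b::euclidean_space set set"
  assumes K: "simplicial_complex \<K>"
  obtains \<S> N where "\<And>S T. S \<in> \<S> \<Longrightarrow> T \<subseteq> S \<Longrightarrow> T \<in> \<S>"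
    "\<Union>\<K> homeomorphic staircases \<S> N (0::real) 1"
proof -
  define V where "V = {v. {v} \<in> \<K>}"
  have "inj_on (\<lambda>v. {v}) V" "(\<lambda>v. {v}) ` V \<subseteq> \<K>" "finite \<K>"
    using K by (auto simp: V_def simplicial_complex_def)
  then have "finite V" by (meson finite_imageD finite_subset)
  then obtain e where e: "bij_betw e {..<card V} V"
    using ex_bij_betw_nat_finite[of V] by (auto simp: atLeast0LessThan)
  define N where "N = card V"
  have einj: "inj_on e {..<N}" and eim: "e ` {..<N} = V" using e by (auto simp: bij_betw_def N_def)
  define \<S> where "\<S> = {I. I \<subseteq> {..<N} \<and> \<not> affine_dependent (e ` I) \<and> (I = {} \<or> convex hull (e ` I) \<in> \<K>)}"
  have S_sub: "\<And>I. I \<in> \<S> \<Longrightarrow> I \<subseteq> {..<N}" by (simp add: \<S>_def)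
  have down: "T \<in> \<S>" if "S \<in> \<S>" "T \<subseteq> S" for S T
  proof -
    have S: "S \<subseteq> {..<N}" "\<not> affine_dependent (e ` S)" using that by (auto simp: \<S>_def)
    have sub: "e ` T \<subseteq> e ` S" using that by blast
    have "convex hull (e ` T) \<in> \<K>" if "T \<noteq> {}"
    proof -
      have "convex hull (e ` S) \<in> \<K>" using \<open>S \<in> \<S>\<close> \<open>T \<subseteq> S\<close> that by (auto simp: \<S>_def)
      moreover have "convex hull (e ` T) face_of convex hull (e ` S)"
        using face_of_convex_hull_affine_independent[OF S(2)] sub by blast
      ultimately show ?thesis using K by (auto simp: simplicial_complex_def)
    qed
    then show ?thesis using S affine_independent_subset[OF S(2) sub] that by (auto simp: \<S>_def)
  qed
  define F where "F = (\<lambda>w. \<Sum>i<N. (w i :: real) *\<^sub>R e i)"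
  have supp: "I = {i. w i \<noteq> 0} \<Longrightarrow> I \<in> \<S> \<and> I \<noteq> {} \<and> finite I \<and> (\<Sum>i\<in>I. w i) = 1 \<and> F w = (\<Sum>i\<in>I. w i *\<^sub>R e i)
       \<and> (\<forall>i\<in>I. 0 < w i) \<and> convex hull (e ` I) \<in> \<K> \<and> F w \<in> rel_interior (convex hull (e ` I))"
    if w: "w \<in> realization \<S> N" for w I
  proof -
    assume I: "I = {i. w i \<noteq> 0}"
    have IS: "I \<in> \<S>" and pos: "\<And>i. 0 \<le> w i" and s1: "(\<Sum>i\<le>N. w i) = 1"
      using w by (auto simp: realization_def I Simplices.standard_simplex_def)
    have IN: "I \<subseteq> {..<N}" and ind: "\<not> affine_dependent (e ` I)" using IS by (auto simp: \<S>_def)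
    then have fin: "finite I" by (auto intro: finite_subset)
    have z: "w i = 0" if "i \<notin> I" for i using that by (simp add: I)
    have "I \<subseteq> {..N}" using IN by (meson atMost_iff lessThan_iff less_imp_le subset_iff)
    then have "(\<Sum>i\<le>N. w i) = (\<Sum>i\<in>I. w i)"
      by (intro sum.mono_neutral_right) (simp_all add: z)
    with s1 have sum: "(\<Sum>i\<in>I. w i) = 1" by simp
    have ne: "I \<noteq> {}" using sum by (metis sum.empty zero_neq_one)
    have F: "F w = (\<Sum>i\<in>I. w i *\<^sub>R e i)"
      unfolding F_def using IN by (intro sum.mono_neutral_right) (simp_all add: z)
    have pos': "\<forall>i\<in>I. 0 < w i" using pos by (simp add: I less_le)
    have inj: "inj_on e I" using einj IN by (rule inj_on_subset)
    have "F w \<in> rel_interior (convex hull (e ` I))"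
      unfolding rel_interior_convex_hull_explicit[OF ind] mem_Collect_eq
    proof (intro exI conjI)
      let ?u = "\<lambda>v. w (inv_into I e v)"
      have inv: "inv_into I e (e i) = i" if "i \<in> I" for i using inj that by simp
      show "\<forall>x\<in>e ` I. 0 < ?u x" using pos' inv by simp
      show "sum ?u (e ` I) = 1" using sum by (simp add: sum.reindex[OF inj] inv)
      show "(\<Sum>x\<in>e ` I. ?u x *\<^sub>R x) = F w" by (simp add: sum.reindex[OF inj] inv F)
    qed
    moreover have "convex hull (e ` I) \<in> \<K>" using IS ne by (simp add: \<S>_def)
    ultimately show "I \<in> \<S> \<and> I \<noteq> {} \<and> finite I \<and> (\<Sum>i\<in>I. w i) = 1 \<and> F w = (\<Sum>i\<in>I. w i *\<^sub>R e i)
       \<and> (\<forall>i\<in>I. 0 < w i) \<and> convex hull (e ` I) \<in> \<K> \<and> F w \<in> rel_interior (convex hull (e ` I))"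
      using IS ne fin sum F pos' by simp
  qed
  have "realization \<S> N homeomorphic \<Union>\<K>"
  proof (rule homeomorphic_compact[of _ F])
    show "compact (realization \<S> N)" by (rule compact_realization) (use S_sub down in auto)
    show "continuous_on (realization \<S> N) F"
      unfolding F_def by (intro continuous_on_sum continuous_on_scaleR continuous_on_apply continuous_on_const)
    show "inj_on F (realization \<S> N)"
    proof (rule inj_onI)
      fix w w' assume w: "w \<in> realization \<S> N" and w': "w' \<in> realization \<S> N" and eq: "F w = F w'"
      define I where "I = {i. w i \<noteq> 0}"
      define I' where "I' = {i. w' i \<noteq> 0}"
      note p = supp[OF w I_def] and p' = supp[OF w' I'_def]
      have ind: "\<not> affine_dependent (e ` I)" "\<not> affine_dependent (e ` I')" "I \<subseteq> {..<N}" "I' \<subseteq> {..<N}"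
        using p p' by (auto simp: \<S>_def)
      \<comment> \<open>The common image lies in the relative interior of both carriers, so each
        contains the other; equal vertex sets then allow uniqueness of weights to be used.\<close>
      have "convex hull (e ` I) \<subseteq> convex hull (e ` I')"
        using p p' eq rel_interior_subset[of "convex hull (e ` I')"]
        by (intro simplex_subset_if_rel_interior_meets[OF K, of _ _ "F w"]) auto
      moreover have "convex hull (e ` I') \<subseteq> convex hull (e ` I)"
        using p p' eq rel_interior_subset[of "convex hull (e ` I)"]
        by (intro simplex_subset_if_rel_interior_meets[OF K, of _ _ "F w'"]) auto
      ultimately have "e ` I = e ` I'" by (intro affine_independent_hull_eq[OF ind(1,2)] subset_antisym)
      then have II: "I = I'" using inj_on_image_eq_iff[OF einj ind(3,4)] by blast
      have "\<forall>i\<in>I. w i = w' i"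
      proof (rule support_weights_affine_independent[of I e])
        show "inj_on e I" using einj ind(3) by (rule inj_on_subset)
        show "finite I" "\<not> affine_dependent (e ` I)" using p ind(1) by simp_all
        show "(\<Sum>i\<in>I. w i) = (\<Sum>i\<in>I. w' i)" using p p' II by simp
        show "(\<Sum>i\<in>I. w i *\<^sub>R e i) = (\<Sum>i\<in>I. w' i *\<^sub>R e i)" using p p' II eq by simp
      qed
      moreover have "w i = 0 \<and> w' i = 0" if "i \<notin> I" for i
        using that II by (auto simp: I_def I'_def)
      ultimately show "w = w'" by (metis ext)
    qed
    show "F ` realization \<S> N = \<Union>\<K>"
    proof
      show "F ` realization \<S> N \<subseteq> \<Union>\<K>"
      proof clarify
        fix w assume "w \<in> realization \<S> N"
        from supp[OF this refl] show "F w \<in> \<Union>\<K>" using rel_interior_subset by blast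
      qed
      show "\<Union>\<K> \<subseteq> F ` realization \<S> N"
      proof clarify
        fix x S assume x: "x \<in> S" and S: "S \<in> \<K>"
        obtain C where C: "finite C" "\<not> affine_dependent C" "S = convex hull C" "\<And>c. c \<in> C \<Longrightarrow> {c} \<in> \<K>"
          using simplicial_complex_vertices[OF K S] by metis
        define I where "I = {i. i < N \<and> e i \<in> C}"
        have "C \<subseteq> V" using C(4) by (auto simp: V_def)
        then have eI: "e ` I = C" using eim by (auto simp: I_def)
        have inj: "inj_on e I" by (rule inj_on_subset[OF einj]) (auto simp: I_def)
        have IS: "I \<in> \<S>" using C S eI by (auto simp: \<S>_def I_def)
        obtain u where u: "\<forall>x\<in>C. 0 \<le> u x" "sum u C = 1" "(\<Sum>v\<in>C. u v *\<^sub>R v) = x"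
          using x C(1,3) by (auto simp: convex_hull_finite)
        define w where "w = (\<lambda>i. if i \<in> I then u (e i) else 0)"
        have fin: "finite I" by (simp add: I_def)
        have pos: "0 \<le> w i" for i using u(1) by (auto simp: w_def I_def)
        have "(\<Sum>i\<in>I. w i) = sum u C"
          unfolding eI[symmetric] sum.reindex[OF inj] by (intro sum.cong) (auto simp: w_def)
        moreover have "(\<Sum>i\<le>N. w i) = (\<Sum>i\<in>I. w i)"
          by (intro sum.mono_neutral_right) (auto simp: w_def I_def)
        ultimately have sum: "(\<Sum>i\<le>N. w i) = 1" using u(2) by simp
        have "w i \<le> 1" for i
        proof (cases "i \<le> N")
          case True
          then show ?thesis using member_le_sum[of i "{..N}" w] pos sum by simp
        qed (simp add: w_def I_def)
        moreover have "{i. w i \<noteq> 0} \<in> \<S>" by (rule down[OF IS]) (auto simp: w_def)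
        moreover have "w i = 0" if "i > N" for i using that by (simp add: w_def I_def)
        ultimately have "w \<in> realization \<S> N"
          using pos sum by (simp add: realization_def Simplices.standard_simplex_def)
        moreover have "F w = x"
        proof -
          have "F w = (\<Sum>i\<in>I. w i *\<^sub>R e i)"
            unfolding F_def by (intro sum.mono_neutral_right) (auto simp: w_def I_def)
          also have "\<dots> = (\<Sum>v\<in>C. u v *\<^sub>R v)"
            unfolding eI[symmetric] sum.reindex[OF inj] by (intro sum.cong) (auto simp: w_def)
          finally show ?thesis using u(3) by simp
        qed
        ultimately show "x \<in> F ` realization \<S> N" by blast
      qed
    qed
  qed
  then have "\<Union>\<K> homeomorphic realization \<S> N" using homeomorphic_sym by blast
  also have "\<dots> homeomorphic staircases \<S> N (0::real) 1"
    by (rule realization_homeomorphic_staircases) (use S_sub down in auto)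
  finally show ?thesis using that down by blast
qed

section \<open>Counting\<close>

subsection \<open>Multisets with a repeated element\<close>

definition slim_multisets :: "nat \<Rightarrow> 'a set \<Rightarrow> nat \<Rightarrow> 'a multiset set" where
  "slim_multisets D A n = {M. size M = n \<and> set_mset M \<subseteq> A \<and> (\<forall>z. count M z \<le> D)}"

lemma finite_slim_multisets: "finite A \<Longrightarrow> finite (slim_multisets D A n)"
  by (rule finite_subset[OF _ finite_multisets_of_size[of A n]]) (auto simp: slim_multisets_def)

text \<open>Pascal's rule for multisets: one over \<open>insert x A\<close> either avoids
  \<open>x\<close> or arises by adding a copy of \<open>x\<close> to a smaller one.\<close>

lemma card_multisets_of_size:
  assumes "finite A"
  shows "real (card {M. size M = n \<and> set_mset M \<subseteq> A}) = (\<Prod>j<n. real (card A) + real j) / fact n"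
  using assms
proof (induction A arbitrary: n rule: finite_induct)
  case empty
  have "{M :: 'a multiset. size M = n \<and> set_mset M \<subseteq> {}} = (if n = 0 then {{#}} else {})" by auto
  moreover have "(\<Prod>j<n. real j) = 0" if "n \<noteq> 0"
    using that by (intro prod_zero) (auto intro!: bexI[of _ 0])
  ultimately show ?case by simp
next
  case (insert x A)
  show ?case
  proof (induction n)
    case 0
    have "{M :: 'a multiset. size M = 0 \<and> set_mset M \<subseteq> insert x A} = {{#}}" by auto
    then show ?case by simp
  next
    case (Suc n)
    let ?T = "\<lambda>n A. {M :: 'a multiset. size M = n \<and> set_mset M \<subseteq> A}"
    have split: "?T (Suc n) (insert x A) = ?T (Suc n) A \<union> add_mset x ` ?T n (insert x A)"
    proof
      show "?T (Suc n) (insert x A) \<subseteq> ?T (Suc n) A \<union> add_mset x ` ?T n (insert x A)"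
      proof
        fix M assume M: "M \<in> ?T (Suc n) (insert x A)"
        show "M \<in> ?T (Suc n) A \<union> add_mset x ` ?T n (insert x A)"
        proof (cases "x \<in># M")
          case True
          then obtain M' where "M = add_mset x M'" by (metis insert_DiffM)
          with M show ?thesis by auto
        qed (use M in auto)
      qed
    qed auto
    have "card (?T (Suc n) (insert x A)) = card (?T (Suc n) A) + card (add_mset x ` ?T n (insert x A))"
      unfolding split using insert.hyps finite_multisets_of_size
      by (intro card_Un_disjoint finite_imageI) auto
    also have "card (add_mset x ` ?T n (insert x A)) = card (?T n (insert x A))"
      by (intro card_image inj_onI) simp
    finally have "real (card (?T (Suc n) (insert x A))) =
        (\<Prod>j<Suc n. real (card A) + real j) / fact (Suc n) + (\<Prod>j<n. real (card (insert x A)) + real j) / fact n"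
      using insert.IH Suc.IH by simp
    also have "(\<Prod>j<Suc n. real (card A) + real j) = real (card A) * (\<Prod>j<n. real (card (insert x A)) + real j)"
      using insert.hyps by (simp add: prod.lessThan_Suc_shift ac_simps del: prod.lessThan_Suc)
    also have "real (card A) * (\<Prod>j<n. real (card (insert x A)) + real j) / fact (Suc n) +
        (\<Prod>j<n. real (card (insert x A)) + real j) / fact n =
        (\<Prod>j<Suc n. real (card (insert x A)) + real j) / fact (Suc n)"
      using insert.hyps by (simp add: divide_simps) (simp add: algebra_simps)
    finally show ?case .
  qed
qed

text \<open>The multisets with multiplicities at most \<open>D + 1\<close> are classified by the set \<open>U\<close> of elements
  with multiplicity exactly \<open>D + 1\<close>.\<close>

lemma card_slim_multisets_Suc:
  assumes A: "finite A"
  shows "card (slim_multisets (Suc D) A n) =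
    (\<Sum>U | U \<subseteq> A \<and> Suc D * card U \<le> n. card (slim_multisets D (A - U) (n - Suc D * card U)))"
proof -
  let ?I = "{U. U \<subseteq> A \<and> Suc D * card U \<le> n}"
  let ?R = "\<lambda>U. repeat_mset (Suc D) (mset_set U)"
  let ?f = "\<lambda>U. (\<lambda>M. M + ?R U) ` slim_multisets D (A - U) (n - Suc D * card U)"
  have cR: "count (?R U) z = (if z \<in> U then Suc D else 0)" if "U \<subseteq> A" for U z
    using that A finite_subset[OF that A] by (simp add: count_mset_set')
  \<comment> \<open>\<open>U\<close> is recovered from the multiset, which makes the pieces
    disjoint: its elements have no further copies, and all others stay below
    \<open>Suc D\<close>.\<close>
  have top: "{z. count M z = Suc D} = U" if UA: "U \<subseteq> A" and MU: "M \<in> ?f U" for U M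
  proof -
    obtain M' where M': "M = M' + ?R U" "M' \<in> slim_multisets D (A - U) (n - Suc D * card U)"
      using MU by blast
    have "count M' z = 0" if "z \<in> U" for z
      using M'(2) that by (auto simp: slim_multisets_def not_in_iff[symmetric])
    moreover have "count M' z \<le> D" for z using M'(2) by (simp add: slim_multisets_def)
    then have "count M' z \<noteq> Suc D" for z by (metis Suc_n_not_le_n)
    ultimately have "count M z = Suc D \<longleftrightarrow> z \<in> U" for z
      unfolding M'(1) count_union cR[OF UA] by simp
    then show ?thesis by blast
  qed
  have eq: "slim_multisets (Suc D) A n = (\<Union>U\<in>?I. ?f U)"
  proof
    show "slim_multisets (Suc D) A n \<subseteq> (\<Union>U\<in>?I. ?f U)"
    proof
      fix M assume M: "M \<in> slim_multisets (Suc D) A n"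
      define U where "U = {z. count M z = Suc D}"
      have UA: "U \<subseteq> A"
      proof
        fix z assume "z \<in> U"
        then have "z \<in># M" by (simp add: U_def flip: count_greater_zero_iff)
        then show "z \<in> A" using M by (auto simp: slim_multisets_def)
      qed
      have le: "?R U \<subseteq># M" by (rule mset_subset_eqI) (simp only: cR[OF UA], simp add: U_def)
      have "size (?R U) = Suc D * card U" by simp
      then have size: "Suc D * card U \<le> n" using size_mset_mono[OF le] M by (simp add: slim_multisets_def)
      have "M - ?R U \<in> slim_multisets D (A - U) (n - Suc D * card U)"
        unfolding slim_multisets_def mem_Collect_eq
      proof (intro conjI allI subsetI)
        show "size (M - ?R U) = n - Suc D * card U"
          using M size_Diff_submset[OF le] by (simp add: slim_multisets_def)
        have c: "count (M - ?R U) z = (if z \<in> U then 0 else count M z)" for z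
          using cR[OF UA, of z] by (simp add: U_def del: repeat_mset_Suc count_repeat_mset)
        show "z \<in> A - U" if "z \<in># M - ?R U" for z
        proof -
          have "count (M - ?R U) z > 0" using that by (simp only: count_greater_zero_iff)
          then have "z \<notin> U" "z \<in># M" unfolding c by (simp_all split: if_splits)
          then show ?thesis using M by (auto simp: slim_multisets_def)
        qed
        show "count (M - ?R U) z \<le> D" for z
        proof -
          have "count M z \<le> Suc D" using M by (simp add: slim_multisets_def)
          then show ?thesis unfolding c by (auto simp: U_def)
        qed
      qed
      moreover have "M = (M - ?R U) + ?R U" using le by (simp only: subset_mset.diff_add)
      ultimately have "M \<in> ?f U" by blast
      with UA size show "M \<in> (\<Union>U\<in>?I. ?f U)" by blast
    qed
    show "(\<Union>U\<in>?I. ?f U) \<subseteq> slim_multisets (Suc D) A n"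
    proof clarify
      fix U M assume U: "U \<subseteq> A" "Suc D * card U \<le> n" and M: "M \<in> slim_multisets D (A - U) (n - Suc D * card U)"
      have finU: "finite U" using U A finite_subset by blast
      have "size (?R U) = Suc D * card U" by simp
      then have "size (M + ?R U) = n" using U M by (simp add: slim_multisets_def)
      moreover have "set_mset (M + ?R U) \<subseteq> A"
      proof
        fix z assume "z \<in># M + ?R U"
        then have "count M z + count (?R U) z > 0" by (simp only: count_greater_zero_iff count_union[symmetric])
        then have "z \<in># M \<or> z \<in> U" unfolding cR[OF U(1)] by (auto split: if_splits)
        then show "z \<in> A" using U M by (auto simp: slim_multisets_def)
      qed
      moreover have "count (M + ?R U) z \<le> Suc D" for z
      proof (cases "z \<in> U")
        case True
        then have "count M z = 0" using M by (auto simp: slim_multisets_def not_in_iff[symmetric])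
        with True show ?thesis by (simp only: count_union cR[OF U(1)]) simp
      next
        case False
        have "count M z \<le> D" using M by (simp add: slim_multisets_def)
        with False show ?thesis by (simp only: count_union cR[OF U(1)]) simp
      qed
      ultimately show "M + ?R U \<in> slim_multisets (Suc D) A n" unfolding slim_multisets_def by blast
    qed
  qed
  have "card (slim_multisets (Suc D) A n) = (\<Sum>U\<in>?I. card (?f U))"
    unfolding eq
  proof (rule card_UN_disjoint)
    show "finite ?I" using A by (intro finite_subset[of ?I "Pow A"]) auto
    show "\<forall>U\<in>?I. finite (?f U)" using A by (auto intro!: finite_imageI finite_slim_multisets)
    show "\<forall>U\<in>?I. \<forall>V\<in>?I. U \<noteq> V \<longrightarrow> ?f U \<inter> ?f V = {}"
    proof (intro ballI impI equals0I)
      fix U V M assume "U \<in> ?I" "V \<in> ?I" "U \<noteq> V" "M \<in> ?f U \<inter> ?f V"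
      then show False using top[of U M] top[of V M] by simp
    qed
  qed
  also have "\<dots> = (\<Sum>U\<in>?I. card (slim_multisets D (A - U) (n - Suc D * card U)))"
    by (intro sum.cong card_image inj_onI refl) simp
  finally show ?thesis .
qed

text \<open>The sum of the theorem for \<open>D = d - 1\<close>. Here \<open>\<alpha> i\<close> is
  the number of elements of multiplicity \<open>i\<close>, and a summand counts the choices of
  disjoint sets of these sizes. The range \<open>{..n}\<close> keeps the index set finite and loses
  no solution, as \<open>i * \<alpha> i \<le> n\<close>.\<close>

definition slim_poly :: "nat \<Rightarrow> real \<Rightarrow> nat \<Rightarrow> real" where
  "slim_poly D x n = (\<Sum>\<alpha>\<in>{\<alpha> \<in> {1..D} \<rightarrow>\<^sub>E {..n}. (\<Sum>i\<in>{1..D}. i * \<alpha> i) = n}.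
     (\<Prod>j<(\<Sum>i\<in>{1..D}. \<alpha> i). x - real j) / (\<Prod>i\<in>{1..D}. fact (\<alpha> i)))"

lemma falling_prod_add:
  "(\<Prod>j<a + b. x - real j) = (\<Prod>j<a. x - real j) * (\<Prod>j<b. (x - real a) - real j)"
  by (induction b) (auto simp: algebra_simps)

lemma slim_poly_0: "slim_poly 0 x n = (if n = 0 then 1 else 0)"
proof -
  have "{\<alpha> \<in> {1..0::nat} \<rightarrow>\<^sub>E {..n}. (\<Sum>i\<in>{1..0}. i * \<alpha> i) = n} = (if n = 0 then {\<lambda>_. undefined} else {})" by auto
  then show ?thesis by (simp add: slim_poly_def)
qed

text \<open>Splits off the last exponent \<open>j\<close>; the result has the shape of the recursion
  for the number of slim multisets, with \<open>j\<close> in the role of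
  \<open>card U\<close>.\<close>

lemma slim_poly_Suc:
  "slim_poly (Suc D) x n =
    (\<Sum>j | Suc D * j \<le> n. (\<Prod>i<j. x - real i) / fact j * slim_poly D (x - real j) (n - Suc D * j))"
proof -
  let ?S = "\<lambda>D n. {\<alpha> \<in> {1..D} \<rightarrow>\<^sub>E {..n}. (\<Sum>i\<in>{1..D}. i * \<alpha> i) = n}"
  let ?t = "\<lambda>D x \<alpha>. (\<Prod>j<(\<Sum>i\<in>{1..D}. \<alpha> i). x - real j) / (\<Prod>i\<in>{1..D}. fact (\<alpha> i))"
  let ?J = "{j. Suc D * j \<le> n}"
  have finJ: "finite ?J" by (rule finite_subset[of _ "{..n}"]) auto
  have finS: "finite (?S D k)" for k by (intro finite_subset[OF _ finite_PiE[of "{1..D}" "\<lambda>_. {..k}"]]) auto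
  have "slim_poly (Suc D) x n = (\<Sum>(j, \<alpha>)\<in>(SIGMA j:?J. ?S D (n - Suc D * j)).
      (\<Prod>i<j. x - real i) / fact j * ?t D (x - real j) \<alpha>)"
    unfolding slim_poly_def
  \<comment> \<open>Extensional functions are \<open>undefined\<close> outside their index set, so
    dropping the last exponent means resetting it to \<open>undefined\<close>.\<close>
  proof (rule sum.reindex_bij_witness[where i = "\<lambda>(j, \<alpha>). \<alpha>(Suc D := j)"
        and j = "\<lambda>\<alpha>. (\<alpha> (Suc D), \<alpha>(Suc D := undefined))"])
    fix \<alpha> assume \<alpha>: "\<alpha> \<in> ?S (Suc D) n"
    then have sum: "(\<Sum>i\<in>{1..D}. i * \<alpha> i) + Suc D * \<alpha> (Suc D) = n" by simp
    have upd: "(\<Sum>i\<in>{1..D}. g i ((\<alpha>(Suc D := undefined)) i)) = (\<Sum>i\<in>{1..D}. g i (\<alpha> i))"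
      for g :: "nat \<Rightarrow> nat \<Rightarrow> nat" by (intro sum.cong) auto
    have updp: "(\<Prod>i\<in>{1..D}. fact ((\<alpha>(Suc D := undefined)) i)) = (\<Prod>i\<in>{1..D}. fact (\<alpha> i) :: real)"
      by (intro prod.cong) auto
    have le: "\<alpha> i \<le> n - Suc D * \<alpha> (Suc D)" if "i \<in> {1..D}" for i
    proof -
      have "\<alpha> i \<le> i * \<alpha> i" using that by simp
      also have "\<dots> \<le> (\<Sum>i\<in>{1..D}. i * \<alpha> i)" using that by (intro member_le_sum[of i _ "\<lambda>i. i * \<alpha> i"]) auto
      also have "\<dots> = n - Suc D * \<alpha> (Suc D)" using sum by simp
      finally show ?thesis .
    qed
    show "(case (\<alpha> (Suc D), \<alpha>(Suc D := undefined)) of (j, \<alpha>) \<Rightarrow> \<alpha>(Suc D := j)) = \<alpha>" by simp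
    have "\<alpha>(Suc D := undefined) \<in> ?S D (n - Suc D * \<alpha> (Suc D))"
    proof -
      have "\<alpha>(Suc D := undefined) \<in> {1..D} \<rightarrow>\<^sub>E {..n - Suc D * \<alpha> (Suc D)}"
        using \<alpha> le by (auto simp: PiE_iff extensional_def)
      then show ?thesis using sum upd[of "\<lambda>i v. i * v"] by simp
    qed
    then show "(\<alpha> (Suc D), \<alpha>(Suc D := undefined)) \<in> (SIGMA j:?J. ?S D (n - Suc D * j))"
      using sum by simp
    have sums: "(\<Sum>i\<in>{1..Suc D}. \<alpha> i) = \<alpha> (Suc D) + (\<Sum>i\<in>{1..D}. \<alpha> i)"
      "(\<Prod>i\<in>{1..Suc D}. fact (\<alpha> i) :: real) = fact (\<alpha> (Suc D)) * (\<Prod>i\<in>{1..D}. fact (\<alpha> i))" by simp_all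
    show "(case (\<alpha> (Suc D), \<alpha>(Suc D := undefined)) of (j, \<alpha>) \<Rightarrow>
          (\<Prod>i<j. x - real i) / fact j * ?t D (x - real j) \<alpha>) = ?t (Suc D) x \<alpha>"
      unfolding prod.case sums upd[of "\<lambda>i v. v"] updp falling_prod_add times_divide_times_eq ..
  next
    fix p assume p: "p \<in> (SIGMA j:?J. ?S D (n - Suc D * j))"
    obtain j \<alpha> where jp: "p = (j, \<alpha>)" by (cases p)
    have j: "Suc D * j \<le> n" and \<alpha>: "\<alpha> \<in> {1..D} \<rightarrow>\<^sub>E {..n - Suc D * j}" "(\<Sum>i\<in>{1..D}. i * \<alpha> i) = n - Suc D * j"
      using p by (auto simp: jp)
    have un: "\<alpha> (Suc D) = undefined" using \<alpha>(1) by (auto simp: PiE_iff extensional_def)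
    then show "(\<lambda>\<alpha>. (\<alpha> (Suc D), \<alpha>(Suc D := undefined))) (case p of (j, \<alpha>) \<Rightarrow> \<alpha>(Suc D := j)) = p"
      by (auto simp: jp)
    have jn: "j \<le> n" using j by (metis le_add1 le_trans mult_Suc)
    have "(\<Sum>i\<in>{1..D}. i * (\<alpha>(Suc D := j)) i) = (\<Sum>i\<in>{1..D}. i * \<alpha> i)" by (intro sum.cong) auto
    then have "(\<Sum>i\<in>{1..Suc D}. i * (\<alpha>(Suc D := j)) i) = n"
      using \<alpha>(2) j by simp
    moreover have "(\<alpha>(Suc D := j)) i \<le> n" if "i \<in> {1..Suc D}" for i
    proof (cases "i = Suc D")
      case False
      then have "\<alpha> i \<le> n - Suc D * j" using that PiE_mem[OF \<alpha>(1), of i] by simp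
      then show ?thesis using False by simp
    qed (simp add: jn)
    moreover have "\<alpha>(Suc D := j) \<in> extensional {1..Suc D}"
      using \<alpha>(1) by (auto simp: PiE_iff extensional_def)
    ultimately show "(case p of (j, \<alpha>) \<Rightarrow> \<alpha>(Suc D := j)) \<in> ?S (Suc D) n"
      by (simp add: jp PiE_iff)
  qed
  also have "\<dots> = (\<Sum>j\<in>?J. \<Sum>\<alpha>\<in>?S D (n - Suc D * j). (\<Prod>i<j. x - real i) / fact j * ?t D (x - real j) \<alpha>)"
    using finJ finS by (intro sum.Sigma[symmetric]) auto
  also have "\<dots> = (\<Sum>j\<in>?J. (\<Prod>i<j. x - real i) / fact j * slim_poly D (x - real j) (n - Suc D * j))"
    by (simp add: slim_poly_def sum_distrib_left)
  finally show ?thesis .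
qed

lemma sum_subsets_by_card:
  fixes f :: "nat \<Rightarrow> 'b::comm_semiring_1"
  assumes "finite A"
  shows "(\<Sum>U | U \<subseteq> A \<and> P (card U). f (card U)) = (\<Sum>k | k \<le> card A \<and> P k. of_nat (card A choose k) * f k)"
proof -
  let ?I = "{U. U \<subseteq> A \<and> P (card U)}" and ?K = "{k. k \<le> card A \<and> P k}"
  have "finite ?I" using assms by (intro finite_subset[of ?I "Pow A"]) auto
  moreover have "card ` ?I \<subseteq> ?K" using assms by (auto intro: card_mono)
  ultimately have "(\<Sum>U\<in>?I. f (card U)) = (\<Sum>k\<in>?K. \<Sum>U | U \<in> ?I \<and> card U = k. f (card U))"
    by (intro sum.group[symmetric]) auto
  also have "\<dots> = (\<Sum>k\<in>?K. of_nat (card A choose k) * f k)"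
  proof (rule sum.cong[OF refl])
    fix k assume "k \<in> ?K"
    then have "{U. U \<in> ?I \<and> card U = k} = {U. U \<subseteq> A \<and> card U = k}" by auto
    then show "(\<Sum>U | U \<in> ?I \<and> card U = k. f (card U)) = of_nat (card A choose k) * f k"
      using n_subsets[OF assms, of k] by simp
  qed
  finally show ?thesis .
qed

lemma binomial_falling_prod: "real (N choose j) = (\<Prod>i<j. real N - real i) / fact j"
  by (simp add: binomial_gbinomial gbinomial_prod_rev atLeast0LessThan)

lemma card_slim_multisets:
  assumes "finite A"
  shows "real (card (slim_multisets D A n)) = slim_poly D (real (card A)) n"
  using assms
proof (induction D arbitrary: A n)
  case 0
  have "slim_multisets 0 A n = (if n = 0 then {{#}} else {})"
    by (auto simp: slim_multisets_def) (metis multiset_nonemptyE size_empty less_irrefl)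
  then show ?case by (simp add: slim_poly_0)
next
  case (Suc D)
  let ?N = "card A"
  let ?q = "\<lambda>j. slim_poly D (real ?N - real j) (n - Suc D * j)"
  have "real (card (slim_multisets (Suc D) A n)) =
      (\<Sum>U | U \<subseteq> A \<and> Suc D * card U \<le> n. real (card (slim_multisets D (A - U) (n - Suc D * card U))))"
    by (simp only: card_slim_multisets_Suc[OF Suc.prems] of_nat_sum)
  also have "\<dots> = (\<Sum>U | U \<subseteq> A \<and> Suc D * card U \<le> n. ?q (card U))"
  proof (rule sum.cong[OF refl])
    fix U assume "U \<in> {U. U \<subseteq> A \<and> Suc D * card U \<le> n}"
    then have U: "U \<subseteq> A" by blast
    then have "real (card (A - U)) = real ?N - real (card U)"
      using Suc.prems by (simp add: card_Diff_subset finite_subset of_nat_diff card_mono)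
    then show "real (card (slim_multisets D (A - U) (n - Suc D * card U))) = ?q (card U)"
      using Suc.IH[of "A - U" "n - Suc D * card U"] Suc.prems by simp
  qed
  also have "\<dots> = (\<Sum>k | k \<le> ?N \<and> Suc D * k \<le> n. real (?N choose k) * ?q k)"
    by (rule sum_subsets_by_card[OF Suc.prems])
  \<comment> \<open>Terms with \<open>k > card A\<close> vanish through the binomial coefficient, so
    the summation range can be made independent of \<open>A\<close>.\<close>
  also have "\<dots> = (\<Sum>k | Suc D * k \<le> n. real (?N choose k) * ?q k)"
  proof (rule sum.mono_neutral_left)
    show "finite {k. Suc D * k \<le> n}" by (rule finite_subset[of _ "{..n}"]) auto
  qed auto
  also have "\<dots> = slim_poly (Suc D) (real ?N) n"
    by (simp add: slim_poly_Suc binomial_falling_prod)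
  finally show ?case .
qed

definition fat_poly :: "nat \<Rightarrow> nat \<Rightarrow> real \<Rightarrow> real" where
  "fat_poly d n x = (\<Prod>j<n. x + real j) / fact n - slim_poly (d - 1) x n"

lemma card_fat_multisets:
  assumes "finite A" "1 \<le> d"
  shows "real (card (fat_multisets d A n)) = fat_poly d n (real (card A))"
proof -
  let ?T = "{M. size M = n \<and> set_mset M \<subseteq> A}"
  have "fat_multisets d A n = ?T - slim_multisets (d - 1) A n"
  proof -
    have "d \<le> c \<longleftrightarrow> \<not> c \<le> d - 1" for c using assms(2) by linarith
    then show ?thesis unfolding fat_multisets_def slim_multisets_def by blast
  qed
  moreover have "slim_multisets (d - 1) A n \<subseteq> ?T" by (auto simp: slim_multisets_def)
  ultimately have "real (card (fat_multisets d A n)) = real (card ?T) - real (card (slim_multisets (d - 1) A n))"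
    using finite_multisets_of_size[OF assms(1), of n] finite_slim_multisets[OF assms(1)]
    by (simp add: card_Diff_subset of_nat_diff card_mono)
  then show ?thesis
    by (simp add: fat_poly_def card_multisets_of_size[OF assms(1)] card_slim_multisets[OF assms(1)])
qed

subsection \<open>Grids\<close>

context
  fixes \<S> :: "nat set set" and N d n :: nat
  assumes down: "\<And>S T. S \<in> \<S> \<Longrightarrow> T \<subseteq> S \<Longrightarrow> T \<in> \<S>"
    and d: "1 \<le> d" and n: "1 \<le> n"
begin

text \<open>Replacing levels by their ranks in \<open>W\<close>, with inverse \<open>unrank\<close>,
  turns these multisets into nondegenerate ones: every simplex is a degeneracy of a unique
  nondegenerate one.\<close>

lemma card_grid_multisets_with_values:
  assumes W: "W \<subseteq> {..Suc m}" "0 \<in> W" "Suc m \<in> W" "card W = k + 2"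
  shows "card {\<tau> \<in> fat_multisets d (grids \<S> N m) n. value_set \<tau> = W} = card (cells \<S> N d n k)"
proof -
  have fin: "finite W" using W(1) finite_subset by blast
  have W': "{..Suc k} = {..<card W}" using W(4) by auto
  have r0: "rank_in W 0 = 0" by (simp add: rank_in_def)
  have "{u \<in> W. u < Suc m} = W - {Suc m}" using W(1) by auto
  then have r1: "rank_in W (Suc m) = Suc k" using W(3,4) fin by (simp add: rank_in_def)
  have u0: "unrank W 0 = 0" using unrank_rank[OF fin W(2)] by (simp add: r0)
  have u1: "unrank W (Suc k) = Suc m" using unrank_rank[OF fin W(3)] by (simp add: r1)
  have ur: "unrank W v \<le> unrank W w" if "v \<in> {..Suc k}" "w \<in> {..Suc k}" "v \<le> w" for v w
    using unrank_strict_mono[OF fin, of v w] that W(4) by (cases "v = w") auto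
  have inv: "image_mset (\<lambda>a. g \<circ> a) (image_mset (\<lambda>a. f \<circ> a) \<tau>) = \<tau>"
    if "\<And>w. w \<in> value_set \<tau> \<Longrightarrow> g (f w) = w" for f g and \<tau> :: "(nat \<Rightarrow> nat) multiset"
  proof -
    have "image_mset (\<lambda>a. g \<circ> (f \<circ> a)) \<tau> = image_mset id \<tau>"
    proof (rule image_mset_cong)
      fix a assume "a \<in># \<tau>"
      then have "a i \<in> value_set \<tau>" for i by (auto simp: value_set_def)
      then show "g \<circ> (f \<circ> a) = id a" by (simp add: fun_eq_iff that)
    qed
    then show ?thesis by (simp add: multiset.map_comp o_def)
  qed
  have "bij_betw (image_mset (\<lambda>a. rank_in W \<circ> a))
      {\<tau> \<in> fat_multisets d (grids \<S> N m) n. value_set \<tau> = W} (cells \<S> N d n k)"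
  proof (rule bij_betw_byWitness[where f' = "image_mset (\<lambda>a. unrank W \<circ> a)"])
    show "\<forall>\<tau>\<in>{\<tau> \<in> fat_multisets d (grids \<S> N m) n. value_set \<tau> = W}.
        image_mset (\<lambda>a. unrank W \<circ> a) (image_mset (\<lambda>a. rank_in W \<circ> a) \<tau>) = \<tau>"
      using unrank_rank[OF fin] by (auto intro!: inv)
    show "\<forall>\<tau>\<in>cells \<S> N d n k. image_mset (\<lambda>a. rank_in W \<circ> a) (image_mset (\<lambda>a. unrank W \<circ> a) \<tau>) = \<tau>"
    proof
      fix \<tau> assume "\<tau> \<in> cells \<S> N d n k"
      then have "value_set \<tau> = {..<card W}" using down d n W' by (simp add: cells_def)
      then show "image_mset (\<lambda>a. rank_in W \<circ> a) (image_mset (\<lambda>a. unrank W \<circ> a) \<tau>) = \<tau>"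
        using rank_unrank[OF fin] by (intro inv) auto
    qed
    show "image_mset (\<lambda>a. rank_in W \<circ> a) ` {\<tau> \<in> fat_multisets d (grids \<S> N m) n. value_set \<tau> = W} \<subseteq> cells \<S> N d n k"
    proof clarify
      fix \<tau> assume \<tau>: "\<tau> \<in> fat_multisets d (grids \<S> N m) n" "W = value_set \<tau>"
      have "image_mset (\<lambda>a. rank_in W \<circ> a) \<tau> \<in> fat_multisets d (grids \<S> N k) n"
      proof (rule image_mset_fat_multisets[OF \<tau>(1)])
        fix a assume a: "a \<in> grids \<S> N m"
        show "rank_in W \<circ> a \<in> grids \<S> N k"
          by (rule staircases_compose[where W = UNIV, OF down a]) (simp_all add: r0 r1 rank_in_mono fin)
      qed
      moreover have "value_set (image_mset (\<lambda>a. rank_in W \<circ> a) \<tau>) = {..Suc k}"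
        unfolding value_set_image_mset W' using rank_in_image[OF fin] \<tau>(2) by simp
      ultimately show "image_mset (\<lambda>a. rank_in (value_set \<tau>) \<circ> a) \<tau> \<in> cells \<S> N d n k"
        using down d n \<tau>(2) by (simp add: cells_def)
    qed
    show "image_mset (\<lambda>a. unrank W \<circ> a) ` cells \<S> N d n k \<subseteq> {\<tau> \<in> fat_multisets d (grids \<S> N m) n. value_set \<tau> = W}"
    proof
      fix \<sigma> assume "\<sigma> \<in> image_mset (\<lambda>a. unrank W \<circ> a) ` cells \<S> N d n k"
      then obtain \<tau> where \<sigma>: "\<sigma> = image_mset (\<lambda>a. unrank W \<circ> a) \<tau>" and
        \<tau>: "\<tau> \<in> fat_multisets d (grids \<S> N k) n" "value_set \<tau> = {..Suc k}"
        using down d n by (auto simp: cells_def)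
      have "\<sigma> \<in> fat_multisets d (grids \<S> N m) n"
        unfolding \<sigma>
      proof (rule image_mset_fat_multisets[OF \<tau>(1)])
        fix a assume a: "a \<in> grids \<S> N k"
        have "range a \<subseteq> {..Suc k}" using staircases_range(1)[OF a] by auto
        then show "unrank W \<circ> a \<in> grids \<S> N m"
          by (intro staircases_compose[where W = "{..Suc k}", OF down a]) (simp_all add: u0 u1 ur)
      qed
      moreover have "value_set \<sigma> = W"
        unfolding \<sigma> value_set_image_mset \<tau>(2) W' by (rule unrank_image[OF fin])
      ultimately show "\<sigma> \<in> {\<tau> \<in> fat_multisets d (grids \<S> N m) n. value_set \<tau> = W}" by blast
    qed
  qed
  then show ?thesis by (rule bij_betw_same_card)
qed

text \<open>Levels 0 and \<open>Suc m\<close> always occur; the other \<open>k\<close> levels form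
  an arbitrary subset of \<open>{1..m}\<close>, which explains \<open>m choose k\<close>.\<close>

lemma card_grid_multisets:
  "card (fat_multisets d (grids \<S> N m) n) = (\<Sum>k<n * Suc N. (m choose k) * card (cells \<S> N d n k))"
proof -
  let ?G = "fat_multisets d (grids \<S> N m) n"
  let ?c = "\<lambda>k. card (cells \<S> N d n k)"
  define w where "w = (\<lambda>R. {0, Suc m} \<union> R)"
  have finG: "finite ?G" by (intro finite_fat_multisets finite_staircases)
  have "value_set \<tau> \<in> w ` Pow {1..m}" if \<tau>: "\<tau> \<in> ?G" for \<tau>
  proof -
    have "value_set \<tau> = w (value_set \<tau> \<inter> {1..m})"
      using value_set_staircases[OF \<tau> n] by (auto simp: w_def)
    then show ?thesis by blast
  qed
  then have sub: "value_set ` ?G \<subseteq> w ` Pow {1..m}" by (rule image_subsetI)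
  have "card ?G = (\<Sum>W\<in>w ` Pow {1..m}. card {\<tau> \<in> ?G. value_set \<tau> = W})"
    using sum.group[OF finG _ sub, of "\<lambda>_. 1::nat"] by simp
  also have "\<dots> = (\<Sum>R\<in>Pow {1..m}. card {\<tau> \<in> ?G. value_set \<tau> = w R})"
  proof (rule sum.reindex_cong[OF _ refl refl])
    show "inj_on w (Pow {1..m})"
      by (rule inj_on_inverseI[where g = "\<lambda>W. W \<inter> {1..m}"]) (auto simp: w_def)
  qed
  also have "\<dots> = (\<Sum>R\<in>Pow {1..m}. ?c (card R))"
  proof (rule sum.cong[OF refl])
    fix R assume R: "R \<in> Pow {1..m}"
    then have "finite R" by (auto intro: finite_subset)
    moreover have "0 \<notin> R" "Suc m \<notin> R" using R by auto
    ultimately have "card (w R) = card R + 2" by (simp add: w_def)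
    then show "card {\<tau> \<in> ?G. value_set \<tau> = w R} = ?c (card R)"
      using R by (intro card_grid_multisets_with_values) (auto simp: w_def)
  qed
  also have "\<dots> = (\<Sum>k | k \<le> m. (m choose k) * ?c k)"
    using sum_subsets_by_card[where A = "{1..m}" and P = "\<lambda>_. True" and f = ?c] by (simp add: Pow_def)
  \<comment> \<open>The range is first enlarged, where \<open>m choose k\<close> vanishes, and then
    cut to the dimensions of existing cells. The final bound is independent of \<open>m\<close>, so
    the count is a polynomial in \<open>m\<close>.\<close>
  also have "\<dots> = (\<Sum>k<Suc m + n * Suc N. (m choose k) * ?c k)"
    by (intro sum.mono_neutral_left) auto
  also have "\<dots> = (\<Sum>k<n * Suc N. (m choose k) * ?c k)"
    using cells_empty[of \<S> d n N, OF down d n] by (intro sum.mono_neutral_right) (auto simp: not_less)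
  finally show ?thesis .
qed

end

section \<open>The instance d = n = 1, which recovers the space itself\<close>

lemma fat_multisets_singletons: "fat_multisets 1 A 1 = (\<lambda>x. {#x#}) ` A"
proof
  show "fat_multisets 1 A 1 \<subseteq> (\<lambda>x. {#x#}) ` A"
  proof
    fix M assume M: "M \<in> fat_multisets 1 A 1"
    then obtain x where "M = {#x#}"
      using size_1_singleton_mset[of M] by (auto simp: fat_multisets_def)
    with M show "M \<in> (\<lambda>x. {#x#}) ` A" by (auto simp: fat_multisets_def)
  qed
qed (auto simp: fat_multisets_def intro!: exI)

lemma card_fat_multisets_singletons: "card (fat_multisets 1 A 1) = card A"
  unfolding fat_multisets_singletons by (intro card_image inj_onI) simp

lemma homeomorphic_Bd_space_1: "X homeomorphic_space Bd_space 1 X 1"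
proof -
  define g where "g = (\<lambda>M :: 'a multiset. THE x. M = {#x#})"
  have g: "g {#x#} = x" for x by (simp add: g_def)
  have sq: "sym_quot 1 x = {#x 0#}" for x :: "nat \<Rightarrow> 'a" by (simp add: sym_quot_def lessThan_Suc)
  have "continuous_map X (product_topology (\<lambda>i. X) {..<1}) (\<lambda>x. restrict (\<lambda>_. x) {..<1::nat})"
    unfolding continuous_map_componentwise
  proof (intro conjI ballI)
    fix i assume "i \<in> {..<1::nat}"
    then show "continuous_map X X (\<lambda>x. restrict (\<lambda>_. x) {..<1} i)" by simp
  qed auto
  moreover have "continuous_map (product_topology (\<lambda>i. X) {..<1}) (symprod 1 X) (sym_quot 1)"
    unfolding symprod_def by (rule quotient_imp_continuous_map[OF quotient_map_quotient_topology])
  ultimately have "continuous_map X (symprod 1 X) (sym_quot 1 \<circ> (\<lambda>x. restrict (\<lambda>_. x) {..<1::nat}))"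
    by (rule continuous_map_compose)
  then have "continuous_map X (symprod 1 X) (\<lambda>x. {#x#})" by (simp add: o_def sq del: One_nat_def)
  then have f: "continuous_map X (Bd_space 1 X 1) (\<lambda>x. {#x#})"
    by (simp add: Bd_space_eq continuous_map_in_subtopology fat_multisets_singletons del: One_nat_def)
  have "continuous_map (product_topology (\<lambda>i. X) {..<1}) X (\<lambda>x. x (0::nat))"
    by (intro continuous_map_product_projection) simp
  then have "continuous_map (product_topology (\<lambda>i. X) {..<1}) X (g \<circ> sym_quot 1)"
    by (simp add: o_def sq g del: One_nat_def)
  then have "continuous_map (symprod 1 X) X g"
    unfolding symprod_def by (rule continuous_compose_quotient_map[OF quotient_map_quotient_topology])
  then have "continuous_map (Bd_space 1 X 1) X g"
    unfolding Bd_space_def by (rule continuous_map_from_subtopology)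
  with f have "homeomorphic_maps X (Bd_space 1 X 1) (\<lambda>x. {#x#}) g"
    by (auto simp: homeomorphic_maps_def topspace_Bd_space fat_multisets_singletons g simp del: One_nat_def)
  then show ?thesis unfolding homeomorphic_space_def by blast
qed

subsection \<open>Polynomial identities\<close>

lemma real_polynomial_function_eq_if_eq_on_nat:
  fixes f g :: "real \<Rightarrow> real"
  assumes "real_polynomial_function f" "real_polynomial_function g" "\<And>m :: nat. f (real m) = g (real m)"
  shows "f x = g x"
proof -
  obtain a k where h: "(\<lambda>x. f x - g x) = (\<lambda>x. \<Sum>i\<le>k. a i * x ^ i)"
    using real_polynomial_function_imp_sum[OF real_polynomial_function_diff[OF assms(1,2)]] by blast
  have "(\<Sum>i\<le>k. a i * real m ^ i) = 0" for m
    using fun_cong[OF h, of "real m"] assms(3)[of m] by simp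
  then have "range real \<subseteq> {x. (\<Sum>i\<le>k. a i * x ^ i) = 0}" by blast
  moreover have "infinite (range real)" by (simp add: finite_image_iff inj_on_def)
  ultimately have "infinite {x. (\<Sum>i\<le>k. a i * x ^ i) = 0}" using finite_subset by blast
  then have "\<forall>i\<le>k. a i = 0" using polyfun_finite_roots[of a k] by blast
  then show ?thesis using fun_cong[OF h, of x] by simp
qed

lemma real_polynomial_function_id: "real_polynomial_function (\<lambda>x. x)"
  by (rule real_polynomial_function.intros(1)) (rule bounded_linear_ident)

lemma real_polynomial_function_gbinomial: "real_polynomial_function (\<lambda>x. x gchoose k)"
  unfolding gbinomial_prod_rev
  by (intro real_polynomial_function_divide real_polynomial_function_prod real_polynomial_function_diff
      real_polynomial_function_id real_polynomial_function.intros(2)) simp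

lemma real_polynomial_function_slim_poly: "real_polynomial_function (\<lambda>x. slim_poly D x n)"
proof -
  have "finite {\<alpha> \<in> {1..D} \<rightarrow>\<^sub>E {..n}. (\<Sum>i\<in>{1..D}. i * \<alpha> i) = n}"
    by (intro finite_subset[OF _ finite_PiE[of "{1..D}" "\<lambda>_. {..n}"]]) auto
  then show ?thesis
    unfolding slim_poly_def
    by (intro real_polynomial_function_sum real_polynomial_function_divide real_polynomial_function_prod
        real_polynomial_function_diff real_polynomial_function_id real_polynomial_function.intros(2)) simp_all
qed

lemma real_polynomial_function_fat_poly: "real_polynomial_function (fat_poly d n)"
  unfolding fat_poly_def[abs_def]
  by (intro real_polynomial_function_diff real_polynomial_function_slim_poly real_polynomial_function_divide
      real_polynomial_function_prod real_polynomial_function.intros(3) real_polynomial_function_id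
      real_polynomial_function.intros(2)) simp

text \<open>\<open>card (grids \<S> N m)\<close> and \<open>card (fat_multisets d (grids \<S> N m) n)\<close> are polynomials in \<open>m\<close> which at
  \<open>m = -1\<close> take the values \<open>\<chi>(X)\<close> and \<open>\<chi>(B\<^sub>d(X, n))\<close>, because \<open>(-1 gchoose k) = (-1)\<^sup>k\<close>.\<close>

theorem euler_char_Bd_staircases:
  fixes \<S> :: "nat set set" and N d n :: nat
  assumes down: "\<And>S T. S \<in> \<S> \<Longrightarrow> T \<subseteq> S \<Longrightarrow> T \<in> \<S>" and d: "1 \<le> d" and n: "1 \<le> n"
  defines "M \<equiv> top_of_set (staircases \<S> N (0::real) 1)"
  shows "finite_homology (Bd_space d M n)" "finite_homology M"
    "real_of_int (euler_char (Bd_space d M n)) = fat_poly d n (real_of_int (euler_char M))"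
proof -
  \<comment> \<open>Kept general in \<open>d\<close> and \<open>n\<close>, because the instance
    \<open>C 1 1\<close> counts the simplices of the space itself.\<close>
  define C where "C = (\<lambda>d n x. \<Sum>k<n * Suc N. (x gchoose k) * real (card (cells \<S> N d n k)))"
  have poly_C: "real_polynomial_function (C d n)" for d n
    unfolding C_def
    by (intro real_polynomial_function_sum real_polynomial_function.intros(4) real_polynomial_function_gbinomial
        real_polynomial_function.intros(2)) simp
  have count: "real (card (fat_multisets d (grids \<S> N m) n)) = C d n (real m)"
    if "1 \<le> d" "1 \<le> n" for d n m
  proof -
    have "card (fat_multisets d (grids \<S> N m) n) = (\<Sum>k<n * Suc N. (m choose k) * card (cells \<S> N d n k))"
      by (rule card_grid_multisets[OF _ that]) (use down in blast)
    then show ?thesis unfolding C_def by (simp only: of_nat_sum of_nat_mult binomial_gbinomial)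
  qed
  have points: "finite_homology (Bd_space d M n) \<and>
      euler_char (Bd_space d M n) = (\<Sum>m<n * Suc N. (-1) ^ m * int (card (cells \<S> N d n m)))"
    if "1 \<le> d" "1 \<le> n" for d n
    unfolding M_def by (rule euler_char_Bd_points[OF _ that]) (use down in blast)
  have minus1: "((-1::real) gchoose k) = (-1) ^ k" for k
    using gbinomial_minus[of "1::real" k] by (simp flip: binomial_gbinomial)
  have euler: "real_of_int (euler_char (Bd_space d M n)) = C d n (-1)"
    if "1 \<le> d" "1 \<le> n" for d n
    using points[OF that] by (simp add: C_def minus1)
  \<comment> \<open>Both sides count the fat multisets over the finite set
    \<open>grids \<S> N m\<close>, which has \<open>C 1 1 (real m)\<close> elements.\<close>
  have "fat_poly d n (C 1 1 (real m)) = C d n (real m)" for m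
  proof -
    have "C 1 1 (real m) = real (card (grids \<S> N m))"
      using count[of 1 1 m] by (simp only: card_fat_multisets_singletons order_refl)
    then show ?thesis
      using card_fat_multisets[OF finite_staircases[of \<S> N "Suc m"] d, of n] count[OF d n, of m] by simp
  qed
  moreover have "real_polynomial_function (fat_poly d n \<circ> C 1 1)"
    using poly_C[of 1 1] real_polynomial_function_fat_poly
    by (intro real_polynomial_function_compose) (simp_all only: real_polynomial_function_eq)
  ultimately have eq: "fat_poly d n (C 1 1 (-1)) = C d n (-1)"
    using real_polynomial_function_eq_if_eq_on_nat[of "fat_poly d n \<circ> C 1 1" "C d n" "-1"] poly_C[of d n] by simp
  have fin: "finite_homology (Bd_space d M n)" if "1 \<le> d" "1 \<le> n" for d n
    using points[OF that] by blast
  show "finite_homology (Bd_space d M n)" by (rule fin[OF d n])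
  have M1: "Bd_space 1 M 1 homotopy_equivalent_space M"
    using homeomorphic_Bd_space_1[of M] homeomorphic_imp_homotopy_equivalent_space homotopy_equivalent_space_sym by blast
  note M = finite_homology_homotopy_equivalent[OF M1 fin[OF order_refl order_refl]]
  show "finite_homology M" by (rule M)
  show "real_of_int (euler_char (Bd_space d M n)) = fat_poly d n (real_of_int (euler_char M))"
    using euler[OF d n] euler[of 1 1] M(2) eq by simp
qed

text \<open>At 0 every product contains a zero factor: the rising one as \<open>1 \<le> n\<close>,
  the falling ones because \<open>1 \<le> n\<close> forces some exponent \<open>\<alpha> i\<close>
  to be nonzero.\<close>

lemma fat_poly_0:
  assumes "1 \<le> n"
  shows "fat_poly d n 0 = 0"
proof -
  have z: "(\<Prod>j<k. 0 + real j) = 0" "(\<Prod>j<k. 0 - real j) = 0" if "k \<ge> 1" for k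
    using that by (auto intro!: prod_zero bexI[of _ 0])
  have "(\<Sum>i\<in>{1..d-1}. \<alpha> i) \<ge> 1" if "(\<Sum>i\<in>{1..d-1}. i * \<alpha> i) = n" for \<alpha> :: "nat \<Rightarrow> nat"
  proof (rule ccontr)
    assume "\<not> ?thesis"
    then have "\<forall>i\<in>{1..d-1}. \<alpha> i = 0" by (simp add: not_le)
    then have "(\<Sum>i\<in>{1..d-1}. i * \<alpha> i) = 0" by simp
    with that assms show False by simp
  qed
  then have "slim_poly (d - 1) 0 n = 0"
    unfolding slim_poly_def by (intro sum.neutral) (auto simp del: diff_0 simp: z)
  with z(1)[OF assms] show ?thesis by (simp add: fat_poly_def)
qed

theorem theorem2:
  fixes X :: "'a topology" and d n :: nat
  assumes "\<exists>\<K> :: ('b::euclidean_space) set set.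
             simplicial_complex \<K> \<and> X homotopy_equivalent_space top_of_set (\<Union>\<K>)"
    and "2 \<le> d" and "d \<le> n"
  shows "real_of_int (euler_char (Bd_space d X n)) =
           (\<Prod>j<n. real_of_int (euler_char X) + real j) / fact n
           - (\<Sum>\<alpha>\<in>{\<alpha> \<in> {1..d-1} \<rightarrow>\<^sub>E {..n}. (\<Sum>i\<in>{1..d-1}. i * \<alpha> i) = n}.
                (\<Prod>j<(\<Sum>i\<in>{1..d-1}. \<alpha> i). real_of_int (euler_char X) - real j)
                / (\<Prod>i\<in>{1..d-1}. fact (\<alpha> i)))
         \<and> (euler_char X = 0 \<longrightarrow> euler_char (Bd_space d X n) = 0)"
proof -
  obtain \<K> :: "'b set set" where K: "simplicial_complex \<K>" "X homotopy_equivalent_space top_of_set (\<Union>\<K>)"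
    using assms(1) by blast
  obtain \<S> N where down: "\<And>S T. S \<in> \<S> \<Longrightarrow> T \<subseteq> S \<Longrightarrow> T \<in> \<S>"
    and homeo: "\<Union>\<K> homeomorphic staircases \<S> N (0::real) 1"
    using simplicial_complex_homeomorphic_staircases[OF K(1)] by metis
  define M where "M = top_of_set (staircases \<S> N (0::real) 1)"
  have "top_of_set (\<Union>\<K>) homotopy_equivalent_space M"
    using homeo by (intro homeomorphic_imp_homotopy_equivalent_space) (simp add: M_def)
  then have "X homotopy_equivalent_space M" by (rule homotopy_eqv_trans[OF K(2)])
  then have XM: "M homotopy_equivalent_space X" using homotopy_equivalent_space_sym by blast
  have d: "1 \<le> d" and n: "1 \<le> n" using assms by auto
  have M: "finite_homology (Bd_space d M n)" "finite_homology M"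
    "real_of_int (euler_char (Bd_space d M n)) = fat_poly d n (real_of_int (euler_char M))"
    unfolding M_def by (rule euler_char_Bd_staircases[OF _ d n], use down in blast)+
  have "euler_char X = euler_char M"
    by (rule finite_homology_homotopy_equivalent(2)[OF XM M(2)])
  moreover have "euler_char (Bd_space d X n) = euler_char (Bd_space d M n)"
    by (rule finite_homology_homotopy_equivalent(2)[OF Bd_space_homotopy_equivalent[OF d XM] M(1)])
  ultimately have eq: "real_of_int (euler_char (Bd_space d X n)) = fat_poly d n (real_of_int (euler_char X))"
    using M(3) by simp
  have "euler_char (Bd_space d X n) = 0" if "euler_char X = 0"
  proof -
    have "real_of_int (euler_char (Bd_space d X n)) = 0"
      unfolding eq that of_int_0 by (rule fat_poly_0[OF n])
    then show ?thesis by (simp only: of_int_eq_0_iff)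
  qed
  with eq[unfolded fat_poly_def slim_poly_def] show ?thesis by blast
qed

end
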